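(* The inequivalent (i.e. pairwise non-isomorphic) real $(2,3)$-trivial Lie algebras in dimensions three and four are exactly the following (every $(2,3)$-trivial Lie algebra of dimension three or four is isomorphic to exactly one in the list, and all of these are $(2,3)$-trivial). Dimension three: - $\mathfrak r_3=(0,21+31,31)$; - $\mathfrak r_{3,\lambda}=(0,21,\lambda.31)$, $\lambda\in(-1,1]\setminus\{0\}$; - $\mathfrak r'_{3,\lambda}=(0,\lambda.21+31,-21+\lambda.31)$, $\lambda>0$. Dimension four: - $\mathfrak r_4=(0,21+31,31+41,41)$; - $\mathfrak r_{4,\lambda}=(0,21,\lambda.31+41,\lambda.41)$, $\lambda\neq-1,-\tfrac12,0$; - $\mathfrak r_{4,\mu,\lambda}=(0,21,\mu.31,\lambda.41)$, $(\mu,\lambda)\in\mathscr R$; - $\mathfrak r'_{4,\mu,\lambda}=(0,\mu.21,\lambda.31+41,-31+\lambda.41)$, $\mu>0$, $\lambda\neq-\tfrac\mu2,0$; - $\mathfrak d_{4,\lambda}=(0,\lambda.21,(1-\lambda).31,41+32)$, $\lambda\geqslant\tfrac12$, $\lambda\neq1,2$; - $\mathfrak d'_{4,\lambda}=(0,\lambda.21+31,-21+\lambda.31,2\lambda.41+32)$, $\lambda>0$; - $\mathfrak h_4=(0,21+31,31,2.41+32)$. Here $\mathscr R$ is the set of $(\mu,\lambda)$ with $\mu,\lambda\in(-1,1]\setminus\{0\}$, $\lambda\geqslant\mu$ and $\mu+\lambda\neq0,-1$.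
   Context: A Lie algebra $\mathfrak g$ is $(2,3)$-trivial if $b_2(\mathfrak g)=0=b_3(\mathfrak g)$, where $b_n(\mathfrak g)=\dim H^n(\mathfrak g)$ for Lie algebra cohomology with trivial real coefficients. Notation for Lie algebras: the tuple lists $de_1,\dots,de_n$ for a basis $e_1,\dots,e_n$ of $\mathfrak g^*$, where $d$ is the Chevalley–Eilenberg differential, $ij$ stands for $e_{ij}=e_i\wedge e_j$, and $\lambda.ij$ for $\lambda e_{ij}$. For example $\mathfrak h_4=(0,21+31,31,2.41+32)$ means $de_1=0$, $de_2=e_{21}+e_{31}$, $de_3=e_{31}$, $de_4=2e_{41}+e_{32}$. *)

theory Defs
  imports "HOL-Analysis.Analysis"
begin

section \<open>Real Lie algebras\<close>

definition lie_algebra :: "('a::real_vector \<Rightarrow> 'a \<Rightarrow> 'a) \<Rightarrow> bool" where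
  "lie_algebra br \<longleftrightarrow> bilinear br \<and> (\<forall>x. br x x = 0) \<and>
     (\<forall>x y z. br x (br y z) + br y (br z x) + br z (br x y) = 0)"

definition lie_isomorphic ::
  "('a::real_vector \<Rightarrow> 'a \<Rightarrow> 'a) \<Rightarrow> ('b::real_vector \<Rightarrow> 'b \<Rightarrow> 'b) \<Rightarrow> bool" where
  "lie_isomorphic br br' \<longleftrightarrow>
     (\<exists>f. linear f \<and> bij f \<and> (\<forall>x y. f (br x y) = br' (f x) (f y)))"


section \<open>Lie algebra cohomology with trivial real coefficients\<close>

text \<open>An alternating \<open>n\<close>-form is a function on argument lists, which is set to \<open>0\<close> on lists
  whose length is not \<open>n\<close>, so that equality of forms is equality of functions.\<close>

definition cochains :: "nat \<Rightarrow> ('a::real_vector list \<Rightarrow> real) set" where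
  "cochains n = {\<omega>.
     (\<forall>xs. length xs \<noteq> n \<longrightarrow> \<omega> xs = 0) \<and>
     (\<forall>xs i. length xs = n \<and> i < n \<longrightarrow> linear (\<lambda>x. \<omega> (xs[i := x]))) \<and>
     (\<forall>xs i j. length xs = n \<and> i < j \<and> j < n \<and> xs ! i = xs ! j \<longrightarrow> \<omega> xs = 0)}"

text \<open>The Chevalley--Eilenberg differential. The list \<open>nths xs (- {i, j})\<close> is \<open>xs\<close> with the
  entries at positions \<open>i\<close> and \<open>j\<close> omitted. On 1-forms this is
  \<open>d\<alpha>(x, y) = - \<alpha>([x, y])\<close>.\<close>

definition ce_diff ::
  "('a::real_vector \<Rightarrow> 'a \<Rightarrow> 'a) \<Rightarrow> ('a list \<Rightarrow> real) \<Rightarrow> 'a list \<Rightarrow> real" where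
  "ce_diff br \<omega> xs =
     (\<Sum>j<length xs. \<Sum>i<j. (-1) ^ (i + j) * \<omega> (br (xs ! i) (xs ! j) # nths xs (- {i, j})))"

definition cocycles :: "('a::real_vector \<Rightarrow> 'a \<Rightarrow> 'a) \<Rightarrow> nat \<Rightarrow> ('a list \<Rightarrow> real) set" where
  "cocycles br n = {\<omega> \<in> cochains n. ce_diff br \<omega> = (\<lambda>_. 0)}"

definition coboundaries :: "('a::real_vector \<Rightarrow> 'a \<Rightarrow> 'a) \<Rightarrow> nat \<Rightarrow> ('a list \<Rightarrow> real) set" where
  "coboundaries br n =
     (case n of 0 \<Rightarrow> {\<lambda>_. 0} | Suc m \<Rightarrow> ce_diff br ` cochains m)"

text \<open>For subspaces \<open>W \<subseteq> V\<close> of a space of real functions, \<open>quotient_basis V W S\<close> says that the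
  finite set \<open>S\<close> of representatives projects bijectively onto a basis of \<open>V / W\<close>: every vector is,
  modulo \<open>W\<close>, a unique linear combination of \<open>S\<close>. As for the library's \<^const>\<open>dim\<close>, the dimension
  of an infinite-dimensional quotient is \<open>0\<close> by convention.\<close>

definition quotient_basis ::
  "('b \<Rightarrow> real) set \<Rightarrow> ('b \<Rightarrow> real) set \<Rightarrow> ('b \<Rightarrow> real) set \<Rightarrow> bool" where
  "quotient_basis V W S \<longleftrightarrow> finite S \<and> S \<subseteq> V \<and>
     (\<forall>v\<in>V. \<exists>!c. (\<forall>s. s \<notin> S \<longrightarrow> c s = 0) \<and> (\<lambda>x. v x - (\<Sum>s\<in>S. c s * s x)) \<in> W)"

definition quotient_dim :: "('b \<Rightarrow> real) set \<Rightarrow> ('b \<Rightarrow> real) set \<Rightarrow> nat" where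
  "quotient_dim V W =
     (if \<exists>S. quotient_basis V W S then card (SOME S. quotient_basis V W S) else 0)"

definition betti :: "('a::real_vector \<Rightarrow> 'a \<Rightarrow> 'a) \<Rightarrow> nat \<Rightarrow> nat" where
  "betti br n = quotient_dim (cocycles br n) (coboundaries br n)"

definition trivial_2_3 :: "('a::real_vector \<Rightarrow> 'a \<Rightarrow> 'a) \<Rightarrow> bool" where
  "trivial_2_3 br \<longleftrightarrow> betti br 2 = 0 \<and> betti br 3 = 0"


section \<open>The list of Lie algebras\<close>

text \<open>\<open>ee i j\<close> is the two-form \<open>e\<^sub>i \<and> e\<^sub>j\<close> for the coordinate forms \<open>e\<^sub>i\<close> on \<open>real ^ 'n\<close>.\<close>

definition ee :: "'n::finite \<Rightarrow> 'n \<Rightarrow> real ^ 'n \<Rightarrow> real ^ 'n \<Rightarrow> real" where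
  "ee i j x y = x $ i * y $ j - x $ j * y $ i"

text \<open>The brackets below are given by \<open>[x, y] = - (de\<^sub>1(x, y), \<dots>, de\<^sub>n(x, y))\<close>, since
  \<open>de\<^sub>i(x, y) = - e\<^sub>i([x, y])\<close>. Each label stands for one algebra of the list, so distinct
  parameters give distinct labels. In \<open>R4_mu_lambda\<close> and \<open>R4'_mu_lambda\<close> the first argument is
  \<open>\<mu>\<close> and the second \<open>\<lambda>\<close>.\<close>

datatype lie3 = R3 | R3_lambda real | R3'_lambda real

fun bracket3 :: "lie3 \<Rightarrow> real ^ 3 \<Rightarrow> real ^ 3 \<Rightarrow> real ^ 3" where
  "bracket3 R3 x y = - vector [0, ee 2 1 x y + ee 3 1 x y, ee 3 1 x y]"
| "bracket3 (R3_lambda l) x y = - vector [0, ee 2 1 x y, l * ee 3 1 x y]"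
| "bracket3 (R3'_lambda l) x y =
     - vector [0, l * ee 2 1 x y + ee 3 1 x y, - ee 2 1 x y + l * ee 3 1 x y]"

fun listed3 :: "lie3 \<Rightarrow> bool" where
  "listed3 R3 \<longleftrightarrow> True"
| "listed3 (R3_lambda l) \<longleftrightarrow> l \<in> {-1<..1} - {0}"
| "listed3 (R3'_lambda l) \<longleftrightarrow> l > 0"

definition param_R :: "(real \<times> real) set" where
  "param_R = {(m, l). m \<in> {-1<..1} - {0} \<and> l \<in> {-1<..1} - {0} \<and>
     l \<ge> m \<and> m + l \<noteq> 0 \<and> m + l \<noteq> -1}"

datatype lie4 =
    R4
  | R4_lambda real
  | R4_mu_lambda real real
  | R4'_mu_lambda real real
  | D4_lambda real
  | D4'_lambda real
  | H4

fun bracket4 :: "lie4 \<Rightarrow> real ^ 4 \<Rightarrow> real ^ 4 \<Rightarrow> real ^ 4" where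
  "bracket4 R4 x y =
     - vector [0, ee 2 1 x y + ee 3 1 x y, ee 3 1 x y + ee 4 1 x y, ee 4 1 x y]"
| "bracket4 (R4_lambda l) x y =
     - vector [0, ee 2 1 x y, l * ee 3 1 x y + ee 4 1 x y, l * ee 4 1 x y]"
| "bracket4 (R4_mu_lambda m l) x y =
     - vector [0, ee 2 1 x y, m * ee 3 1 x y, l * ee 4 1 x y]"
| "bracket4 (R4'_mu_lambda m l) x y =
     - vector [0, m * ee 2 1 x y, l * ee 3 1 x y + ee 4 1 x y, - ee 3 1 x y + l * ee 4 1 x y]"
| "bracket4 (D4_lambda l) x y =
     - vector [0, l * ee 2 1 x y, (1 - l) * ee 3 1 x y, ee 4 1 x y + ee 3 2 x y]"
| "bracket4 (D4'_lambda l) x y =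
     - vector [0, l * ee 2 1 x y + ee 3 1 x y, - ee 2 1 x y + l * ee 3 1 x y,
               2 * l * ee 4 1 x y + ee 3 2 x y]"
| "bracket4 H4 x y =
     - vector [0, ee 2 1 x y + ee 3 1 x y, ee 3 1 x y, 2 * ee 4 1 x y + ee 3 2 x y]"

fun listed4 :: "lie4 \<Rightarrow> bool" where
  "listed4 R4 \<longleftrightarrow> True"
| "listed4 (R4_lambda l) \<longleftrightarrow> l \<noteq> -1 \<and> l \<noteq> -1/2 \<and> l \<noteq> 0"
| "listed4 (R4_mu_lambda m l) \<longleftrightarrow> (m, l) \<in> param_R"
| "listed4 (R4'_mu_lambda m l) \<longleftrightarrow> m > 0 \<and> l \<noteq> - m/2 \<and> l \<noteq> 0"
| "listed4 (D4_lambda l) \<longleftrightarrow> l \<ge> 1/2 \<and> l \<noteq> 1 \<and> l \<noteq> 2"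
| "listed4 (D4'_lambda l) \<longleftrightarrow> l > 0"
| "listed4 H4 \<longleftrightarrow> True"

end

theory Submission
  imports Defs
begin

text \<open>
  Exactness in degree 3 forces a nonzero closed 1-form \<open>\<alpha>\<close>, by comparing the ranks of the differentials.
  So \<open>\<gg>\<close> is \<open>\<real> h\<close> acting on the ideal \<open>\<kk> = ker \<alpha>\<close> by a derivation \<open>A\<close>. If \<open>\<gamma>\<close> is a closed 1-form
  on \<open>\<kk>\<close>, then \<open>\<alpha> \<and> \<gamma>\<close> is closed, hence exact, so \<open>A\<close> maps the closed 1-forms of \<open>\<kk>\<close> onto
  themselves and is injective on them. The trace form of \<open>\<kk>\<close> is closed and killed by \<open>A\<close>,
  so \<open>\<kk>\<close> is unimodular; since the volume form of \<open>\<kk>\<close> is not exact, \<open>tr A \<noteq> 0\<close>.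

  When \<open>dim \<kk> = 3\<close>, the bracket of \<open>\<kk>\<close> is a symmetric matrix \<open>S\<close>, and \<open>A\<close> is a derivation iff
  \<open>A S + S A\<^sup>T = tr A \<cdot> S\<close>. The determinant of \<open>S\<close> then scales by \<open>2 tr A = 3 tr A\<close>, so it vanishes,
  and the cofactor matrix consists of closed forms killed by \<open>A\<close>, so it vanishes as well.
  Thus \<open>S\<close> has rank at most 1, that is, \<open>\<kk>\<close> is abelian or the Heisenberg algebra. What remains is to
  put \<open>A\<close> in real Jordan normal form up to scaling, and to express the two cohomological
  conditions as the nonvanishing of \<open>tr A\<close> and of determinants. Isomorphic algebras have matrices that
  are similar up to a scalar, which the characteristic polynomial and diagonalizability detect.\<close>

section \<open>Vanishing of Betti numbers\<close>

text \<open>The trace form is killed because tr ad(A x) = tr [A, ad x] = 0 for a derivation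
  \<open>A\<close>. For the determinant, A S + S A^T and tr A . S are read as the same infinitesimal
  change of S: by Jacobi's formula det S changes at rate 2 tr A in one reading and 3 tr A in the
  other. The cofactor matrix C changes by 2 tr A . C - (A^T C + C A) and by 2 tr A . C, so A^T C + C
  A = 0. Since det S = 0, C has rank at most 1 and is v v^T up to sign; this gives A^T v = 0, and S
  C = 0 makes v closed because the columns of S span [\<kk>, \<kk>].

  The obstacle before any of this is the definition of the Betti numbers: a dimension picked by
  \<open>SOME\<close>, equal to 0 also for infinite-dimensional quotients, of spaces of functions on
  lists over an arbitrary real vector space. Vanishing is therefore restated as
  \<open>H2_zero\<close> and \<open>H3_zero\<close>, which ask for primitives of multilinear forms,
  are invariant under isomorphism, and become finite linear systems in coordinates.\<close>

definition subspace_fun :: "('b \<Rightarrow> real) set \<Rightarrow> bool" where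
  "subspace_fun V \<longleftrightarrow> (\<lambda>_. 0) \<in> V \<and> (\<forall>f\<in>V. \<forall>g\<in>V. \<forall>a b. (\<lambda>x. a * f x + b * g x) \<in> V)"

lemma subspace_funD:
  assumes "subspace_fun V" "f \<in> V" "g \<in> V"
  shows "(\<lambda>x. a * f x + b * g x) \<in> V"
  using assms by (auto simp: subspace_fun_def)

text \<open>Induction over the test points. If some element of \<open>W\<close> is nonzero at the
  new point \<open>x\<close>, restricting to functions vanishing at \<open>x\<close> does not change
  the quotient. Otherwise \<open>W\<close> already vanishes there, and the quotient grows by at most
  one dimension, spanned by a \<open>g\<close> with \<open>g x \<noteq> 0\<close>.\<close>

lemma quotient_basis_exists:
  assumes "finite L" "subspace_fun V" "subspace_fun W" "W \<subseteq> V"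
    and "\<And>f. f \<in> V \<Longrightarrow> (\<forall>x\<in>L. f x = 0) \<Longrightarrow> f \<in> W"
  shows "\<exists>S. quotient_basis V W S"
  using assms
proof (induction L arbitrary: V W rule: finite_induct)
  case empty
  have "quotient_basis V W {}"
    unfolding quotient_basis_def using empty.prems(4) by (auto intro!: ex1I[of _ "\<lambda>_. 0"])
  then show ?case by blast
next
  case (insert x L)
  define V0 where "V0 = {f \<in> V. f x = 0}"
  have V0: "subspace_fun V0"
    using insert.prems(1) by (auto simp: subspace_fun_def V0_def)
  note Vlin = subspace_funD[OF insert.prems(1)] and Wlin = subspace_funD[OF insert.prems(2)]
  show ?case
  proof (cases "\<exists>g\<in>W. g x \<noteq> 0")
    case True
    then obtain g where g: "g \<in> W" "g x \<noteq> 0" by blast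
    have gV: "g \<in> V" using g insert.prems by blast
    have W0: "subspace_fun (W \<inter> V0)"
      using V0 insert.prems(2) by (auto simp: subspace_fun_def)
    obtain S where S: "quotient_basis V0 (W \<inter> V0) S"
    proof (atomize_elim, rule insert.IH[OF V0 W0])
      show "f \<in> W \<inter> V0" if "f \<in> V0" "\<forall>x\<in>L. f x = 0" for f
        using that insert.prems(4)[of f] by (auto simp: V0_def)
    qed auto
    have "quotient_basis V W S"
      unfolding quotient_basis_def
    proof (intro conjI ballI)
      show "finite S" "S \<subseteq> V" using S by (auto simp: quotient_basis_def V0_def)
      fix v assume v: "v \<in> V"
      \<comment> \<open>The multiple of \<open>g\<close> subtracted here cancels the value at
        \<open>x\<close>; since \<open>g \<in> W\<close>, the class modulo \<open>W\<close> stays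
        the same.\<close>
      define v0 where "v0 = (\<lambda>y. 1 * v y + (- v x / g x) * g y)"
      have v0: "v0 \<in> V0" unfolding V0_def using Vlin[OF v gV, of 1 "- v x / g x"] g(2) by (simp add: v0_def)
      have sx: "(\<Sum>s\<in>S. c s * s x) = 0" for c
        using S by (intro sum.neutral) (auto simp: quotient_basis_def V0_def)
      have eq: "(\<lambda>y. v y - (\<Sum>s\<in>S. c s * s y)) \<in> W \<longleftrightarrow>
          (\<lambda>y. v0 y - (\<Sum>s\<in>S. c s * s y)) \<in> W \<inter> V0" (is "?l \<longleftrightarrow> ?r") for c
      proof
        assume ?l
        from Wlin[OF this g(1), of 1 "- v x / g x"]
        have 1: "(\<lambda>y. v0 y - (\<Sum>s\<in>S. c s * s y)) \<in> W"
          by (simp add: v0_def algebra_simps)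
        then show ?r using insert.prems(3) v0 sx by (auto simp: V0_def)
      next
        assume ?r
        then have "(\<lambda>y. v0 y - (\<Sum>s\<in>S. c s * s y)) \<in> W" by blast
        from Wlin[OF this g(1), of 1 "v x / g x"] show ?l
          by (simp add: v0_def algebra_simps)
      qed
      show "\<exists>!c. (\<forall>s. s \<notin> S \<longrightarrow> c s = 0) \<and> (\<lambda>y. v y - (\<Sum>s\<in>S. c s * s y)) \<in> W"
        unfolding eq using S v0 by (auto simp: quotient_basis_def)
    qed
    then show ?thesis by blast
  next
    case False
    then have WV0: "W \<subseteq> V0" using insert.prems(3) by (auto simp: V0_def)
    obtain S where S: "quotient_basis V0 W S"
    proof (atomize_elim, rule insert.IH[OF V0 insert.prems(2) WV0])
      show "f \<in> W" if "f \<in> V0" "\<forall>x\<in>L. f x = 0" for f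
        using that insert.prems(4)[of f] by (auto simp: V0_def)
    qed
    show ?thesis
    proof (cases "V0 = V")
      case True
      then show ?thesis using S by blast
    next
      case False
      then obtain g where g: "g \<in> V" "g x \<noteq> 0" by (auto simp: V0_def)
      have fin: "finite S" and SV0: "S \<subseteq> V0" using S by (auto simp: quotient_basis_def)
      have gS: "g \<notin> S" using g SV0 by (auto simp: V0_def)
      have sx: "(\<Sum>s\<in>S. c s * s x) = 0" for c
        using SV0 by (intro sum.neutral) (auto simp: V0_def)
      have "quotient_basis V W (insert g S)"
        unfolding quotient_basis_def
      proof (intro conjI ballI)
        show "finite (insert g S)" "insert g S \<subseteq> V" using fin SV0 g by (auto simp: V0_def)
        fix v assume v: "v \<in> V"
        define v0 where "v0 = (\<lambda>y. 1 * v y + (- v x / g x) * g y)"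
        have v0: "v0 \<in> V0" unfolding V0_def using Vlin[OF v g(1), of 1 "- v x / g x"] g(2) by (simp add: v0_def)
        have "\<exists>!c. (\<forall>s. s \<notin> S \<longrightarrow> c s = 0) \<and> (\<lambda>x. v0 x - (\<Sum>s\<in>S. c s * s x)) \<in> W"
          using S v0 by (auto simp: quotient_basis_def)
        then obtain c where c: "\<And>s. s \<notin> S \<Longrightarrow> c s = 0" "(\<lambda>x. v0 x - (\<Sum>s\<in>S. c s * s x)) \<in> W"
          and uniq: "\<And>c'. (\<forall>s. s \<notin> S \<longrightarrow> c' s = 0) \<Longrightarrow>
             (\<lambda>x. v0 x - (\<Sum>s\<in>S. c' s * s x)) \<in> W \<Longrightarrow> c' = c"
          by (smt (verit) ext)
        have upd: "(\<Sum>s\<in>S. (c(g := t)) s * s y) = (\<Sum>s\<in>S. c s * s y)" for c :: "_ \<Rightarrow> real" and t y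
          using gS by (intro sum.cong) auto
        have sumg: "(\<Sum>s\<in>insert g S. c s * s y) = c g * g y + (\<Sum>s\<in>S. c s * s y)" for c :: "_ \<Rightarrow> real" and y
          using fin gS by simp
        show "\<exists>!c. (\<forall>s. s \<notin> insert g S \<longrightarrow> c s = 0) \<and>
            (\<lambda>y. v y - (\<Sum>s\<in>insert g S. c s * s y)) \<in> W"
        proof (rule ex1I[of _ "c(g := v x / g x)"], intro conjI)
          show "\<forall>s. s \<notin> insert g S \<longrightarrow> (c(g := v x / g x)) s = 0" using c by auto
          show "(\<lambda>y. v y - (\<Sum>s\<in>insert g S. (c(g := v x / g x)) s * s y)) \<in> W"
            using c(2) unfolding sumg upd fun_upd_same v0_def by (simp add: algebra_simps)
        next
          fix c' assume c': "(\<forall>s. s \<notin> insert g S \<longrightarrow> c' s = 0) \<and>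
            (\<lambda>y. v y - (\<Sum>s\<in>insert g S. c' s * s y)) \<in> W"
          \<comment> \<open>\<open>S\<close> and \<open>W\<close> vanish at \<open>x\<close>, so
            evaluation there isolates the coefficient of \<open>g\<close>.\<close>
          then have "(\<lambda>y. v y - (\<Sum>s\<in>insert g S. c' s * s y)) x = 0"
            using WV0 unfolding V0_def by blast
          then have cg: "c' g = v x / g x" unfolding sumg sx using g(2) by (simp add: field_simps)
          have "c'(g := 0) = c"
          proof (rule uniq)
            show "\<forall>s. s \<notin> S \<longrightarrow> (c'(g := 0)) s = 0" using c' by auto
            show "(\<lambda>x. v0 x - (\<Sum>s\<in>S. (c'(g := 0)) s * s x)) \<in> W"
              using c' unfolding sumg upd v0_def by (simp add: algebra_simps cg)
          qed
          then show "c' = c(g := v x / g x)" using cg by (metis fun_upd_triv fun_upd_upd)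
        qed
      qed
      then show ?thesis by blast
    qed
  qed
qed

lemma quotient_basis_empty_iff:
  assumes "(\<lambda>_. 0) \<in> W"
  shows "quotient_basis V W {} \<longleftrightarrow> V \<subseteq> W"
proof -
  have "(\<exists>!c. (\<forall>s. s \<notin> {} \<longrightarrow> c s = 0) \<and> (\<lambda>x. v x - (\<Sum>s\<in>{}. c s * s x)) \<in> W) \<longleftrightarrow> v \<in> W"
    for v :: "'a \<Rightarrow> real"
    by (auto intro!: ex1I[of _ "\<lambda>_. 0"])
  then show ?thesis by (auto simp: quotient_basis_def)
qed

text \<open>An element \<open>s\<close> of \<open>S\<close> would be represented both by the
  coefficient 1 at \<open>s\<close> and by zero coefficients, against uniqueness. This controls
  whatever set \<open>SOME\<close> picks in \<open>quotient_dim\<close>.\<close>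

lemma quotient_basis_subset:
  assumes "quotient_basis V W S" "V \<subseteq> W" "(\<lambda>_. 0) \<in> W"
  shows "S = {}"
proof (rule ccontr)
  assume "S \<noteq> {}"
  then obtain s where s: "s \<in> S" by blast
  let ?c = "(\<lambda>_. 0)(s := 1) :: _ \<Rightarrow> real"
  have fin: "finite S" and sV: "s \<in> V" using assms(1) s by (auto simp: quotient_basis_def)
  have ex1: "\<exists>!c. (\<forall>t. t \<notin> S \<longrightarrow> c t = 0) \<and> (\<lambda>x. s x - (\<Sum>t\<in>S. c t * t x)) \<in> W"
    using assms(1) sV by (auto simp: quotient_basis_def)
  have sum: "(\<Sum>t\<in>S. ?c t * t x) = s x" for x
    using fin s by (simp add: if_distrib[of "\<lambda>c. c * _"] sum.delta cong: if_cong)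
  have 1: "(\<forall>t. t \<notin> S \<longrightarrow> ?c t = 0) \<and> (\<lambda>x. s x - (\<Sum>t\<in>S. ?c t * t x)) \<in> W"
    using s assms(3) unfolding sum by auto
  have 2: "(\<forall>t. t \<notin> S \<longrightarrow> (\<lambda>_. 0::real) t = 0) \<and>
      (\<lambda>x. s x - (\<Sum>t\<in>S. (\<lambda>_. 0) t * t x)) \<in> W"
    using sV assms(2) by auto
  have uniq: "c = c'" if "(\<forall>t. t \<notin> S \<longrightarrow> c t = 0) \<and> (\<lambda>x. s x - (\<Sum>t\<in>S. c t * t x)) \<in> W"
    "(\<forall>t. t \<notin> S \<longrightarrow> c' t = 0) \<and> (\<lambda>x. s x - (\<Sum>t\<in>S. c' t * t x)) \<in> W" for c c'
    using ex1 that by blast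
  have "?c = (\<lambda>_. 0)" by (rule uniq[OF 1 2])
  then show False by (metis fun_upd_same zero_neq_one)
qed

lemma quotient_dim_eq_0:
  assumes "V \<subseteq> W" "(\<lambda>_. 0) \<in> W"
  shows "quotient_dim V W = 0"
proof -
  have "(SOME S. quotient_basis V W S) = {}" if "\<exists>S. quotient_basis V W S"
    using quotient_basis_subset[OF someI_ex[OF that] assms] .
  then show ?thesis by (simp add: quotient_dim_def)
qed

text \<open>A family \<open>V\<close> of functions that is determined by finitely many values is
  finite-dimensional, which rules out the junk value of \<^const>\<open>quotient_dim\<close>.\<close>

lemma quotient_dim_eq_0D:
  assumes "finite L" "subspace_fun V" "subspace_fun W"
    and "\<And>f. f \<in> V \<Longrightarrow> (\<forall>x\<in>L. f x = 0) \<Longrightarrow> f = (\<lambda>_. 0)"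
    and "quotient_dim V W = 0"
  shows "V \<subseteq> W"
proof -
  \<comment> \<open>Existence of a basis was shown for a subspace of \<open>V\<close>, hence the
    intersection. For \<open>v \<in> V\<close> and \<open>S \<subseteq> V\<close> the differences
    lie in \<open>V\<close> anyway, so membership in \<open>W\<close> and in
    \<open>W \<inter> V\<close> agree.\<close>
  have WV: "subspace_fun (W \<inter> V)" using assms(2,3) by (auto simp: subspace_fun_def)
  have "f \<in> W \<inter> V" if "f \<in> V" "\<forall>x\<in>L. f x = 0" for f
    using assms(4)[OF that] WV by (simp add: subspace_fun_def)
  then obtain S where S: "quotient_basis V (W \<inter> V) S"
    using quotient_basis_exists[OF assms(1,2) WV] by blast
  have "(\<lambda>x. v x - (\<Sum>s\<in>S'. c s * s x)) \<in> V" if "v \<in> V" "S' \<subseteq> V" "finite S'" for v c S'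
    using that(3,2)
  proof (induction S' rule: finite_induct)
    case empty
    then show ?case using that by simp
  next
    case (insert s S')
    then have "(\<lambda>x. 1 * (v x - (\<Sum>s\<in>S'. c s * s x)) + (- c s) * s x) \<in> V"
      by (intro subspace_funD[OF assms(2)]) auto
    then show ?case using insert by (simp add: algebra_simps)
  qed
  then have "(\<lambda>x. v x - (\<Sum>s\<in>S. c s * s x)) \<in> W \<inter> V \<longleftrightarrow>
      (\<lambda>x. v x - (\<Sum>s\<in>S. c s * s x)) \<in> W" if "v \<in> V" for v c
    using S that by (auto simp: quotient_basis_def)
  then have "quotient_basis V W S"
    using S unfolding quotient_basis_def by simp
  then have "quotient_basis V W (SOME S. quotient_basis V W S)" by (rule someI)
  moreover have "card (SOME S. quotient_basis V W S) = 0"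
    using assms(5) \<open>quotient_basis V W S\<close> unfolding quotient_dim_def by metis
  moreover have "finite (SOME S. quotient_basis V W S)"
    using calculation(1) by (simp add: quotient_basis_def)
  ultimately have "quotient_basis V W {}" by (metis card_0_eq)
  then show ?thesis
    using assms(3) by (simp add: quotient_basis_empty_iff subspace_fun_def)
qed

section \<open>Cochains, cocycles and coboundaries as function spaces\<close>

lemma linear_real_combination:
  fixes f g :: "'a::real_vector \<Rightarrow> real"
  assumes "linear f" "linear g"
  shows "linear (\<lambda>x. a * f x + b * g x)"
  using assms by (simp add: linear_iff algebra_simps)

lemma subspace_cochains: "subspace_fun (cochains n)"
  unfolding subspace_fun_def cochains_def
  by (simp add: linear_real_combination linear_iff[of "\<lambda>_. 0"])

lemma ce_diff_linear:
  "ce_diff br (\<lambda>x. a * f x + b * g x) = (\<lambda>x. a * ce_diff br f x + b * ce_diff br g x)"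
  by (rule ext) (simp add: ce_diff_def sum_distrib_left sum.distrib algebra_simps)

lemma ce_diff_zero: "ce_diff br (\<lambda>_. 0) = (\<lambda>_. 0)"
  by (rule ext) (simp add: ce_diff_def)

lemma subspace_cocycles: "subspace_fun (cocycles br n)"
  using subspace_cochains[of n]
  unfolding subspace_fun_def cocycles_def by (auto simp: ce_diff_linear ce_diff_zero)

lemma subspace_coboundaries: "subspace_fun (coboundaries br n)"
proof (cases n)
  case 0
  then show ?thesis by (auto simp: coboundaries_def subspace_fun_def)
next
  case (Suc m)
  have "subspace_fun (ce_diff br ` cochains m)"
    unfolding subspace_fun_def
  proof (intro conjI ballI allI)
    show "(\<lambda>_. 0) \<in> ce_diff br ` cochains m"
      using subspace_cochains[of m]
      by (intro image_eqI[of _ _ "\<lambda>_. 0"]) (auto simp: ce_diff_zero subspace_fun_def)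
    fix f g a b assume "f \<in> ce_diff br ` cochains m" "g \<in> ce_diff br ` cochains m"
    then obtain f' g' where "f' \<in> cochains m" "g' \<in> cochains m" "f = ce_diff br f'" "g = ce_diff br g'"
      by blast
    then show "(\<lambda>x. a * f x + b * g x) \<in> ce_diff br ` cochains m"
      by (intro image_eqI[of _ _ "\<lambda>x. a * f' x + b * g' x"])
        (auto simp: ce_diff_linear intro: subspace_funD[OF subspace_cochains])
  qed
  then show ?thesis using Suc by (simp add: coboundaries_def)
qed

text \<open>The slots are freed one at a time: \<open>k\<close> counts the leading entries that are
  arbitrary while the remaining ones lie in \<open>B\<close>, and linearity in slot \<open>k\<close>
  together with the spanning property raises \<open>k\<close> by one.\<close>

lemma cochain_eq_0:
  assumes "span B = UNIV" "w \<in> cochains n"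
    and "\<And>xs. set xs \<subseteq> B \<Longrightarrow> length xs = n \<Longrightarrow> w xs = 0"
  shows "w = (\<lambda>_. 0)"
proof -
  have "w xs = 0" if "length xs = n" "k \<le> n" "\<forall>i. k \<le> i \<and> i < n \<longrightarrow> xs ! i \<in> B" for k xs
    using that
  proof (induction k arbitrary: xs)
    case 0
    then show ?case by (intro assms(3)) (auto simp: set_conv_nth)
  next
    case (Suc k)
    have lin: "linear (\<lambda>x. w (xs[k := x]))"
      using assms(2) Suc.prems by (auto simp: cochains_def)
    have z: "w (xs[k := x]) = 0" if "x \<in> B" for x
      using Suc.prems that by (intro Suc.IH) (auto simp: nth_list_update)
    have "w (xs[k := xs ! k]) = 0"
      using linear_eq_0_on_span[OF lin z, of B "xs ! k"] assms(1) by simp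
    then show ?case by simp
  qed
  then have "w xs = 0" if "length xs = n" for xs using that by (metis le_refl not_le)
  moreover have "w xs = 0" if "length xs \<noteq> n" for xs
    using assms(2) that by (auto simp: cochains_def)
  ultimately show ?thesis by blast
qed

text \<open>The finitely many lists over a finite spanning set serve as test points that determine a
  cocycle, so a Betti number 0 cannot come from the default value for infinite-dimensional
  quotients.\<close>

lemma betti_eq_0_iff:
  fixes br :: "'a::real_vector \<Rightarrow> 'a \<Rightarrow> 'a"
  assumes "finite B" "span B = (UNIV :: 'a set)"
  shows "betti br n = 0 \<longleftrightarrow> cocycles br n \<subseteq> coboundaries br n"
proof
  assume "cocycles br n \<subseteq> coboundaries br n"
  then show "betti br n = 0" unfolding betti_def
    using subspace_coboundaries[of br n] by (intro quotient_dim_eq_0) (auto simp: subspace_fun_def)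
next
  assume "betti br n = 0"
  moreover have "finite {xs. set xs \<subseteq> B \<and> length xs = n}"
    by (rule finite_lists_length_eq[OF assms(1)])
  ultimately show "cocycles br n \<subseteq> coboundaries br n" unfolding betti_def
    using subspace_coboundaries subspace_cocycles
    by (elim quotient_dim_eq_0D[rotated -1])
      (auto simp: cocycles_def intro!: cochain_eq_0[OF assms(2)])
qed

section \<open>Forms of degree at most four\<close>

definition alt2 :: "('a::real_vector \<Rightarrow> 'a \<Rightarrow> real) \<Rightarrow> bool" where
  "alt2 w \<longleftrightarrow> (\<forall>y. linear (\<lambda>x. w x y)) \<and> (\<forall>x. linear (\<lambda>y. w x y)) \<and> (\<forall>x. w x x = 0)"

definition alt3 :: "('a::real_vector \<Rightarrow> 'a \<Rightarrow> 'a \<Rightarrow> real) \<Rightarrow> bool" where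
  "alt3 w \<longleftrightarrow> (\<forall>y z. linear (\<lambda>x. w x y z)) \<and> (\<forall>x z. linear (\<lambda>y. w x y z)) \<and>
     (\<forall>x y. linear (\<lambda>z. w x y z)) \<and>
     (\<forall>x y. w x x y = 0) \<and> (\<forall>x y. w x y x = 0) \<and> (\<forall>x y. w x y y = 0)"

text \<open>These are the Chevalley--Eilenberg differentials on 2- and 3-forms up to the sign \<open>-1\<close>.\<close>

definition diff2 :: "('a::real_vector \<Rightarrow> 'a \<Rightarrow> 'a) \<Rightarrow> ('a \<Rightarrow> 'a \<Rightarrow> real) \<Rightarrow> 'a \<Rightarrow> 'a \<Rightarrow> 'a \<Rightarrow> real" where
  "diff2 br w x y z = w (br x y) z - w (br x z) y + w (br y z) x"

definition diff3 :: "('a::real_vector \<Rightarrow> 'a \<Rightarrow> 'a) \<Rightarrow> ('a \<Rightarrow> 'a \<Rightarrow> 'a \<Rightarrow> real) \<Rightarrow>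
    'a \<Rightarrow> 'a \<Rightarrow> 'a \<Rightarrow> 'a \<Rightarrow> real" where
  "diff3 br w x y z u = w (br x y) z u - w (br x z) y u + w (br x u) y z
     + w (br y z) x u - w (br y u) x z + w (br z u) x y"

definition H2_zero :: "('a::real_vector \<Rightarrow> 'a \<Rightarrow> 'a) \<Rightarrow> bool" where
  "H2_zero br \<longleftrightarrow> (\<forall>w. alt2 w \<and> (\<forall>x y z. diff2 br w x y z = 0) \<longrightarrow>
     (\<exists>a. linear a \<and> (\<forall>x y. w x y = a (br x y))))"

definition H3_zero :: "('a::real_vector \<Rightarrow> 'a \<Rightarrow> 'a) \<Rightarrow> bool" where
  "H3_zero br \<longleftrightarrow> (\<forall>w. alt3 w \<and> (\<forall>x y z u. diff3 br w x y z u = 0) \<longrightarrow>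
     (\<exists>b. alt2 b \<and> (\<forall>x y z. w x y z = diff2 br b x y z)))"

section \<open>Passage between forms on lists and multilinear forms\<close>

lemma less_2_iff: "i < (2::nat) \<longleftrightarrow> i = 0 \<or> i = 1" by auto
lemma less_3_iff: "i < (3::nat) \<longleftrightarrow> i = 0 \<or> i = 1 \<or> i = 2" by auto

lemma length_2_iff: "length xs = 2 \<longleftrightarrow> (\<exists>x y. xs = [x, y])"
  by (auto simp: numeral_2_eq_2 length_Suc_conv)
lemma length_3_iff: "length xs = 3 \<longleftrightarrow> (\<exists>x y z. xs = [x, y, z])"
  by (auto simp: numeral_3_eq_3 length_Suc_conv)
lemma length_4_iff: "length xs = 4 \<longleftrightarrow> (\<exists>x y z u. xs = [x, y, z, u])"
  by (auto simp: eval_nat_numeral length_Suc_conv)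

lemma cochain1_linear:
  assumes "w \<in> cochains 1" shows "linear (\<lambda>x. w [x])"
proof -
  have "linear (\<lambda>x. w (xs[i := x]))" if "length xs = 1" "i < 1" for xs i
    using assms that by (simp add: cochains_def)
  from this[of "[_]" 0] show ?thesis by simp
qed

lemma cochain2_alt2: 
  assumes "w \<in> cochains 2" shows "alt2 (\<lambda>x y. w [x, y])"
proof -
  have lin: "linear (\<lambda>x. w (xs[i := x]))" if "length xs = 2" "i < 2" for xs i
    using assms that by (simp add: cochains_def)
  have alt: "w xs = 0" if "length xs = 2" "i < j" "j < 2" "xs ! i = xs ! j" for xs i j
    using assms that unfolding cochains_def by blast
  show ?thesis unfolding alt2_def
    using lin[of "[_, _]" 0] lin[of "[_, _]" 1] alt[of "[_, _]" 0 1] by simp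
qed

lemma cochain3_alt3:
  assumes "w \<in> cochains 3" shows "alt3 (\<lambda>x y z. w [x, y, z])"
proof -
  have lin: "linear (\<lambda>x. w (xs[i := x]))" if "length xs = 3" "i < 3" for xs i
    using assms that by (simp add: cochains_def)
  have alt: "w xs = 0" if "length xs = 3" "i < j" "j < 3" "xs ! i = xs ! j" for xs i j
    using assms that unfolding cochains_def by blast
  show ?thesis unfolding alt3_def
    using lin[of "[_, _, _]" 0] lin[of "[_, _, _]" 1] lin[of "[_, _, _]" 2]
      alt[of "[_, _, _]" 0 1] alt[of "[_, _, _]" 0 2] alt[of "[_, _, _]" 1 2] by simp
qed

definition list1 :: "('a \<Rightarrow> real) \<Rightarrow> 'a list \<Rightarrow> real" where
  "list1 w xs = (if length xs = 1 then w (xs ! 0) else 0)"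
definition list2 :: "('a \<Rightarrow> 'a \<Rightarrow> real) \<Rightarrow> 'a list \<Rightarrow> real" where
  "list2 w xs = (if length xs = 2 then w (xs ! 0) (xs ! 1) else 0)"
definition list3 :: "('a \<Rightarrow> 'a \<Rightarrow> 'a \<Rightarrow> real) \<Rightarrow> 'a list \<Rightarrow> real" where
  "list3 w xs = (if length xs = 3 then w (xs ! 0) (xs ! 1) (xs ! 2) else 0)"

lemma list1_cochain: "linear w \<Longrightarrow> list1 w \<in> cochains 1"
  by (auto simp: cochains_def list1_def)

lemma list2_cochain: "alt2 w \<Longrightarrow> list2 w \<in> cochains 2"
  by (auto simp: cochains_def list2_def alt2_def less_2_iff)

lemma list3_cochain: "alt3 w \<Longrightarrow> list3 w \<in> cochains 3"
  by (auto simp: cochains_def list3_def alt3_def less_2_iff less_3_iff)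

lemma ce_diff_1: "ce_diff br w [x, y] = - w [br x y]"
  by (simp add: ce_diff_def nths_Cons)

lemma ce_diff_2: "ce_diff br w [x, y, z] = - diff2 br (\<lambda>x y. w [x, y]) x y z"
  by (simp add: ce_diff_def nths_Cons diff2_def eval_nat_numeral)

lemma ce_diff_3: "ce_diff br w [x, y, z, u] = - diff3 br (\<lambda>x y z. w [x, y, z]) x y z u"
  by (simp add: ce_diff_def nths_Cons diff3_def eval_nat_numeral)

text \<open>Equality of cochains is equality on lists of every length, so the differential must be
  known on lists of the wrong length too. Dropping two entries and adding a bracket shortens a list
  by exactly one.\<close>

lemma ce_diff_length:
  assumes "w \<in> cochains n" "n \<noteq> 0" "length xs \<noteq> Suc n"
  shows "ce_diff br w xs = 0"
  unfolding ce_diff_def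
proof (intro sum.neutral ballI)
  fix j i assume ij: "j \<in> {..<length xs}" "i \<in> {..<j}"
  then have "length (nths xs (- {i, j})) = length xs - 2"
  proof -
    have "{k. k < length xs \<and> k \<in> - {i, j}} = {..<length xs} - {i, j}" by auto
    then show ?thesis using ij by (simp add: length_nths card_Diff_subset)
  qed
  then have "w (br (xs ! i) (xs ! j) # nths xs (- {i, j})) = 0"
    using assms ij by (auto simp: cochains_def)
  then show "(- 1) ^ (i + j) * w (br (xs ! i) (xs ! j) # nths xs (- {i, j})) = 0" by simp
qed

text \<open>The minus sign in the differential of a 1-form is absorbed by passing to the negative of
  the primitive; the same happens in degree 3.\<close>

lemma H2_zero_iff: "cocycles br 2 \<subseteq> coboundaries br 2 \<longleftrightarrow> H2_zero br"
proof
  assume sub: "cocycles br 2 \<subseteq> coboundaries br 2"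
  show "H2_zero br" unfolding H2_zero_def
  proof (intro allI impI, elim conjE)
    fix w assume w: "alt2 w" "\<forall>x y z. diff2 br w x y z = 0"
    have "ce_diff br (list2 w) xs = 0" for xs
    proof (cases "length xs = 3")
      case True
      then obtain x y z where "xs = [x, y, z]" by (auto simp: length_3_iff)
      then show ?thesis using w(2) by (simp add: ce_diff_2 list2_def)
    qed (use ce_diff_length[OF list2_cochain[OF w(1)]] in simp)
    then have "list2 w \<in> cocycles br 2"
      using list2_cochain[OF w(1)] by (auto simp: cocycles_def)
    then obtain a where a: "a \<in> cochains 1" "list2 w = ce_diff br a"
      using sub by (auto simp: coboundaries_def numeral_2_eq_2)
    have "w x y = - a [br x y]" for x y
      using a(2) ce_diff_1[of br a x y] by (simp add: list2_def fun_eq_iff) (metis list.size nth_Cons_0 nth_Cons_Suc One_nat_def numeral_2_eq_2 plus_1_eq_Suc add.commute add_0)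
    moreover have "linear (\<lambda>x. - a [x])"
      using cochain1_linear[OF a(1)] by (simp add: linear_iff)
    ultimately show "\<exists>a. linear a \<and> (\<forall>x y. w x y = a (br x y))" by blast
  qed
next
  assume H: "H2_zero br"
  show "cocycles br 2 \<subseteq> coboundaries br 2"
  proof
    fix w assume w: "w \<in> cocycles br 2"
    then have wc: "w \<in> cochains 2" and d: "ce_diff br w = (\<lambda>_. 0)" by (auto simp: cocycles_def)
    have "diff2 br (\<lambda>x y. w [x, y]) x y z = 0" for x y z
      using d ce_diff_2[of br w x y z] by simp
    then obtain a where a: "linear a" "\<And>x y. w [x, y] = a (br x y)"
      using H cochain2_alt2[OF wc] unfolding H2_zero_def by blast
    have lin: "linear (\<lambda>x. - a x)" using a(1) by (simp add: linear_iff)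
    have "w xs = ce_diff br (list1 (\<lambda>x. - a x)) xs" for xs
    proof (cases "length xs = 2")
      case True
      then show ?thesis using a(2) by (auto simp: length_2_iff ce_diff_1 list1_def)
    next
      case False
      then show ?thesis
        using wc ce_diff_length[OF list1_cochain[OF lin]] by (simp add: cochains_def)
    qed
    then show "w \<in> coboundaries br 2"
      using list1_cochain[OF lin] by (auto simp: coboundaries_def numeral_2_eq_2)
  qed
qed

lemma diff2_uminus: "diff2 br (\<lambda>x y. - b x y) x y z = - diff2 br b x y z"
  by (simp add: diff2_def)

lemma alt2_uminus: "alt2 b \<Longrightarrow> alt2 (\<lambda>x y. - b x y)"
  by (simp add: alt2_def linear_iff)

lemma H3_zero_iff: "cocycles br 3 \<subseteq> coboundaries br 3 \<longleftrightarrow> H3_zero br"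
proof
  assume sub: "cocycles br 3 \<subseteq> coboundaries br 3"
  show "H3_zero br" unfolding H3_zero_def
  proof (intro allI impI, elim conjE)
    fix w assume w: "alt3 w" "\<forall>x y z u. diff3 br w x y z u = 0"
    have "ce_diff br (list3 w) xs = 0" for xs
    proof (cases "length xs = 4")
      case True
      then obtain x y z u where "xs = [x, y, z, u]" by (auto simp: length_4_iff)
      then show ?thesis using w(2) by (simp add: ce_diff_3 list3_def)
    qed (use ce_diff_length[OF list3_cochain[OF w(1)]] in simp)
    then have "list3 w \<in> cocycles br 3"
      using list3_cochain[OF w(1)] by (auto simp: cocycles_def)
    then obtain b where b: "b \<in> cochains 2" "list3 w = ce_diff br b"
      using sub by (auto simp: coboundaries_def eval_nat_numeral)
    have "w x y z = - diff2 br (\<lambda>x y. b [x, y]) x y z" for x y z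
      using fun_cong[OF b(2), of "[x, y, z]"] by (simp add: list3_def ce_diff_2)
    then show "\<exists>b. alt2 b \<and> (\<forall>x y z. w x y z = diff2 br b x y z)"
      using alt2_uminus[OF cochain2_alt2[OF b(1)]] by (intro exI[of _ "\<lambda>x y. - b [x, y]"]) (simp add: diff2_uminus)
  qed
next
  assume H: "H3_zero br"
  show "cocycles br 3 \<subseteq> coboundaries br 3"
  proof
    fix w assume w: "w \<in> cocycles br 3"
    then have wc: "w \<in> cochains 3" and d: "ce_diff br w = (\<lambda>_. 0)" by (auto simp: cocycles_def)
    have "diff3 br (\<lambda>x y z. w [x, y, z]) x y z u = 0" for x y z u
      using d ce_diff_3[of br w x y z u] by simp
    then obtain b where b: "alt2 b" "\<And>x y z. w [x, y, z] = diff2 br b x y z"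
      using H cochain3_alt3[OF wc] unfolding H3_zero_def by blast
    have "w xs = ce_diff br (list2 (\<lambda>x y. - b x y)) xs" for xs
    proof (cases "length xs = 3")
      case True
      then show ?thesis using b(2) by (auto simp: length_3_iff ce_diff_2 list2_def diff2_uminus)
    next
      case False
      then show ?thesis
        using wc ce_diff_length[OF list2_cochain[OF alt2_uminus[OF b(1)]]] by (simp add: cochains_def)
    qed
    then show "w \<in> coboundaries br 3"
      using list2_cochain[OF alt2_uminus[OF b(1)]] by (auto simp: coboundaries_def eval_nat_numeral)
  qed
qed

lemma trivial_2_3_iff:
  fixes br :: "'a::real_vector \<Rightarrow> 'a \<Rightarrow> 'a"
  assumes "finite B" "span B = (UNIV :: 'a set)"
  shows "trivial_2_3 br \<longleftrightarrow> H2_zero br \<and> H3_zero br"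
  unfolding trivial_2_3_def betti_eq_0_iff[OF assms] H2_zero_iff H3_zero_iff ..

lemma trivial_2_3_iff_euclidean:
  fixes br :: "'a::euclidean_space \<Rightarrow> 'a \<Rightarrow> 'a"
  shows "trivial_2_3 br \<longleftrightarrow> H2_zero br \<and> H3_zero br"
  by (rule trivial_2_3_iff[OF finite_Basis span_Basis])

section \<open>Isomorphisms and invariance of the vanishing conditions\<close>

lemma lie_isomorphic_trans:
  assumes "lie_isomorphic br1 br2" "lie_isomorphic br2 br3"
  shows "lie_isomorphic br1 br3"
proof -
  obtain f g where "linear f" "bij f" "\<And>x y. f (br1 x y) = br2 (f x) (f y)"
    "linear g" "bij g" "\<And>x y. g (br2 x y) = br3 (g x) (g y)"
    using assms by (auto simp: lie_isomorphic_def)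
  then show ?thesis unfolding lie_isomorphic_def
    by (intro exI[of _ "g \<circ> f"]) (auto simp: linear_compose bij_comp)
qed

lemma linear_inv_bij:
  assumes "linear f" "bij f" shows "linear (inv f)"
proof -
  have "f (inv f x) = x" for x using assms(2) by (simp add: bij_is_surj surj_f_inv_f)
  then show ?thesis unfolding linear_iff
    by (auto intro!: inv_f_eq[OF bij_is_inj[OF assms(2)]] simp: linear_add[OF assms(1)] linear_cmul[OF assms(1)])
qed

lemma lie_isomorphic_sym:
  assumes "lie_isomorphic br1 br2" shows "lie_isomorphic br2 br1"
proof -
  obtain f where f: "linear f" "bij f" "\<And>x y. f (br1 x y) = br2 (f x) (f y)"
    using assms by (auto simp: lie_isomorphic_def)
  have "inv f (br2 x y) = br1 (inv f x) (inv f y)" for x y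
    using f(3)[of "inv f x" "inv f y"] f(2) by (metis bij_inv_eq_iff)
  then show ?thesis unfolding lie_isomorphic_def
    using f linear_inv_bij bij_imp_bij_inv by blast
qed

lemma lie_isomorphic_pullback:
  assumes "linear f" "bij f"
  shows "lie_isomorphic (\<lambda>x y. inv f (br (f x) (f y))) br"
  unfolding lie_isomorphic_def
  by (rule exI[of _ f]) (use assms in \<open>auto simp: bij_is_surj surj_f_inv_f\<close>)

lemma lie_isomorphic_lie_algebra:
  assumes "lie_isomorphic br1 br2" "lie_algebra br2"
  shows "lie_algebra br1"
proof -
  obtain f where f: "linear f" "bij f" "\<And>x y. f (br1 x y) = br2 (f x) (f y)"
    using assms by (auto simp: lie_isomorphic_def)
  have inj: "f x = f y \<longleftrightarrow> x = y" for x y using f(2) by (simp add: bij_is_inj inj_eq)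
  note fl = linear_add[OF f(1)] linear_cmul[OF f(1)] linear_0[OF f(1)] f(3)
  have b2: "br2 (x + x') y = br2 x y + br2 x' y" "br2 x (y + y') = br2 x y + br2 x y'"
    "br2 (c *\<^sub>R x) y = c *\<^sub>R br2 x y" "br2 x (c *\<^sub>R y) = c *\<^sub>R br2 x y" for x x' y y' c
    using assms(2) by (auto simp: lie_algebra_def bilinear_def linear_iff)
  have br2: "br2 x x = 0" "br2 x (br2 y z) + br2 y (br2 z x) + br2 z (br2 x y) = 0" for x y z
    using assms(2) by (auto simp: lie_algebra_def)
  have f0: "f x = 0 \<longleftrightarrow> x = 0" for x using inj[of x 0] linear_0[OF f(1)] by simp
  have "bilinear br1" unfolding bilinear_def linear_iff
    by (auto simp: inj[symmetric] fl b2)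
  moreover have "br1 x x = 0" for x by (simp add: f0[symmetric] fl br2)
  moreover have "br1 x (br1 y z) + br1 y (br1 z x) + br1 z (br1 x y) = 0" for x y z
    by (simp add: f0[symmetric] fl br2)
  ultimately show ?thesis by (simp add: lie_algebra_def)
qed

lemma alt2_compose:
  assumes "linear f" "alt2 w" shows "alt2 (\<lambda>x y. w (f x) (f y))"
proof -
  note c = linear_compose[OF assms(1), unfolded o_def]
  show ?thesis
    using assms(2) c[of "\<lambda>x. w x _"] c[of "\<lambda>y. w _ y"] unfolding alt2_def by blast
qed

lemma alt3_compose:
  assumes "linear f" "alt3 w" shows "alt3 (\<lambda>x y z. w (f x) (f y) (f z))"
proof -
  note c = linear_compose[OF assms(1), unfolded o_def]
  show ?thesis
    using assms(2) c[of "\<lambda>x. w x _ _"] c[of "\<lambda>y. w _ y _"] c[of "\<lambda>z. w _ _ z"]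
    unfolding alt3_def by blast
qed

text \<open>A form is pulled back along the isomorphism, and the primitive found there is pulled
  back along the inverse. The two algebras may live on different types, which later allows an
  abstract Lie algebra to be moved to coordinates.\<close>

lemma H2_zero_iso:
  assumes "lie_isomorphic br1 br2" "H2_zero br1"
  shows "H2_zero br2"
proof -
  obtain f where f: "linear f" "bij f" "\<And>x y. f (br1 x y) = br2 (f x) (f y)"
    using assms by (auto simp: lie_isomorphic_def)
  let ?g = "inv f"
  have fg: "f (?g x) = x" for x using f(2) by (simp add: bij_is_surj surj_f_inv_f)
  show ?thesis unfolding H2_zero_def
  proof (intro allI impI, elim conjE)
    fix w assume w: "alt2 w" "\<forall>x y z. diff2 br2 w x y z = 0"
    have "alt2 (\<lambda>x y. w (f x) (f y))"
      by (rule alt2_compose[OF f(1) w(1)])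
    moreover have "diff2 br1 (\<lambda>x y. w (f x) (f y)) x y z = 0" for x y z
      using w(2) by (simp add: diff2_def f(3))
    ultimately obtain a where a: "linear a" "\<And>x y. w (f x) (f y) = a (br1 x y)"
      using assms(2) unfolding H2_zero_def by (metis (no_types, lifting))
    have "w x y = (a \<circ> ?g) (br2 x y)" for x y
      using a(2)[of "?g x" "?g y"] f(3)[of "?g x" "?g y"] f(2) by (simp add: fg) (metis bij_is_inj inv_f_f)
    then show "\<exists>a. linear a \<and> (\<forall>x y. w x y = a (br2 x y))"
      using linear_compose[OF linear_inv_bij[OF f(1,2)] a(1)] by blast
  qed
qed

lemma H3_zero_iso:
  assumes "lie_isomorphic br1 br2" "H3_zero br1"
  shows "H3_zero br2"
proof -
  obtain f where f: "linear f" "bij f" "\<And>x y. f (br1 x y) = br2 (f x) (f y)"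
    using assms by (auto simp: lie_isomorphic_def)
  let ?g = "inv f"
  have fg: "f (?g x) = x" for x using f(2) by (simp add: bij_is_surj surj_f_inv_f)
  have gl: "linear ?g" by (rule linear_inv_bij[OF f(1,2)])
  have gb: "br1 (?g x) (?g y) = ?g (br2 x y)" for x y
    using f(3)[of "?g x" "?g y"] f(2) by (simp add: fg) (metis bij_is_inj inv_f_f)
  show ?thesis unfolding H3_zero_def
  proof (intro allI impI, elim conjE)
    fix w assume w: "alt3 w" "\<forall>x y z u. diff3 br2 w x y z u = 0"
    have "alt3 (\<lambda>x y z. w (f x) (f y) (f z))"
      by (rule alt3_compose[OF f(1) w(1)])
    moreover have "diff3 br1 (\<lambda>x y z. w (f x) (f y) (f z)) x y z u = 0" for x y z u
      using w(2) by (simp add: diff3_def f(3))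
    ultimately obtain b where b: "alt2 b"
      "\<And>x y z. w (f x) (f y) (f z) = diff2 br1 b x y z"
      using assms(2) unfolding H3_zero_def by (metis (no_types, lifting))
    have "w x y z = diff2 br2 (\<lambda>x y. b (?g x) (?g y)) x y z" for x y z
      using b(2)[of "?g x" "?g y" "?g z"] by (simp add: fg diff2_def gb)
    moreover have "alt2 (\<lambda>x y. b (?g x) (?g y))"
      by (rule alt2_compose[OF gl b(1)])
    ultimately show "\<exists>b. alt2 b \<and> (\<forall>x y z. w x y z = diff2 br2 b x y z)" by blast
  qed
qed

lemma dim_UNIV_linear_bij:
  assumes "dim (UNIV :: 'a::real_vector set) = CARD('n::finite)"
  shows "\<exists>f :: real ^ 'n \<Rightarrow> 'a. linear f \<and> bij f"
proof -
  obtain B :: "'a set" where B: "independent B" "UNIV \<subseteq> span B" "card B = CARD('n)"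
    using basis_exists[of "UNIV :: 'a set"] assms by metis
  \<comment> \<open>An infinite basis would have cardinality 0, while \<open>CARD('n)\<close> is
    positive.\<close>
  have "finite B" using B(3) by (metis card.infinite zero_less_card_finite less_irrefl)
  then obtain v :: "'n \<Rightarrow> 'a" where v: "bij_betw v UNIV B"
    using B(3) by (metis finite_same_card_bij finite)
  define f where "f = (\<lambda>x :: real ^ 'n. \<Sum>i\<in>UNIV. x $ i *\<^sub>R v i)"
  have lin: "linear f"
    unfolding f_def linear_iff by (simp add: scaleR_add_left sum.distrib scaleR_sum_right)
  have sum: "f x = (\<Sum>b\<in>B. x $ (inv v b) *\<^sub>R b)" for x
    unfolding f_def using v
    by (subst sum.reindex_bij_betw[OF v, symmetric]) (auto simp: bij_betw_def inv_f_f)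
  have "inj f"
  proof (rule linear_injective_0[OF lin, THEN iffD2], intro allI impI)
    fix x assume "f x = 0"
    then have "x $ (inv v b) = 0" if "b \<in> B" for b
      using independentD[OF B(1) \<open>finite B\<close> subset_refl, of "\<lambda>b. x $ inv v b"] that sum by simp
    then have "x $ i = 0" for i
      using v by (metis bij_betw_def inv_f_f rangeI)
    then show "x = 0" by (simp add: vec_eq_iff)
  qed
  moreover have "surj f"
  proof -
    have "v i \<in> range f" for i
    proof
      show "v i = f (axis i 1)" unfolding f_def
        by (simp add: axis_def if_distrib[of "\<lambda>c. c *\<^sub>R _"] cong: if_cong)
    qed simp
    then have "B \<subseteq> range f" using v by (auto simp: bij_betw_def)
    then have "span B \<subseteq> range f"
      by (intro span_minimal) (auto intro: linear_subspace_image[OF lin])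
    then show ?thesis using B(2) by auto
  qed
  ultimately show ?thesis using lin by (auto simp: bij_def)
qed

section \<open>Forms in coordinates\<close>

lemma vector_4 [simp]:
  "(vector [a, b, c, d] :: 'a::zero ^ 4) $ 1 = a"
  "(vector [a, b, c, d] :: 'a ^ 4) $ 2 = b"
  "(vector [a, b, c, d] :: 'a ^ 4) $ 3 = c"
  "(vector [a, b, c, d] :: 'a ^ 4) $ 4 = d"
  unfolding vector_def by simp_all

abbreviation ev :: "'n::finite \<Rightarrow> real ^ 'n" where "ev i \<equiv> axis i 1"

lemma linear_expand:
  fixes f :: "real ^ 'n \<Rightarrow> real"
  assumes "linear f"
  shows "f x = (\<Sum>i\<in>UNIV. x $ i * f (ev i))"
proof -
  have "f x = f (\<Sum>i\<in>UNIV. x $ i *\<^sub>R ev i)"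
    by (metis basis_expansion scalar_mult_eq_scaleR)
  also have "\<dots> = (\<Sum>i\<in>UNIV. x $ i * f (ev i))"
    using assms by (simp add: linear_sum linear_cmul)
  finally show ?thesis .
qed

lemma linear_eq_0_axis:
  fixes f :: "real ^ 'n \<Rightarrow> real"
  assumes "linear f" "\<And>i. f (ev i) = 0"
  shows "f x = 0"
  using linear_expand[OF assms(1), of x] assms(2) by simp

lemma alt2_swap:
  assumes "alt2 w" shows "w y x = - w x y"
proof -
  have "w (x + y) z = w x z + w y z" "w z (x + y) = w z x + w z y" "w z z = 0" for z
    using assms by (auto simp: alt2_def linear_iff)
  from this(1,2)[of "x + y"] this(1,2)[of x] this(1,2)[of y] this(3)[of "x + y"] this(3)[of x] this(3)[of y]
  show ?thesis by simp
qed

lemma alt3_slice1: "alt3 w \<Longrightarrow> alt2 (w x)"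
  and alt3_slice3: "alt3 w \<Longrightarrow> alt2 (\<lambda>x y. w x y z)"
  by (simp_all add: alt3_def alt2_def)

lemma alt2_combination:
  "alt2 v \<Longrightarrow> alt2 w \<Longrightarrow> alt2 (\<lambda>x y. a * v x y + b * w x y)"
  by (simp add: alt2_def linear_real_combination)

lemma alt2_scale: "alt2 v \<Longrightarrow> alt2 (\<lambda>x y. a * v x y)"
  using alt2_combination[of v v a 0] by simp

lemma alt2_add: "alt2 v \<Longrightarrow> alt2 w \<Longrightarrow> alt2 (\<lambda>x y. v x y + w x y)"
  using alt2_combination[of v w 1 1] by simp

lemma alt3_scale: "alt3 v \<Longrightarrow> alt3 (\<lambda>x y z. a * v x y z)"
  by (auto simp add: alt3_def linear_iff algebra_simps)

lemma alt3_add: "alt3 v \<Longrightarrow> alt3 w \<Longrightarrow> alt3 (\<lambda>x y z. v x y z + w x y z)"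
  by (auto simp add: alt3_def linear_iff algebra_simps)

definition ee3 :: "'n::finite \<Rightarrow> 'n \<Rightarrow> 'n \<Rightarrow> real ^ 'n \<Rightarrow> real ^ 'n \<Rightarrow> real ^ 'n \<Rightarrow> real" where
  "ee3 i j k x y z = x $ i * ee j k y z - y $ i * ee j k x z + z $ i * ee j k x y"

lemma alt2_ee: "alt2 (ee i j)"
  by (simp add: alt2_def linear_iff ee_def algebra_simps)

lemma alt3_ee3: "alt3 (ee3 i j k)"
  by (simp add: alt3_def linear_iff ee3_def ee_def algebra_simps)

definition form2_3 where
  "form2_3 a b c x y = a * ee (1::3) 2 x y + b * ee 1 3 x y + c * ee 2 3 x y"

definition form2_4 where
  "form2_4 a b c d e f x y = a * ee (1::4) 2 x y + b * ee 1 3 x y + c * ee 1 4 x y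
     + d * ee 2 3 x y + e * ee 2 4 x y + f * ee 3 4 x y"

definition form3_4 where
  "form3_4 p q r s x y z = p * ee3 (1::4) 2 3 x y z + q * ee3 1 2 4 x y z
     + r * ee3 1 3 4 x y z + s * ee3 2 3 4 x y z"

lemma alt2_form2_3: "alt2 (form2_3 a b c)"
  unfolding form2_3_def by (intro alt2_add alt2_scale alt2_ee)
lemma alt2_form2_4: "alt2 (form2_4 a b c d e f)"
  unfolding form2_4_def by (intro alt2_add alt2_scale alt2_ee)
lemma alt3_form3_4: "alt3 (form3_4 p q r s)"
  unfolding form3_4_def by (intro alt3_add alt3_scale alt3_ee3)

lemma alt2_expand:
  fixes w :: "real ^ 'n \<Rightarrow> real ^ 'n \<Rightarrow> real"
  assumes "alt2 w"
  shows "w x y = (\<Sum>i\<in>UNIV. \<Sum>j\<in>UNIV. x $ i * (y $ j * w (ev i) (ev j)))"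
proof -
  have l: "linear (\<lambda>x. w x y)" "linear (w x)" for x y using assms by (auto simp: alt2_def)
  show ?thesis
    by (subst linear_expand[OF l(1)]) (subst linear_expand[OF l(2)], simp add: sum_distrib_left)
qed

lemma alt2_expand3:
  assumes "alt2 w"
  shows "w = form2_3 (w (ev 1) (ev 2)) (w (ev 1) (ev 3)) (w (ev 2) (ev 3))"
proof (intro ext)
  fix x y
  have d: "w x x = 0" for x using assms by (simp add: alt2_def)
  show "w x y = form2_3 (w (ev 1) (ev 2)) (w (ev 1) (ev 3)) (w (ev 2) (ev 3)) x y"
    by (subst alt2_expand[OF assms])
      (simp add: sum_3 d form2_3_def ee_def algebra_simps alt2_swap[OF assms, of "ev 2" "ev 1"]
        alt2_swap[OF assms, of "ev 3" "ev 1"] alt2_swap[OF assms, of "ev 3" "ev 2"])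
qed

lemma alt2_expand4:
  assumes "alt2 w"
  shows "w = form2_4 (w (ev 1) (ev 2)) (w (ev 1) (ev 3)) (w (ev 1) (ev 4))
    (w (ev 2) (ev 3)) (w (ev 2) (ev 4)) (w (ev 3) (ev 4))"
proof (intro ext)
  fix x y
  have d: "w x x = 0" for x using assms by (simp add: alt2_def)
  show "w x y = form2_4 (w (ev 1) (ev 2)) (w (ev 1) (ev 3)) (w (ev 1) (ev 4))
    (w (ev 2) (ev 3)) (w (ev 2) (ev 4)) (w (ev 3) (ev 4)) x y"
    by (subst alt2_expand[OF assms])
      (simp add: sum_4 d form2_4_def ee_def algebra_simps alt2_swap[OF assms, of "ev 2" "ev 1"]
        alt2_swap[OF assms, of "ev 3" "ev 1"] alt2_swap[OF assms, of "ev 3" "ev 2"]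
        alt2_swap[OF assms, of "ev 4" "ev 1"] alt2_swap[OF assms, of "ev 4" "ev 2"]
        alt2_swap[OF assms, of "ev 4" "ev 3"])
qed

lemma alt2_eq3:
  fixes v w :: "real ^ 3 \<Rightarrow> _"
  assumes "alt2 v" "alt2 w" "v (ev 1) (ev 2) = w (ev 1) (ev 2)"
    "v (ev 1) (ev 3) = w (ev 1) (ev 3)" "v (ev 2) (ev 3) = w (ev 2) (ev 3)"
  shows "v = w"
  by (subst alt2_expand3[OF assms(1)], subst alt2_expand3[OF assms(2)]) (simp add: assms)

lemma alt2_eq4:
  fixes v w :: "real ^ 4 \<Rightarrow> _"
  assumes "alt2 v" "alt2 w" "v (ev 1) (ev 2) = w (ev 1) (ev 2)"
    "v (ev 1) (ev 3) = w (ev 1) (ev 3)" "v (ev 1) (ev 4) = w (ev 1) (ev 4)"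
    "v (ev 2) (ev 3) = w (ev 2) (ev 3)" "v (ev 2) (ev 4) = w (ev 2) (ev 4)"
    "v (ev 3) (ev 4) = w (ev 3) (ev 4)"
  shows "v = w"
  by (subst alt2_expand4[OF assms(1)], subst alt2_expand4[OF assms(2)]) (simp add: assms)

lemma trilinear_eq_0_axis:
  fixes u :: "real ^ 'n \<Rightarrow> real ^ 'n \<Rightarrow> real ^ 'n \<Rightarrow> real"
  assumes "\<And>y z. linear (\<lambda>x. u x y z)" "\<And>x z. linear (\<lambda>y. u x y z)" "\<And>x y. linear (u x y)"
    and "\<forall>i j k. u (ev i) (ev j) (ev k) = 0"
  shows "u x y z = 0"
proof -
  have "u (ev i) (ev j) z = 0" for i j z
    by (rule linear_eq_0_axis[OF assms(3)]) (use assms(4) in blast)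
  then have "u (ev i) y z = 0" for i y z
    by (rule linear_eq_0_axis[OF assms(2)])
  then show ?thesis
    by (rule linear_eq_0_axis[OF assms(1)])
qed

text \<open>As ordered rewrite rules these sort the arguments, so that of all triples of basis
  vectors only the increasing ones and those with a repetition remain to be checked.\<close>

lemma alt3_eq_0_swap:
  assumes "alt3 u"
  shows "u x z y = 0 \<longleftrightarrow> u x y z = 0" "u y x z = 0 \<longleftrightarrow> u x y z = 0"
proof -
  have "u x z y = - u x y z" by (rule alt2_swap[OF alt3_slice1[OF assms]])
  then show "u x z y = 0 \<longleftrightarrow> u x y z = 0" by simp
  have "u y x z = - u x y z" by (rule alt2_swap[OF alt3_slice3[OF assms]])
  then show "u y x z = 0 \<longleftrightarrow> u x y z = 0" by simp
qed

lemma alt3_diff: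
  assumes "alt3 v" "alt3 w" shows "alt3 (\<lambda>x y z. v x y z - w x y z)"
  using alt3_add[OF assms(1) alt3_scale[OF assms(2), of "-1"]] by simp

lemma alt3_eq_0_axis:
  fixes u :: "real ^ 'n \<Rightarrow> _"
  assumes "alt3 u" "\<forall>i j k. u (ev i) (ev j) (ev k) = 0"
  shows "u x y z = 0"
  using assms(1) by (intro trilinear_eq_0_axis[OF _ _ _ assms(2)]) (simp_all add: alt3_def)

lemma alt3_eq3:
  fixes v w :: "real ^ 3 \<Rightarrow> _"
  assumes "alt3 v" "alt3 w" "v (ev 1) (ev 2) (ev 3) = w (ev 1) (ev 2) (ev 3)"
  shows "v = w"
proof -
  define u where "u = (\<lambda>x y z. v x y z - w x y z)"
  have u: "alt3 u" unfolding u_def by (rule alt3_diff[OF assms(1,2)])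
  have "u x x y = 0" "u x y x = 0" "u x y y = 0" "u (ev 1) (ev 2) (ev 3) = 0" for x y
    using u assms(3) by (auto simp: alt3_def u_def)
  then have "\<forall>i j k. u (ev i) (ev j) (ev k) = 0"
    unfolding forall_3 by (simp add: alt3_eq_0_swap[OF u])
  then have "u x y z = 0" for x y z by (rule alt3_eq_0_axis[OF u])
  then show ?thesis by (simp add: u_def fun_eq_iff)
qed

lemma alt3_eq4:
  fixes v w :: "real ^ 4 \<Rightarrow> _"
  assumes "alt3 v" "alt3 w" "v (ev 1) (ev 2) (ev 3) = w (ev 1) (ev 2) (ev 3)"
    "v (ev 1) (ev 2) (ev 4) = w (ev 1) (ev 2) (ev 4)"
    "v (ev 1) (ev 3) (ev 4) = w (ev 1) (ev 3) (ev 4)"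
    "v (ev 2) (ev 3) (ev 4) = w (ev 2) (ev 3) (ev 4)"
  shows "v = w"
proof -
  define u where "u = (\<lambda>x y z. v x y z - w x y z)"
  have u: "alt3 u" unfolding u_def by (rule alt3_diff[OF assms(1,2)])
  have "u x x y = 0" "u x y x = 0" "u x y y = 0" "u (ev 1) (ev 2) (ev 3) = 0"
    "u (ev 1) (ev 2) (ev 4) = 0" "u (ev 1) (ev 3) (ev 4) = 0" "u (ev 2) (ev 3) (ev 4) = 0" for x y
    using u assms(3-) by (auto simp: alt3_def u_def)
  then have "\<forall>i j k. u (ev i) (ev j) (ev k) = 0"
    unfolding forall_4 by (simp add: alt3_eq_0_swap[OF u])
  then have "u x y z = 0" for x y z by (rule alt3_eq_0_axis[OF u])
  then show ?thesis by (simp add: u_def fun_eq_iff)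
qed

lemma form2_3_axis [simp]:
  "form2_3 a b c (ev 1) (ev 2) = a" "form2_3 a b c (ev 1) (ev 3) = b" "form2_3 a b c (ev 2) (ev 3) = c"
  by (simp_all add: form2_3_def ee_def axis_def)

lemma form2_4_axis [simp]:
  "form2_4 a b c d e f (ev 1) (ev 2) = a" "form2_4 a b c d e f (ev 1) (ev 3) = b"
  "form2_4 a b c d e f (ev 1) (ev 4) = c" "form2_4 a b c d e f (ev 2) (ev 3) = d"
  "form2_4 a b c d e f (ev 2) (ev 4) = e" "form2_4 a b c d e f (ev 3) (ev 4) = f"
  by (simp_all add: form2_4_def ee_def axis_def)

lemma form3_4_axis [simp]:
  "form3_4 p q r s (ev 1) (ev 2) (ev 3) = p" "form3_4 p q r s (ev 1) (ev 2) (ev 4) = q"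
  "form3_4 p q r s (ev 1) (ev 3) (ev 4) = r" "form3_4 p q r s (ev 2) (ev 3) (ev 4) = s"
  by (simp_all add: form3_4_def ee3_def ee_def axis_def)

lemma lie_algebraD:
  assumes "lie_algebra br"
  shows "br (x + x') y = br x y + br x' y" "br x (y + y') = br x y + br x y'"
    "br (c *\<^sub>R x) y = c *\<^sub>R br x y" "br x (c *\<^sub>R y) = c *\<^sub>R br x y" "br x x = 0"
    "br x (br y z) + br y (br z x) + br z (br x y) = 0"
  using assms by (auto simp: lie_algebra_def bilinear_def linear_iff)

lemma lie_algebra_swap:
  assumes "lie_algebra br" shows "br y x = - br x y"
proof -
  have "br (x + y) (x + y) = br x x + br y x + (br x y + br y y)"
    by (simp only: lie_algebraD(1,2)[OF assms])
  then have "br y x + br x y = 0" by (simp only: lie_algebraD(5)[OF assms] add_0_left add_0_right)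
  then show ?thesis by (simp add: eq_neg_iff_add_eq_0)
qed

lemma linear_bracket:
  assumes "lie_algebra br" "linear f"
  shows "linear (\<lambda>x. f (br x y))" "linear (\<lambda>y. f (br x y))"
  using assms by (simp_all add: linear_iff lie_algebraD[OF assms(1)])

lemma linear_add3:
  fixes f g h :: "'a::real_vector \<Rightarrow> real"
  assumes "linear f" "linear g" "linear h"
  shows "linear (\<lambda>x. f x - g x + h x)"
  using assms by (simp add: linear_iff algebra_simps)

text \<open>The two adjacent transpositions generate all permutations: linearity spreads from the
  first slot to the others, and over the reals antisymmetry forces the form to vanish on equal
  arguments.\<close>

lemma alt3I:
  assumes "\<And>y z. linear (\<lambda>x. u x y z)"
    and "\<And>x y z. u y x z = - u x y z" "\<And>x y z. u x z y = - u x y z"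
  shows "alt3 (u :: 'a::real_vector \<Rightarrow> 'a \<Rightarrow> 'a \<Rightarrow> real)"
proof -
  have "linear (\<lambda>y. - u y x z)" for x z using assms(1) by (simp add: linear_iff)
  then have "linear (\<lambda>y. u x y z)" for x z by (simp only: assms(2)[symmetric])
  moreover from this have "linear (\<lambda>z. - u x z y)" for x y by (simp add: linear_iff)
  then have "linear (\<lambda>z. u x y z)" for x y by (simp only: assms(3)[symmetric])
  moreover have "u x x y = 0" "u x y y = 0" for x y
    using assms(2)[of x x y] assms(3)[of x y y] by simp_all
  moreover have "u x y x = 0" for x y using calculation(3)[of x y] assms(3)[of x y x] by simp
  ultimately show ?thesis using assms(1) by (simp add: alt3_def)
qed

lemma alt3_diff2:
  assumes "lie_algebra br" "alt2 w" shows "alt3 (diff2 br w)"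
proof (rule alt3I)
  have l: "linear (\<lambda>x. w x y)" "linear (w x)" for x y using assms(2) by (auto simp: alt2_def)
  note lb = linear_bracket[OF assms(1)]
  show "linear (\<lambda>x. diff2 br w x y z)" for y z
    unfolding diff2_def by (intro linear_add3 lb(1)[OF l(1)] l(2))
  have n: "w (- x) y = - w x y" for x y using linear_neg[OF l(1)] by simp
  show "diff2 br w y x z = - diff2 br w x y z" for x y z
    by (simp add: diff2_def lie_algebra_swap[OF assms(1), of y x] n)
  show "diff2 br w x z y = - diff2 br w x y z" for x y z
    by (simp add: diff2_def lie_algebra_swap[OF assms(1), of z y] n)
qed

text \<open>Vanishing of an alternating form does not depend on the order of the arguments, so it can be
  decided by ordered rewriting of the basis vectors.\<close>

lemma diff3_eq_0_swap:
  assumes "lie_algebra br" "alt3 w"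
  shows "diff3 br w y x z u = 0 \<longleftrightarrow> diff3 br w x y z u = 0"
    "diff3 br w x z y u = 0 \<longleftrightarrow> diff3 br w x y z u = 0"
    "diff3 br w x y u z = 0 \<longleftrightarrow> diff3 br w x y z u = 0"
    and "diff3 br w x x z u = 0" "diff3 br w x y y u = 0" "diff3 br w x y z z = 0"
proof -
  have l: "linear (\<lambda>x. w x y z)" for y z using assms(2) by (auto simp: alt3_def)
  have n: "w (- x) y z = - w x y z" for x y z using linear_neg[OF l] by simp
  have n0: "w 0 y z = 0" "w x z z = 0" for x y z using linear_0[OF l] assms(2) by (auto simp: alt3_def)
  have s: "w x z y = - w x y z" for x y z by (rule alt2_swap[OF alt3_slice1[OF assms(2)]])
  note b = lie_algebra_swap[OF assms(1)]
  have "diff3 br w y x z u = - diff3 br w x y z u"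
    by (simp add: diff3_def b[of y x] s[of _ y x] n)
  moreover have "diff3 br w x z y u = - diff3 br w x y z u"
    by (simp add: diff3_def b[of z y] s[of _ z y] n)
  moreover have "diff3 br w x y u z = - diff3 br w x y z u"
    by (simp add: diff3_def b[of u z] s[of _ u z] n)
  ultimately show "diff3 br w y x z u = 0 \<longleftrightarrow> diff3 br w x y z u = 0"
    "diff3 br w x z y u = 0 \<longleftrightarrow> diff3 br w x y z u = 0"
    "diff3 br w x y u z = 0 \<longleftrightarrow> diff3 br w x y z u = 0" by simp_all
  show "diff3 br w x x z u = 0" "diff3 br w x y y u = 0" "diff3 br w x y z z = 0"
    by (simp_all add: diff3_def lie_algebraD(5)[OF assms(1)] n0 b[of y x] n b[of z x] b[of y z])
qed

lemma diff3_eq_0_axis: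
  fixes br :: "real ^ 'n \<Rightarrow> _"
  assumes "lie_algebra br" "alt3 w"
    and "\<forall>i j k l. diff3 br w (ev i) (ev j) (ev k) (ev l) = 0"
  shows "diff3 br w x y z u = 0"
proof -
  have w: "linear (\<lambda>x. w x y z)" "linear (\<lambda>y. w x y z)" "linear (w x y)" for x y z
    using assms(2) by (auto simp: alt3_def)
  have sum6: "linear (\<lambda>x. a x - b x + c x + d x - e x + f x)"
    if "linear a" "linear b" "linear c" "linear d" "linear e" "linear f"
    for a b c d e f :: "real ^ 'n \<Rightarrow> real"
    using that by (simp add: linear_iff algebra_simps)
  note lb = linear_bracket[OF assms(1)]
  have 1: "linear (\<lambda>x. diff3 br w x y z u)" for y z u
    unfolding diff3_def by (intro sum6 lb(1)[OF w(1)] w(2))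
  have 2: "linear (\<lambda>y. diff3 br w x y z u)" for x z u
    unfolding diff3_def by (intro sum6 lb(1)[OF w(1)] lb(2)[OF w(1)] w(2,3))
  have 3: "linear (\<lambda>z. diff3 br w x y z u)" for x y u
    unfolding diff3_def by (intro sum6 lb(1)[OF w(1)] lb(2)[OF w(1)] w(2,3))
  have 4: "linear (\<lambda>u. diff3 br w x y z u)" for x y z
    unfolding diff3_def by (intro sum6 lb(2)[OF w(1)] w(3))
  have "diff3 br w (ev i) y z u = 0" for i y z u
    by (rule trilinear_eq_0_axis[OF 2 3 4]) (use assms(3) in blast)
  then show ?thesis by (rule linear_eq_0_axis[OF 1])
qed

text \<open>Among four basis vectors of a three-dimensional space two coincide, so there are no
  nonzero 4-forms and every 3-form is closed.\<close>

lemma diff3_eq_0_3: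
  fixes br :: "real ^ 3 \<Rightarrow> _"
  assumes "lie_algebra br" "alt3 w"
  shows "diff3 br w x y z u = 0"
proof (rule diff3_eq_0_axis[OF assms])
  show "\<forall>i j k l. diff3 br w (ev i) (ev j) (ev k) (ev l) = 0"
    unfolding forall_3 by (simp add: diff3_eq_0_swap[OF assms])
qed

lemma diff3_eq_0_4:
  fixes br :: "real ^ 4 \<Rightarrow> _"
  assumes "lie_algebra br" "alt3 w" "diff3 br w (ev 1) (ev 2) (ev 3) (ev 4) = 0"
  shows "diff3 br w x y z u = 0"
proof (rule diff3_eq_0_axis[OF assms(1,2)])
  show "\<forall>i j k l. diff3 br w (ev i) (ev j) (ev k) (ev l) = 0"
    unfolding forall_4 by (simp add: diff3_eq_0_swap[OF assms(1,2)] assms(3))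
qed

section \<open>The vanishing conditions as linear systems in the coefficients\<close>

lemma linear_inner_expand:
  fixes a :: "real ^ 'n \<Rightarrow> real"
  assumes "linear a"
  shows "a = (\<lambda>x. (\<chi> i. a (ev i)) \<bullet> x)"
  by (rule ext, subst linear_expand[OF assms]) (simp add: inner_vec_def mult.commute)

lemma alt2_inner_bracket:
  assumes "lie_algebra br" shows "alt2 (\<lambda>x y. u \<bullet> br x y)"
  using assms by (simp add: alt2_def linear_iff lie_algebraD[OF assms] inner_add_right)

lemma H2_zero_form: "H2_zero br \<longleftrightarrow> (\<forall>w. alt2 w \<and> diff2 br w = (\<lambda>_ _ _. 0) \<longrightarrow>
     (\<exists>u. w = (\<lambda>x y. u \<bullet> br x y)))" for br :: "real ^ 'n \<Rightarrow> _"
proof -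
  have "(\<exists>a. linear a \<and> (\<forall>x y. w x y = a (br x y))) \<longleftrightarrow> (\<exists>u. w = (\<lambda>x y. u \<bullet> br x y))" (is "?l = ?r") for w
  proof
    assume ?l
    then show ?r using linear_inner_expand by (metis ext)
  next
    assume ?r
    then obtain u where "w = (\<lambda>x y. u \<bullet> br x y)" by blast
    then show ?l by (intro exI[of _ "\<lambda>x. u \<bullet> x"]) (simp add: linear_iff inner_add_right)
  qed
  then show ?thesis by (simp add: H2_zero_def fun_eq_iff)
qed

lemma H3_zero_form: "H3_zero br \<longleftrightarrow> (\<forall>w. alt3 w \<and> (\<forall>x y z u. diff3 br w x y z u = 0) \<longrightarrow>
     (\<exists>b. alt2 b \<and> w = diff2 br b))"
  by (simp add: H3_zero_def fun_eq_iff)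

lemma alt3_zero: "alt3 (\<lambda>_ _ _. 0)"
  by (simp add: alt3_def linear_iff)

lemma H2_zero_3:
  assumes "lie_algebra br"
  shows "H2_zero br \<longleftrightarrow> (\<forall>a b c. diff2 br (form2_3 a b c) (ev 1) (ev 2) (ev 3) = 0 \<longrightarrow>
    (\<exists>u. a = u \<bullet> br (ev 1) (ev 2) \<and> b = u \<bullet> br (ev 1) (ev 3) \<and> c = u \<bullet> br (ev 2) (ev 3)))"
    (is "_ \<longleftrightarrow> ?r")
proof
  assume H: "H2_zero br"
  show ?r
  proof (intro allI impI)
    fix a b c assume "diff2 br (form2_3 a b c) (ev 1) (ev 2) (ev 3) = 0"
    then have "diff2 br (form2_3 a b c) = (\<lambda>_ _ _. 0)"
      by (intro alt3_eq3 alt3_diff2[OF assms] alt2_form2_3 alt3_zero)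
    then obtain u where "form2_3 a b c = (\<lambda>x y. u \<bullet> br x y)"
      using H alt2_form2_3 unfolding H2_zero_form by blast
    then show "\<exists>u. a = u \<bullet> br (ev 1) (ev 2) \<and> b = u \<bullet> br (ev 1) (ev 3) \<and> c = u \<bullet> br (ev 2) (ev 3)"
      by (metis form2_3_axis)
  qed
next
  assume r: ?r
  show "H2_zero br" unfolding H2_zero_form
  proof (intro allI impI, elim conjE)
    fix w assume w: "alt2 w" "diff2 br w = (\<lambda>_ _ _. 0)"
    let ?f = "form2_3 (w (ev 1) (ev 2)) (w (ev 1) (ev 3)) (w (ev 2) (ev 3))"
    have "diff2 br ?f (ev 1) (ev 2) (ev 3) = 0"
      using w alt2_expand3[OF w(1)] by metis
    then obtain u where "w (ev 1) (ev 2) = u \<bullet> br (ev 1) (ev 2)" "w (ev 1) (ev 3) = u \<bullet> br (ev 1) (ev 3)"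
      "w (ev 2) (ev 3) = u \<bullet> br (ev 2) (ev 3)" using r by blast
    then have "w = (\<lambda>x y. u \<bullet> br x y)"
      by (intro alt2_eq3 w(1) alt2_inner_bracket[OF assms])
    then show "\<exists>u. w = (\<lambda>x y. u \<bullet> br x y)" by blast
  qed
qed

lemma H2_zero_4:
  assumes "lie_algebra br"
  shows "H2_zero br \<longleftrightarrow> (\<forall>a b c d e f. diff2 br (form2_4 a b c d e f) (ev 1) (ev 2) (ev 3) = 0 \<and>
      diff2 br (form2_4 a b c d e f) (ev 1) (ev 2) (ev 4) = 0 \<and>
      diff2 br (form2_4 a b c d e f) (ev 1) (ev 3) (ev 4) = 0 \<and>
      diff2 br (form2_4 a b c d e f) (ev 2) (ev 3) (ev 4) = 0 \<longrightarrow>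
    (\<exists>u. a = u \<bullet> br (ev 1) (ev 2) \<and> b = u \<bullet> br (ev 1) (ev 3) \<and> c = u \<bullet> br (ev 1) (ev 4) \<and>
      d = u \<bullet> br (ev 2) (ev 3) \<and> e = u \<bullet> br (ev 2) (ev 4) \<and> f = u \<bullet> br (ev 3) (ev 4)))"
    (is "_ \<longleftrightarrow> ?r")
proof
  assume H: "H2_zero br"
  show ?r
  proof (intro allI impI, elim conjE)
    fix a b c d e f
    let ?f = "form2_4 a b c d e f"
    assume "diff2 br ?f (ev 1) (ev 2) (ev 3) = 0" "diff2 br ?f (ev 1) (ev 2) (ev 4) = 0"
      "diff2 br ?f (ev 1) (ev 3) (ev 4) = 0" "diff2 br ?f (ev 2) (ev 3) (ev 4) = 0"
    then have "diff2 br ?f = (\<lambda>_ _ _. 0)"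
      by (intro alt3_eq4 alt3_diff2[OF assms] alt2_form2_4 alt3_zero)
    then obtain u where u: "?f = (\<lambda>x y. u \<bullet> br x y)"
      using H alt2_form2_4 unfolding H2_zero_form by blast
    show "\<exists>u. a = u \<bullet> br (ev 1) (ev 2) \<and> b = u \<bullet> br (ev 1) (ev 3) \<and> c = u \<bullet> br (ev 1) (ev 4) \<and>
      d = u \<bullet> br (ev 2) (ev 3) \<and> e = u \<bullet> br (ev 2) (ev 4) \<and> f = u \<bullet> br (ev 3) (ev 4)"
      using form2_4_axis[of a b c d e f] unfolding u by (intro exI[of _ u]) simp
  qed
next
  assume r: ?r
  show "H2_zero br" unfolding H2_zero_form
  proof (intro allI impI, elim conjE)
    fix w assume w: "alt2 w" "diff2 br w = (\<lambda>_ _ _. 0)"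
    obtain u where "w (ev 1) (ev 2) = u \<bullet> br (ev 1) (ev 2)" "w (ev 1) (ev 3) = u \<bullet> br (ev 1) (ev 3)"
      "w (ev 1) (ev 4) = u \<bullet> br (ev 1) (ev 4)" "w (ev 2) (ev 3) = u \<bullet> br (ev 2) (ev 3)"
      "w (ev 2) (ev 4) = u \<bullet> br (ev 2) (ev 4)" "w (ev 3) (ev 4) = u \<bullet> br (ev 3) (ev 4)"
      using r[rule_format, of "w (ev 1) (ev 2)" "w (ev 1) (ev 3)" "w (ev 1) (ev 4)"
          "w (ev 2) (ev 3)" "w (ev 2) (ev 4)" "w (ev 3) (ev 4)"]
      unfolding alt2_expand4[OF w(1), symmetric] w(2) by auto
    then have "w = (\<lambda>x y. u \<bullet> br x y)"
      by (intro alt2_eq4 w(1) alt2_inner_bracket[OF assms])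
    then show "\<exists>u. w = (\<lambda>x y. u \<bullet> br x y)" by blast
  qed
qed

text \<open>The 3-forms make up a line and all of them are closed, so exactness only asks that some
  2-form has a nonzero differential.\<close>

lemma H3_zero_3:
  assumes "lie_algebra br"
  shows "H3_zero br \<longleftrightarrow> (\<exists>a b c. diff2 br (form2_3 a b c) (ev 1) (ev 2) (ev 3) \<noteq> 0)"
proof
  assume H: "H3_zero br"
  then obtain b where b: "alt2 b" "ee3 1 2 3 = diff2 br b"
    unfolding H3_zero_form using diff3_eq_0_3[OF assms alt3_ee3] alt3_ee3 by blast
  have "ee3 1 2 3 (ev 1) (ev 2) (ev 3 :: real ^ 3) = 1"
    by (simp add: ee3_def ee_def axis_def)
  then show "\<exists>a b c. diff2 br (form2_3 a b c) (ev 1) (ev 2) (ev 3) \<noteq> 0"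
    using b alt2_expand3[OF b(1)] by (metis zero_neq_one)
next
  assume "\<exists>a b c. diff2 br (form2_3 a b c) (ev 1) (ev 2) (ev 3) \<noteq> 0"
  then obtain b where b: "alt2 b" "diff2 br b (ev 1) (ev 2) (ev 3) \<noteq> 0"
    using alt2_form2_3 by blast
  show "H3_zero br" unfolding H3_zero_form
  proof (intro allI impI, elim conjE)
    fix w :: "real ^ 3 \<Rightarrow> real ^ 3 \<Rightarrow> real ^ 3 \<Rightarrow> real" assume w: "alt3 w"
    define t where "t = w (ev 1) (ev 2) (ev 3) / diff2 br b (ev 1) (ev 2) (ev 3)"
    have tb: "alt2 (\<lambda>x y. t * b x y)" by (rule alt2_scale[OF b(1)])
    have "diff2 br (\<lambda>x y. t * b x y) x y z = t * diff2 br b x y z" for x y z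
      by (simp add: diff2_def algebra_simps)
    then have "w = diff2 br (\<lambda>x y. t * b x y)"
      by (intro alt3_eq3 w alt3_diff2[OF assms tb]) (simp add: t_def b(2))
    then show "\<exists>b. alt2 b \<and> w = diff2 br b" using tb by blast
  qed
qed

lemma H3_zero_4:
  assumes "lie_algebra br"
  shows "H3_zero br \<longleftrightarrow> (\<forall>p q r s. diff3 br (form3_4 p q r s) (ev 1) (ev 2) (ev 3) (ev 4) = 0 \<longrightarrow>
    (\<exists>a b c d e f. p = diff2 br (form2_4 a b c d e f) (ev 1) (ev 2) (ev 3) \<and>
      q = diff2 br (form2_4 a b c d e f) (ev 1) (ev 2) (ev 4) \<and>
      r = diff2 br (form2_4 a b c d e f) (ev 1) (ev 3) (ev 4) \<and>
      s = diff2 br (form2_4 a b c d e f) (ev 2) (ev 3) (ev 4)))"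
    (is "_ \<longleftrightarrow> ?r")
proof
  assume H: "H3_zero br"
  show ?r
  proof (intro allI impI)
    fix p q r s
    let ?f = "form3_4 p q r s"
    assume "diff3 br ?f (ev 1) (ev 2) (ev 3) (ev 4) = 0"
    then have "diff3 br ?f x y z u = 0" for x y z u by (rule diff3_eq_0_4[OF assms alt3_form3_4])
    then obtain b where b: "alt2 b" "?f = diff2 br b"
      using H alt3_form3_4 unfolding H3_zero_form by blast
    obtain a1 a2 a3 a4 a5 a6 where a: "b = form2_4 a1 a2 a3 a4 a5 a6"
      using alt2_expand4[OF b(1)] by blast
    show "\<exists>a b c d e f. p = diff2 br (form2_4 a b c d e f) (ev 1) (ev 2) (ev 3) \<and>
      q = diff2 br (form2_4 a b c d e f) (ev 1) (ev 2) (ev 4) \<and>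
      r = diff2 br (form2_4 a b c d e f) (ev 1) (ev 3) (ev 4) \<and>
      s = diff2 br (form2_4 a b c d e f) (ev 2) (ev 3) (ev 4)"
      by (intro exI[of _ a1] exI[of _ a2] exI[of _ a3] exI[of _ a4] exI[of _ a5] exI[of _ a6])
        (simp flip: a b(2))
  qed
next
  assume r: ?r
  show "H3_zero br" unfolding H3_zero_form
  proof (intro allI impI, elim conjE)
    fix w assume w: "alt3 w" "\<forall>x y z u. diff3 br w x y z u = 0"
    let ?f = "form3_4 (w (ev 1) (ev 2) (ev 3)) (w (ev 1) (ev 2) (ev 4)) (w (ev 1) (ev 3) (ev 4))
      (w (ev 2) (ev 3) (ev 4))"
    have f: "?f = w" by (rule alt3_eq4[OF alt3_form3_4 w(1)]) simp_all
    then have "diff3 br ?f (ev 1) (ev 2) (ev 3) (ev 4) = 0" using w(2) by simp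
    then obtain a b c d e f where
      *: "w (ev 1) (ev 2) (ev 3) = diff2 br (form2_4 a b c d e f) (ev 1) (ev 2) (ev 3)"
      "w (ev 1) (ev 2) (ev 4) = diff2 br (form2_4 a b c d e f) (ev 1) (ev 2) (ev 4)"
      "w (ev 1) (ev 3) (ev 4) = diff2 br (form2_4 a b c d e f) (ev 1) (ev 3) (ev 4)"
      "w (ev 2) (ev 3) (ev 4) = diff2 br (form2_4 a b c d e f) (ev 2) (ev 3) (ev 4)"
      using r by blast
    have "w = diff2 br (form2_4 a b c d e f)"
      by (rule alt3_eq4[OF w(1) alt3_diff2[OF assms alt2_form2_4] *])
    then show "\<exists>b. alt2 b \<and> w = diff2 br b" using alt2_form2_4 by blast
  qed
qed

section \<open>Semidirect products with a line\<close>

lemma det_nz_iff_surj: "det A \<noteq> 0 \<longleftrightarrow> (\<forall>b. \<exists>x. A *v x = b)" for A :: "real ^ 'n ^ 'n"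
  unfolding invertible_det_nz[symmetric] invertible_right_inverse matrix_right_invertible_surjective
    surj_def by metis

lemma det_nz_iff_inj: "det A \<noteq> 0 \<longleftrightarrow> (\<forall>x. A *v x = 0 \<longrightarrow> x = 0)" for A :: "real ^ 'n ^ 'n"
  unfolding invertible_det_nz[symmetric] invertible_left_inverse matrix_left_invertible_ker ..

lemma matrix_vector_2: "A *v x = vector [A$1$1 * x$1 + A$1$2 * x$2, A$2$1 * x$1 + A$2$2 * x$2]"
  for A :: "real ^ 2 ^ 2"
  by (simp add: vec_eq_iff forall_2 matrix_vector_mult_def sum_2)

lemma matrix_vector_3: "A *v x = vector [A$1$1 * x$1 + A$1$2 * x$2 + A$1$3 * x$3,
    A$2$1 * x$1 + A$2$2 * x$2 + A$2$3 * x$3, A$3$1 * x$1 + A$3$2 * x$2 + A$3$3 * x$3]"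
  for A :: "real ^ 3 ^ 3"
  by (simp add: vec_eq_iff forall_3 matrix_vector_mult_def sum_3)

lemma exists_vector_2: "(\<exists>v :: real ^ 2. P v) \<longleftrightarrow> (\<exists>x y. P (vector [x, y]))"
  using forall_vector_2[of "\<lambda>v. \<not> P v"] by blast

lemma exists_vector_3: "(\<exists>v :: real ^ 3. P v) \<longleftrightarrow> (\<exists>x y z. P (vector [x, y, z]))"
  using forall_vector_3[of "\<lambda>v. \<not> P v"] by blast

lemma linear_system_2:
  fixes a b c d :: real
  shows "(\<forall>p q. \<exists>x y. p = a * x + b * y \<and> q = c * x + d * y) \<longleftrightarrow> a * d - b * c \<noteq> 0"
    and "(\<forall>x y. a * x + b * y = 0 \<and> c * x + d * y = 0 \<longrightarrow> x = 0 \<and> y = 0) \<longleftrightarrow> a * d - b * c \<noteq> 0"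
proof -
  let ?A = "vector [vector [a, b], vector [c, d]] :: real ^ 2 ^ 2"
  have d: "det ?A = a * d - b * c" by (simp add: det_2)
  show "(\<forall>p q. \<exists>x y. p = a * x + b * y \<and> q = c * x + d * y) \<longleftrightarrow> a * d - b * c \<noteq> 0"
    unfolding d[symmetric] det_nz_iff_surj
    by (simp add: forall_vector_2 exists_vector_2 matrix_vector_2) (simp add: vec_eq_iff forall_2 eq_commute)
  show "(\<forall>x y. a * x + b * y = 0 \<and> c * x + d * y = 0 \<longrightarrow> x = 0 \<and> y = 0) \<longleftrightarrow> a * d - b * c \<noteq> 0"
    unfolding d[symmetric] det_nz_iff_inj
    by (simp add: forall_vector_2 matrix_vector_2) (simp add: vec_eq_iff forall_2)
qed

lemma linear_system_3:
  fixes A :: "real ^ 3 ^ 3"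
  shows "(\<forall>p q r. \<exists>x y z. p = A$1$1 * x + A$1$2 * y + A$1$3 * z \<and>
      q = A$2$1 * x + A$2$2 * y + A$2$3 * z \<and> r = A$3$1 * x + A$3$2 * y + A$3$3 * z) \<longleftrightarrow> det A \<noteq> 0"
    and "(\<forall>x y z. A$1$1 * x + A$1$2 * y + A$1$3 * z = 0 \<and> A$2$1 * x + A$2$2 * y + A$2$3 * z = 0 \<and>
      A$3$1 * x + A$3$2 * y + A$3$3 * z = 0 \<longrightarrow> x = 0 \<and> y = 0 \<and> z = 0) \<longleftrightarrow> det A \<noteq> 0"
  unfolding det_nz_iff_surj
  subgoal by (simp add: forall_vector_3 exists_vector_3 matrix_vector_3) (simp add: vec_eq_iff forall_3 eq_commute)
  unfolding det_nz_iff_surj[symmetric] det_nz_iff_inj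
  by (simp add: forall_vector_3 matrix_vector_3) (simp add: vec_eq_iff forall_3)

text \<open>In \<open>gen4 A M\<close> the matrix \<open>A\<close> is \<open>ad e\<^sub>1\<close> on the ideal spanned by \<open>e\<^sub>2, e\<^sub>3, e\<^sub>4\<close>, and the
  columns of \<open>M\<close> are \<open>[e\<^sub>3, e\<^sub>4]\<close>, \<open>[e\<^sub>4, e\<^sub>2]\<close>, \<open>[e\<^sub>2, e\<^sub>3]\<close>: with this cyclic order the ideal is
  unimodular iff \<open>M\<close> is symmetric. Likewise for \<open>gen3\<close>. The ideal is abelian in \<open>sd3\<close> and \<open>sd4\<close>,
  and the Heisenberg algebra with centre \<open>e\<^sub>4\<close> in \<open>hs4\<close>.\<close>

definition gen3 :: "real ^ 2 ^ 2 \<Rightarrow> real ^ 2 \<Rightarrow> real ^ 3 \<Rightarrow> real ^ 3 \<Rightarrow> real ^ 3" where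
  "gen3 B m x y = vector [0,
     B$1$1 * ee 1 2 x y + B$1$2 * ee 1 3 x y + m$1 * ee 2 3 x y,
     B$2$1 * ee 1 2 x y + B$2$2 * ee 1 3 x y + m$2 * ee 2 3 x y]"

definition gen4 :: "real ^ 3 ^ 3 \<Rightarrow> real ^ 3 ^ 3 \<Rightarrow> real ^ 4 \<Rightarrow> real ^ 4 \<Rightarrow> real ^ 4" where
  "gen4 A M x y = vector [0,
     A$1$1 * ee 1 2 x y + A$1$2 * ee 1 3 x y + A$1$3 * ee 1 4 x y
       + M$1$1 * ee 3 4 x y + M$1$2 * ee 4 2 x y + M$1$3 * ee 2 3 x y,
     A$2$1 * ee 1 2 x y + A$2$2 * ee 1 3 x y + A$2$3 * ee 1 4 x y
       + M$2$1 * ee 3 4 x y + M$2$2 * ee 4 2 x y + M$2$3 * ee 2 3 x y,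
     A$3$1 * ee 1 2 x y + A$3$2 * ee 1 3 x y + A$3$3 * ee 1 4 x y
       + M$3$1 * ee 3 4 x y + M$3$2 * ee 4 2 x y + M$3$3 * ee 2 3 x y]"

abbreviation sd3 :: "real ^ 2 ^ 2 \<Rightarrow> real ^ 3 \<Rightarrow> real ^ 3 \<Rightarrow> real ^ 3" where
  "sd3 B \<equiv> gen3 B 0"

abbreviation sd4 :: "real ^ 3 ^ 3 \<Rightarrow> real ^ 4 \<Rightarrow> real ^ 4 \<Rightarrow> real ^ 4" where
  "sd4 A \<equiv> gen4 A 0"

text \<open>The last diagonal entry is forced: a derivation applied to the relation that
  \<open>e4\<close> is the bracket of \<open>e2\<close> and \<open>e3\<close> acts on
  \<open>e4\<close> by its trace on the plane of \<open>e2\<close> and \<open>e3\<close>.\<close>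

definition hs4 :: "real ^ 2 ^ 2 \<Rightarrow> real ^ 4 \<Rightarrow> real ^ 4 \<Rightarrow> real ^ 4" where
  "hs4 B = gen4 (vector [vector [B$1$1, B$1$2, 0], vector [B$2$1, B$2$2, 0], vector [0, 0, trace B]])
     (vector [0, 0, vector [0, 0, 1]])"

lemma gen3_axis:
  "gen3 B m (ev 1) (ev 2) = vector [0, B$1$1, B$2$1]"
  "gen3 B m (ev 1) (ev 3) = vector [0, B$1$2, B$2$2]"
  "gen3 B m (ev 2) (ev 3) = vector [0, m$1, m$2]"
  by (simp_all add: gen3_def vec_eq_iff forall_3 ee_def axis_def)

lemma gen4_axis:
  "gen4 A M (ev 1) (ev 2) = vector [0, A$1$1, A$2$1, A$3$1]"
  "gen4 A M (ev 1) (ev 3) = vector [0, A$1$2, A$2$2, A$3$2]"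
  "gen4 A M (ev 1) (ev 4) = vector [0, A$1$3, A$2$3, A$3$3]"
  "gen4 A M (ev 2) (ev 3) = vector [0, M$1$3, M$2$3, M$3$3]"
  "gen4 A M (ev 2) (ev 4) = vector [0, - M$1$2, - M$2$2, - M$3$2]"
  "gen4 A M (ev 3) (ev 4) = vector [0, M$1$1, M$2$1, M$3$1]"
  by (simp_all add: gen4_def vec_eq_iff forall_4 ee_def axis_def)

lemma bilinear_alternating_gen3: "bilinear (gen3 B m)" "gen3 B m x x = 0"
  by (simp_all add: bilinear_def linear_iff gen3_def vec_eq_iff forall_3 ee_def algebra_simps)

lemma bilinear_alternating_gen4: "bilinear (gen4 A M)" "gen4 A M x x = 0"
  by (simp_all add: bilinear_def linear_iff gen4_def vec_eq_iff forall_4 ee_def algebra_simps)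

lemma lie_algebra_sd3: "lie_algebra (sd3 B)"
  unfolding lie_algebra_def using bilinear_alternating_gen3
  by (simp add: gen3_def vec_eq_iff forall_3 ee_def) (simp add: algebra_simps)

lemma lie_algebra_sd4: "lie_algebra (sd4 A)"
  unfolding lie_algebra_def using bilinear_alternating_gen4
  by (simp add: gen4_def vec_eq_iff forall_4 ee_def) (simp add: algebra_simps)

lemma lie_algebra_hs4: "lie_algebra (hs4 B)"
  unfolding lie_algebra_def hs4_def using bilinear_alternating_gen4
  by (simp add: gen4_def vec_eq_iff forall_4 ee_def trace_def sum_2) (simp add: algebra_simps)

section \<open>The vanishing conditions for the three families\<close>

lemma inner_3: "(u :: real ^ 3) \<bullet> v = u$1 * v$1 + u$2 * v$2 + u$3 * v$3"
  by (simp add: inner_vec_def sum_3)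
lemma inner_4: "(u :: real ^ 4) \<bullet> v = u$1 * v$1 + u$2 * v$2 + u$3 * v$3 + u$4 * v$4"
  by (simp add: inner_vec_def sum_4)

lemma exists_vector_4: "(\<exists>v :: real ^ 4. P v) \<longleftrightarrow> (\<exists>x y z u. P (vector [x, y, z, u]))"
proof
  assume "\<exists>v. P v"
  then obtain v where "P v" by blast
  moreover have "v = vector [v$1, v$2, v$3, v$4]" by (simp add: vec_eq_iff forall_4)
  ultimately show "\<exists>x y z u. P (vector [x, y, z, u])" by metis
qed blast

text \<open>The forms \<open>e1 \<and> \<gamma>\<close> are always closed, and exact iff \<gamma> is
  in the image of the transpose of \<open>B\<close>. The area form of the ideal is multiplied by
  \<open>trace B\<close> and is not exact because the ideal is abelian.\<close>

lemma H2_zero_sd3: "H2_zero (sd3 B) \<longleftrightarrow> det B \<noteq> 0 \<and> trace B \<noteq> 0"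
proof -
  have "H2_zero (sd3 B) \<longleftrightarrow> (\<forall>a b c. trace B * c = 0 \<longrightarrow>
      (\<exists>x y. a = B$1$1 * x + B$2$1 * y \<and> b = B$1$2 * x + B$2$2 * y) \<and> c = 0)"
    unfolding H2_zero_3[OF lie_algebra_sd3] diff2_def gen3_axis inner_3 exists_vector_3
    by (simp add: form2_3_def ee_def axis_def trace_def sum_2 algebra_simps) blast
  also have "\<dots> \<longleftrightarrow> (\<forall>a b. \<exists>x y. a = B$1$1 * x + B$2$1 * y \<and> b = B$1$2 * x + B$2$2 * y) \<and> trace B \<noteq> 0"
    by (metis mult_eq_0_iff mult_zero_left zero_neq_one)
  also have "\<dots> \<longleftrightarrow> det B \<noteq> 0 \<and> trace B \<noteq> 0"
    unfolding linear_system_2 det_2 by (simp add: mult.commute)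
  finally show ?thesis .
qed

lemma H3_zero_sd3: "H3_zero (sd3 B) \<longleftrightarrow> trace B \<noteq> 0"
proof -
  have "H3_zero (sd3 B) \<longleftrightarrow> (\<exists>c. trace B * c \<noteq> 0)"
    unfolding H3_zero_3[OF lie_algebra_sd3] diff2_def gen3_axis
    by (simp add: form2_3_def ee_def axis_def trace_def sum_2 algebra_simps)
  then show ?thesis by (metis mult_eq_0_iff zero_neq_one)
qed

lemma trivial_sd3: "trivial_2_3 (sd3 B) \<longleftrightarrow> det B \<noteq> 0 \<and> trace B \<noteq> 0"
  unfolding trivial_2_3_iff_euclidean H2_zero_sd3 H3_zero_sd3 by blast

text \<open>The action of \<open>A\<close> on 2-forms of \<open>\<real>\<^sup>3\<close>, with coordinates \<open>e\<^sub>1\<^sub>2, e\<^sub>1\<^sub>3, e\<^sub>2\<^sub>3\<close>.\<close>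

definition ext2 :: "real ^ 3 ^ 3 \<Rightarrow> real ^ 3 ^ 3" where
  "ext2 A = vector [vector [A$1$1 + A$2$2, A$3$2, - A$3$1],
     vector [A$2$3, A$1$1 + A$3$3, A$2$1], vector [- A$1$3, A$1$2, A$2$2 + A$3$3]]"

text \<open>Every 2-form on a three-dimensional space is the contraction of the volume form with a
  vector v, and the action of \<open>A\<close> on 2-forms becomes v \<mapsto> (tr A) v - A v. The
  eigenvalues are thus the pairwise sums of those of \<open>A\<close>.\<close>

lemma det_ext2: "det (ext2 A) = det (mat (trace A) - A)"
  by (simp add: det_3 ext2_def trace_def sum_3 mat_def algebra_simps)

lemma diff2_sd4:
  "diff2 (sd4 A) (form2_4 a b c d e f) (ev 1) (ev 2) (ev 3)
    = ext2 A$1$1 * d + ext2 A$1$2 * e + ext2 A$1$3 * f"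
  "diff2 (sd4 A) (form2_4 a b c d e f) (ev 1) (ev 2) (ev 4)
    = ext2 A$2$1 * d + ext2 A$2$2 * e + ext2 A$2$3 * f"
  "diff2 (sd4 A) (form2_4 a b c d e f) (ev 1) (ev 3) (ev 4)
    = ext2 A$3$1 * d + ext2 A$3$2 * e + ext2 A$3$3 * f"
  "diff2 (sd4 A) (form2_4 a b c d e f) (ev 2) (ev 3) (ev 4) = 0"
  unfolding diff2_def gen4_axis
  by (simp_all add: form2_4_def ee_def axis_def ext2_def algebra_simps)

text \<open>A 2-form splits into \<open>e1 \<and> \<gamma>\<close>, closed always and exact iff
  \<gamma> is in the image of the transpose of \<open>A\<close>, and a 2-form of the ideal, closed
  iff \<open>ext2 A\<close> kills it. The latter is exact only if zero, as the ideal is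
  abelian.\<close>

lemma H2_zero_sd4: "H2_zero (sd4 A) \<longleftrightarrow> det A \<noteq> 0 \<and> det (ext2 A) \<noteq> 0"
proof -
  have "H2_zero (sd4 A) \<longleftrightarrow>
    (\<forall>a b c. \<exists>x y z. a = transpose A$1$1 * x + transpose A$1$2 * y + transpose A$1$3 * z \<and>
       b = transpose A$2$1 * x + transpose A$2$2 * y + transpose A$2$3 * z \<and>
       c = transpose A$3$1 * x + transpose A$3$2 * y + transpose A$3$3 * z) \<and>
    (\<forall>d e f. ext2 A$1$1 * d + ext2 A$1$2 * e + ext2 A$1$3 * f = 0 \<and>
       ext2 A$2$1 * d + ext2 A$2$2 * e + ext2 A$2$3 * f = 0 \<and>
       ext2 A$3$1 * d + ext2 A$3$2 * e + ext2 A$3$3 * f = 0 \<longrightarrow> d = 0 \<and> e = 0 \<and> f = 0)"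
    (is "_ \<longleftrightarrow> (\<forall>a b c. ?P a b c) \<and> (\<forall>d e f. ?Q d e f \<longrightarrow> ?R d e f)")
  proof -
    have "H2_zero (sd4 A) \<longleftrightarrow> (\<forall>a b c d e f. ?Q d e f \<longrightarrow> ?P a b c \<and> ?R d e f)"
      unfolding H2_zero_4[OF lie_algebra_sd4] diff2_sd4 gen4_axis inner_4 exists_vector_4
      by (simp add: transpose_def algebra_simps) blast
    moreover have "?Q 0 0 0" by simp
    ultimately show ?thesis by blast
  qed
  also have "\<dots> \<longleftrightarrow> det A \<noteq> 0 \<and> det (ext2 A) \<noteq> 0"
    unfolding linear_system_3 by (simp add: det_transpose)
  finally show ?thesis .
qed

text \<open>One degree higher, \<open>e1 \<and> \<beta>\<close> is closed always and exact iff
  \<beta> is in the image of \<open>ext2 A\<close>; the volume form of the ideal is not exact, and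
  closed iff \<open>trace A = 0\<close>.\<close>

lemma H3_zero_sd4: "H3_zero (sd4 A) \<longleftrightarrow> trace A \<noteq> 0 \<and> det (ext2 A) \<noteq> 0"
proof -
  have d: "diff3 (sd4 A) (form3_4 p q r s) (ev 1) (ev 2) (ev 3) (ev 4) = trace A * s" for p q r s
    unfolding diff3_def gen4_axis
    by (simp add: form3_4_def ee3_def ee_def axis_def trace_def sum_3 algebra_simps)
  have "H3_zero (sd4 A) \<longleftrightarrow>
    (\<forall>p q r. \<exists>d e f. p = ext2 A$1$1 * d + ext2 A$1$2 * e + ext2 A$1$3 * f \<and>
       q = ext2 A$2$1 * d + ext2 A$2$2 * e + ext2 A$2$3 * f \<and>
       r = ext2 A$3$1 * d + ext2 A$3$2 * e + ext2 A$3$3 * f) \<and> (\<forall>s. trace A * s = 0 \<longrightarrow> s = 0)"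
    (is "_ \<longleftrightarrow> (\<forall>p q r. ?P p q r) \<and> _")
  proof -
    have "H3_zero (sd4 A) \<longleftrightarrow> (\<forall>p q r s. trace A * s = 0 \<longrightarrow> ?P p q r \<and> s = 0)"
      unfolding H3_zero_4[OF lie_algebra_sd4] diff2_sd4 d by (simp del: mult_eq_0_iff) blast
    then show ?thesis by (metis mult_zero_right)
  qed
  also have "\<dots> \<longleftrightarrow> trace A \<noteq> 0 \<and> det (ext2 A) \<noteq> 0"
    unfolding linear_system_3 by (metis mult_eq_0_iff zero_neq_one)
  finally show ?thesis .
qed

lemma trivial_sd4:
  "trivial_2_3 (sd4 A) \<longleftrightarrow> det A \<noteq> 0 \<and> trace A \<noteq> 0 \<and> det (mat (trace A) - A) \<noteq> 0"
  unfolding trivial_2_3_iff_euclidean H2_zero_sd4 H3_zero_sd4 det_ext2 by blast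

lemma hs4_axis:
  "hs4 B (ev 1) (ev 2) = vector [0, B$1$1, B$2$1, 0]"
  "hs4 B (ev 1) (ev 3) = vector [0, B$1$2, B$2$2, 0]"
  "hs4 B (ev 1) (ev 4) = vector [0, 0, 0, trace B]"
  "hs4 B (ev 2) (ev 3) = vector [0, 0, 0, 1]"
  "hs4 B (ev 2) (ev 4) = 0"
  "hs4 B (ev 3) (ev 4) = 0"
  unfolding hs4_def gen4_axis by (simp_all add: vec_eq_iff forall_4)

lemma diff2_hs4:
  "diff2 (hs4 B) (form2_4 a b c d e f) (ev 1) (ev 2) (ev 3) = trace B * d - c"
  "diff2 (hs4 B) (form2_4 a b c d e f) (ev 1) (ev 2) (ev 4) = (B$1$1 + trace B) * e + B$2$1 * f"
  "diff2 (hs4 B) (form2_4 a b c d e f) (ev 1) (ev 3) (ev 4) = B$1$2 * e + (B$2$2 + trace B) * f"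
  "diff2 (hs4 B) (form2_4 a b c d e f) (ev 2) (ev 3) (ev 4) = 0"
  unfolding diff2_def hs4_axis
  by (simp_all add: form2_4_def ee_def axis_def trace_def sum_2 algebra_simps)

text \<open>Closedness ties the coefficients of \<open>e1 \<and> e4\<close> and
  \<open>e2 \<and> e3\<close> by the factor \<open>trace B\<close>; this line is spanned by the
  differential of \<open>e4\<close> and contributes no cohomology. The coefficients of
  \<open>e12\<close>, \<open>e13\<close> give the condition on \<open>det B\<close>, those of
  \<open>e24\<close>, \<open>e34\<close> the other one.\<close>

lemma H2_zero_hs4: "H2_zero (hs4 B) \<longleftrightarrow> det B \<noteq> 0 \<and> det (mat (trace B) + B) \<noteq> 0"
proof -
  have "H2_zero (hs4 B) \<longleftrightarrow>
    (\<forall>a b. \<exists>x y. a = B$1$1 * x + B$2$1 * y \<and> b = B$1$2 * x + B$2$2 * y) \<and>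
    (\<forall>e f. (B$1$1 + trace B) * e + B$2$1 * f = 0 \<and> B$1$2 * e + (B$2$2 + trace B) * f = 0
       \<longrightarrow> e = 0 \<and> f = 0)"
    (is "_ \<longleftrightarrow> (\<forall>a b. ?P a b) \<and> (\<forall>e f. ?Q e f \<longrightarrow> ?R e f)")
  proof -
    have "H2_zero (hs4 B) \<longleftrightarrow> (\<forall>a b e f. ?Q e f \<longrightarrow> ?P a b \<and> ?R e f)"
      unfolding H2_zero_4[OF lie_algebra_hs4] diff2_hs4 hs4_axis inner_4 exists_vector_4
      by (simp add: mult.commute) blast
    moreover have "?Q 0 0" by simp
    ultimately show ?thesis by blast
  qed
  also have "\<dots> \<longleftrightarrow> det B \<noteq> 0 \<and> det (mat (trace B) + B) \<noteq> 0"
    unfolding linear_system_2 by (simp add: det_2 mat_def algebra_simps)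
  finally show ?thesis .
qed

text \<open>The form \<open>e123\<close> is always exact, being up to sign the differential of
  \<open>e14\<close>. The factor 2 is the trace of the derivation on the whole ideal:
  \<open>trace B\<close> on the plane plus \<open>trace B\<close> on the centre.\<close>

lemma H3_zero_hs4: "H3_zero (hs4 B) \<longleftrightarrow> trace B \<noteq> 0 \<and> det (mat (trace B) + B) \<noteq> 0"
proof -
  have d: "diff3 (hs4 B) (form3_4 p q r s) (ev 1) (ev 2) (ev 3) (ev 4) = 2 * trace B * s" for p q r s
    unfolding diff3_def hs4_axis
    by (simp add: form3_4_def ee3_def ee_def axis_def trace_def sum_2 algebra_simps)
  have "H3_zero (hs4 B) \<longleftrightarrow>
    (\<forall>q r. \<exists>e f. q = (B$1$1 + trace B) * e + B$2$1 * f \<and> r = B$1$2 * e + (B$2$2 + trace B) * f) \<and>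
    (\<forall>s. trace B * s = 0 \<longrightarrow> s = 0)"
    (is "_ \<longleftrightarrow> (\<forall>q r. ?P q r) \<and> _")
  proof -
    have "H3_zero (hs4 B) \<longleftrightarrow> (\<forall>p q r s. trace B * s = 0 \<longrightarrow> (\<exists>c d. p = trace B * d - c) \<and> ?P q r \<and> s = 0)"
      unfolding H3_zero_4[OF lie_algebra_hs4] diff2_hs4 d by simp blast
    moreover have "\<exists>c d. p = trace B * d - c" for p by (rule exI[of _ "- p"], rule exI[of _ 0]) simp
    ultimately show ?thesis by (metis mult_zero_right)
  qed
  also have "\<dots> \<longleftrightarrow> trace B \<noteq> 0 \<and> det (mat (trace B) + B) \<noteq> 0"
  proof -
    have "(B$1$1 + trace B) * (B$2$2 + trace B) - B$2$1 * B$1$2 = det (mat (trace B) + B)"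
      by (simp add: det_2 mat_def algebra_simps)
    moreover have "(\<forall>s. trace B * s = 0 \<longrightarrow> s = 0) \<longleftrightarrow> trace B \<noteq> 0"
      by (metis mult_eq_0_iff zero_neq_one)
    ultimately show ?thesis unfolding linear_system_2 by auto
  qed
  finally show ?thesis .
qed

lemma trivial_hs4:
  "trivial_2_3 (hs4 B) \<longleftrightarrow> det B \<noteq> 0 \<and> trace B \<noteq> 0 \<and> det (mat (trace B) + B) \<noteq> 0"
  unfolding trivial_2_3_iff_euclidean H2_zero_hs4 H3_zero_hs4 by blast

section \<open>Reduction to a semidirect product\<close>

text \<open>Since \<open>f\<close> kills the range of \<open>g\<close>, it attains all its values on
  the orthogonal complement of that range, whose dimension is the difference.\<close>

lemma dim_range_plus_injective_le:
  fixes f :: "'b::euclidean_space \<Rightarrow> 'c::euclidean_space" and g :: "'a::euclidean_space \<Rightarrow> 'b"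
  assumes "linear f" "linear g" "inj g" "\<And>x. f (g x) = 0"
  shows "dim (range f) + DIM('a) \<le> DIM('b)"
proof -
  let ?I = "range g" and ?K = "{y. \<forall>x\<in>range g. orthogonal x y}"
  have sI: "subspace ?I" by (rule linear_subspace_image[OF assms(2) subspace_UNIV])
  have dI: "dim ?I = DIM('a)"
    using dim_image_eq[OF assms(2), of UNIV] assms(3) by (simp add: inj_on_subset)
  have "dim {y \<in> UNIV. \<forall>x\<in>?I. orthogonal x y} + dim ?I = dim (UNIV :: 'b set)"
    by (rule dim_subspace_orthogonal_to_vectors) (simp_all add: sI)
  then have dK: "dim ?K + DIM('a) = DIM('b)" using dI by simp
  have "range f \<subseteq> f ` ?K"
  proof
    fix z assume "z \<in> range f"
    then obtain v where v: "z = f v" by blast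
    obtain y w where yw: "y \<in> span ?I" "\<And>u. u \<in> span ?I \<Longrightarrow> orthogonal w u" "v = y + w"
      using orthogonal_subspace_decomp_exists[of ?I v] by metis
    have "f y = 0" using yw(1) assms(4) by (auto simp: span_eq_iff[THEN iffD2, OF sI])
    then have "z = f w" using v yw(3) linear_add[OF assms(1)] by simp
    moreover have "orthogonal (g x) w" for x
      using yw(2)[of "g x"] span_base[of "g x" ?I] by (simp add: orthogonal_commute)
    then have "w \<in> ?K" by blast
    ultimately show "z \<in> f ` ?K" by blast
  qed
  then have "dim (range f) \<le> dim (f ` ?K)" by (rule dim_subset)
  also have "\<dots> \<le> dim ?K" by (rule dim_image_le[OF assms(1)])
  finally show ?thesis using dK by simp
qed

text \<open>This turns exactness into injectivity. If \<open>z\<close> were a nonzero kernel vector,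
  its orthogonal complement in \<open>Z\<close>, of smaller dimension, would still be mapped onto
  all of \<open>Z\<close>.\<close>

lemma inj_on_if_subspace_subset_image:
  fixes f :: "'a::euclidean_space \<Rightarrow> 'a"
  assumes "linear f" "subspace Z" "Z \<subseteq> f ` Z" "z \<in> Z" "f z = 0"
  shows "z = 0"
proof (rule ccontr)
  assume z: "z \<noteq> 0"
  let ?K = "{y \<in> Z. \<forall>x\<in>span {z}. orthogonal x y}"
  have sz: "span {z} \<subseteq> Z" using assms(2,4) by (simp add: span_minimal)
  have "dim ?K + dim (span {z}) = dim Z"
    by (rule dim_subspace_orthogonal_to_vectors[OF subspace_span assms(2) sz])
  moreover have "dim (span {z}) = 1" using z by (simp add: dim_singleton)
  moreover have "Z \<subseteq> f ` ?K"
  proof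
    fix x assume "x \<in> Z"
    then obtain y where y: "y \<in> Z" "x = f y" using assms(3) by blast
    obtain p q where pq: "p \<in> span {z}" "\<And>u. u \<in> span {z} \<Longrightarrow> orthogonal q u" "y = p + q"
      using orthogonal_subspace_decomp_exists[of "{z}" y] by metis
    obtain c where "p = c *\<^sub>R z" using pq(1) by (auto simp: span_singleton)
    then have "f p = 0" using assms(1,5) by (simp add: linear_cmul)
    then have "x = f q" using y(2) pq(3) linear_add[OF assms(1)] by simp
    moreover have "q = y - p" using pq(3) by simp
    then have "q \<in> Z" using subspace_diff[OF assms(2) y(1)] pq(1) sz by blast
    moreover have "\<forall>u\<in>span {z}. orthogonal u q" using pq(2) by (auto simp: orthogonal_commute)
    ultimately show "x \<in> f ` ?K" by blast
  qed
  then have "dim Z \<le> dim (f ` ?K)" by (rule dim_subset)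
  then have "dim Z \<le> dim ?K" using dim_image_le[OF assms(1), of ?K] by linarith
  ultimately show False by linarith
qed

text \<open>This is d d = 0 on 1-forms: the value is \<open>u\<close> paired with minus the Jacobi
  sum.\<close>

lemma diff2_inner_bracket:
  assumes "lie_algebra br" shows "diff2 br (\<lambda>x y. u \<bullet> br x y) x y z = 0"
proof -
  note s = lie_algebra_swap[OF assms]
  have "br (br x y) z - br (br x z) y + br (br y z) x
      = - (br x (br y z) + br y (br z x) + br z (br x y))"
    using s[of z "br x y"] s[of y "br x z"] s[of x "br y z"] s[of z x] s[of y "br z x"]
      s[of "br x y" z] s[of "br x z" y] s[of "br y z" x]  lie_algebraD(4)[OF assms, of y "-1" "br z x"]
    by simp
  also have "\<dots> = 0" using lie_algebraD(6)[OF assms] by simp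
  finally have "u \<bullet> (br (br x y) z - br (br x z) y + br (br y z) x) = 0" by simp
  then show ?thesis by (simp add: diff2_def inner_diff_right inner_add_right)
qed

text \<open>Otherwise the differential would embed the 1-forms in the 2-forms, a space of the same
  dimension 3, so all 2-forms would be closed and the volume form could not be exact.\<close>

lemma closed_form_exists_3:
  assumes "lie_algebra br" "H3_zero br"
  shows "\<exists>a :: real ^ 3. a \<noteq> 0 \<and> (\<forall>x y. a \<bullet> br x y = 0)"
proof (rule ccontr)
  assume no: "\<not> ?thesis"
  define g where "g = (\<lambda>u. vector [u \<bullet> br (ev 1) (ev 2), u \<bullet> br (ev 1) (ev 3), u \<bullet> br (ev 2) (ev 3)] :: real ^ 3)"
  define f where "f = (\<lambda>v :: real ^ 3. diff2 br (form2_3 (v$1) (v$2) (v$3)) (ev 1) (ev 2) (ev 3))"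
  have lg: "linear g" by (simp add: g_def linear_iff vec_eq_iff forall_3 inner_add_left)
  have lf: "linear f" by (simp add: f_def linear_iff diff2_def form2_3_def algebra_simps)
  have fg: "f (g u) = 0" for u
    using alt2_expand3[OF alt2_inner_bracket[OF assms(1)], of u] diff2_inner_bracket[OF assms(1), of u]
    by (simp add: f_def g_def)
  have "u = 0" if "g u = 0" for u
  proof -
    have "(\<lambda>x y. u \<bullet> br x y) = (\<lambda>x y. 0 \<bullet> br x y)"
      using that by (intro alt2_eq3 alt2_inner_bracket[OF assms(1)]) (simp_all add: g_def vec_eq_iff forall_3)
    then show ?thesis using no by (metis inner_zero_left)
  qed
  then have "inj g" using linear_injective_0[OF lg] by blast
  then have "dim (range f) = 0"
    using dim_range_plus_injective_le[OF lf lg _ fg] by simp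
  then have "f v = 0" for v by (auto simp: dim_eq_0)
  moreover obtain a b c where "f (vector [a, b, c]) \<noteq> 0"
    using assms(2) unfolding H3_zero_3[OF assms(1)] by (auto simp: f_def)
  ultimately show False by blast
qed

text \<open>By exactness in degree 3 the differential on 2-forms has rank at least 3, so its kernel has
  dimension at most 3 and cannot contain an injective image of the 4-dimensional dual.\<close>

lemma closed_form_exists_4:
  assumes "lie_algebra br" "H3_zero br"
  shows "\<exists>a :: real ^ 4. a \<noteq> 0 \<and> (\<forall>x y. a \<bullet> br x y = 0)"
proof (rule ccontr)
  assume no: "\<not> ?thesis"
  define g :: "real ^ 4 \<Rightarrow> (real ^ 3) \<times> (real ^ 3)" where
    "g = (\<lambda>u. (vector [u \<bullet> br (ev 1) (ev 2), u \<bullet> br (ev 1) (ev 3), u \<bullet> br (ev 1) (ev 4)],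
      vector [u \<bullet> br (ev 2) (ev 3), u \<bullet> br (ev 2) (ev 4), u \<bullet> br (ev 3) (ev 4)]))"
  define F where "F = (\<lambda>v :: (real ^ 3) \<times> (real ^ 3).
    form2_4 (fst v$1) (fst v$2) (fst v$3) (snd v$1) (snd v$2) (snd v$3))"
  define f :: "(real ^ 3) \<times> (real ^ 3) \<Rightarrow> real ^ 4" where
    "f = (\<lambda>v. vector [diff2 br (F v) (ev 1) (ev 2) (ev 3), diff2 br (F v) (ev 1) (ev 2) (ev 4),
      diff2 br (F v) (ev 1) (ev 3) (ev 4), diff2 br (F v) (ev 2) (ev 3) (ev 4)])"
  define h where "h = (\<lambda>p :: real ^ 4. diff3 br (form3_4 (p$1) (p$2) (p$3) (p$4)) (ev 1) (ev 2) (ev 3) (ev 4))"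
  have lg: "linear g" by (simp add: g_def linear_iff vec_eq_iff forall_3 inner_add_left)
  have lf: "linear f"
    by (simp add: f_def F_def linear_iff vec_eq_iff forall_4 diff2_def form2_4_def algebra_simps)
  have lh: "linear h" by (simp add: h_def linear_iff diff3_def form3_4_def algebra_simps)
  have fg: "f (g u) = 0" for u
    using alt2_expand4[OF alt2_inner_bracket[OF assms(1)], of u] diff2_inner_bracket[OF assms(1), of u]
    by (simp add: f_def F_def g_def vec_eq_iff forall_4)
  have "u = 0" if "g u = 0" for u
  proof -
    have "(\<lambda>x y. u \<bullet> br x y) = (\<lambda>x y. 0 \<bullet> br x y)"
      using that by (intro alt2_eq4 alt2_inner_bracket[OF assms(1)])
        (simp_all add: g_def vec_eq_iff forall_3 zero_prod_def)
    then show ?thesis using no by (metis inner_zero_left)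
  qed
  then have "inj g" using linear_injective_0[OF lg] by blast
  \<comment> \<open>The bound is 6 - 4, the number of coefficients of a 2-form minus that of a
    1-form.\<close>
  then have le: "dim (range f) \<le> 2"
    using dim_range_plus_injective_le[OF lf lg _ fg] by simp
  obtain n where n: "h = (\<lambda>p. n \<bullet> p)" using linear_inner_expand[OF lh] by blast
  have "{p. n \<bullet> p = 0} \<subseteq> range f"
  proof
    fix p assume "p \<in> {p. n \<bullet> p = 0}"
    then have "h p = 0" by (simp add: n)
    then obtain a b c d e k where
      "p$1 = diff2 br (form2_4 a b c d e k) (ev 1) (ev 2) (ev 3) \<and>
       p$2 = diff2 br (form2_4 a b c d e k) (ev 1) (ev 2) (ev 4) \<and>
       p$3 = diff2 br (form2_4 a b c d e k) (ev 1) (ev 3) (ev 4) \<and>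
       p$4 = diff2 br (form2_4 a b c d e k) (ev 2) (ev 3) (ev 4)"
      using assms(2) unfolding H3_zero_4[OF assms(1)] h_def by blast
    then have "p = f (vector [a, b, c], vector [d, e, k])"
      by (simp add: f_def F_def vec_eq_iff forall_4)
    then show "p \<in> range f" by blast
  qed
  then have "dim {p. n \<bullet> p = 0} \<le> 2" using le dim_subset le_trans by blast
  moreover have "dim {p. n \<bullet> p = 0} \<ge> 3"
    by (cases "n = 0") (simp_all add: dim_hyperplane)
  ultimately show False by simp
qed

text \<open>An orthogonal change of basis takes the closed form to a multiple of the
  \<open>i\<close>-th coordinate and respects the inner product, so pairing with \<open>a\<close>
  becomes reading off coordinate \<open>i\<close>.\<close>

lemma rotate_closed_form:
  fixes a :: "real ^ 'n" and br :: "real ^ 'n \<Rightarrow> _"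
  assumes "a \<noteq> 0" "\<forall>x y. a \<bullet> br x y = 0"
  shows "\<exists>br' :: real ^ 'n \<Rightarrow> _. lie_isomorphic br' br \<and> (\<forall>x y. br' x y $ i = 0)"
proof -
  have "norm a = norm (norm a *\<^sub>R ev i :: real ^ 'n)" by (simp add: norm_axis_1)
  then obtain f where f: "orthogonal_transformation f" "f (norm a *\<^sub>R ev i) = a"
    using orthogonal_transformation_exists by metis
  have lin: "linear f" and bij: "bij f"
    using f(1) by (auto simp: orthogonal_transformation_linear orthogonal_transformation_bij)
  let ?br = "\<lambda>x y. inv f (br (f x) (f y))"
  have "?br x y $ i = 0" for x y
  proof -
    have "(norm a *\<^sub>R ev i) \<bullet> ?br x y = f (norm a *\<^sub>R ev i) \<bullet> f (?br x y)"
      using f(1) by (simp add: orthogonal_transformation_def)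
    also have "\<dots> = 0" using f(2) assms(2) bij by (simp add: bij_is_surj surj_f_inv_f)
    finally show ?thesis using assms(1) by (simp add: inner_axis')
  qed
  then show ?thesis using lie_isomorphic_pullback[OF lin bij, of br] by blast
qed

section \<open>Structure of the ideal where the closed form vanishes\<close>

lemma alt2_bracket_nth: "lie_algebra br \<Longrightarrow> alt2 (\<lambda>x y. br x y $ i)"
  by (simp add: alt2_def linear_iff lie_algebraD)

lemma gen3_exists:
  assumes "lie_algebra br" "\<forall>x y. br x y $ 1 = 0"
  shows "\<exists>B m. br = gen3 B m"
proof -
  define B :: "real ^ 2 ^ 2" where
    "B = vector [vector [br (ev 1) (ev 2) $ 2, br (ev 1) (ev 3) $ 2],
      vector [br (ev 1) (ev 2) $ 3, br (ev 1) (ev 3) $ 3]]"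
  define m :: "real ^ 2" where "m = vector [br (ev 2) (ev 3) $ 2, br (ev 2) (ev 3) $ 3]"
  have alt: "alt2 (\<lambda>x y. gen3 B m x y $ i)" for i
    using bilinear_alternating_gen3 by (auto simp: alt2_def bilinear_def linear_iff)
  have "\<forall>i. (\<lambda>x y. br x y $ i) = (\<lambda>x y. gen3 B m x y $ i)"
    unfolding forall_3
    by (intro conjI alt2_eq3 alt2_bracket_nth assms(1) alt) (simp_all add: gen3_axis assms(2) B_def m_def)
  then have "br = gen3 B m" by (simp add: fun_eq_iff vec_eq_iff)
  then show ?thesis by blast
qed

lemma gen4_exists:
  assumes "lie_algebra br" "\<forall>x y. br x y $ 1 = 0"
  shows "\<exists>A M. br = gen4 A M"
proof -
  define A :: "real ^ 3 ^ 3" where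
    "A = vector [vector [br (ev 1) (ev 2) $ 2, br (ev 1) (ev 3) $ 2, br (ev 1) (ev 4) $ 2],
      vector [br (ev 1) (ev 2) $ 3, br (ev 1) (ev 3) $ 3, br (ev 1) (ev 4) $ 3],
      vector [br (ev 1) (ev 2) $ 4, br (ev 1) (ev 3) $ 4, br (ev 1) (ev 4) $ 4]]"
  define M :: "real ^ 3 ^ 3" where
    "M = vector [vector [br (ev 3) (ev 4) $ 2, - (br (ev 2) (ev 4) $ 2), br (ev 2) (ev 3) $ 2],
      vector [br (ev 3) (ev 4) $ 3, - (br (ev 2) (ev 4) $ 3), br (ev 2) (ev 3) $ 3],
      vector [br (ev 3) (ev 4) $ 4, - (br (ev 2) (ev 4) $ 4), br (ev 2) (ev 3) $ 4]]"
  have alt: "alt2 (\<lambda>x y. gen4 A M x y $ i)" for i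
    using bilinear_alternating_gen4 by (auto simp: alt2_def bilinear_def linear_iff)
  have "\<forall>i. (\<lambda>x y. br x y $ i) = (\<lambda>x y. gen4 A M x y $ i)"
    unfolding forall_4
    by (intro conjI alt2_eq4 alt2_bracket_nth assms(1) alt) (simp_all add: gen4_axis assms(2) A_def M_def)
  then have "br = gen4 A M" by (simp add: fun_eq_iff vec_eq_iff)
  then show ?thesis by blast
qed

text \<open>\<open>m\<close> is the bracket of \<open>e2\<close> and \<open>e3\<close>, so
  \<open>(m2, - m1)\<close> is the trace form of the ideal. In dimension two, unimodular already
  means abelian.\<close>

lemma gen3_reduction:
  assumes lie: "lie_algebra (gen3 B m)" and H2: "H2_zero (gen3 B m)"
  shows "m = 0"
proof -
  \<comment> \<open>In this form the Jacobi identity says that \<open>B\<close> multiplies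
    \<open>m\<close> by its trace.\<close>
  have jac: "B$1$2 * m$2 = B$2$2 * m$1" "B$2$1 * m$1 = B$1$1 * m$2"
    using lie_algebraD(6)[OF lie, of "ev 1" "ev 2" "ev 3"] lie_algebra_swap[OF lie, of "ev 3" "ev 1"]
    unfolding gen3_axis
    by (simp_all add: gen3_def vec_eq_iff forall_3 ee_def axis_def algebra_simps)
  have sol: "\<exists>x y. x * m$1 + y * m$2 = 0 \<and> p = x * B$1$1 + y * B$2$1 \<and> q = x * B$1$2 + y * B$2$2"
    if "p * m$1 + q * m$2 = 0" for p q
  proof -
    \<comment> \<open>The 2-form is \<open>e1 \<and> \<gamma>\<close> with \<gamma> =
      \<open>(p, q)\<close> vanishing on \<open>m\<close>; its primitive restricts to a preimage of
      \<gamma> that vanishes on \<open>m\<close> as well.\<close>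
    have "diff2 (gen3 B m) (form2_3 p q 0) (ev 1) (ev 2) (ev 3) = 0"
      using that unfolding diff2_def gen3_axis by (simp add: form2_3_def ee_def axis_def algebra_simps)
    then obtain u where "p = u \<bullet> gen3 B m (ev 1) (ev 2)" "q = u \<bullet> gen3 B m (ev 1) (ev 3)"
      "0 = u \<bullet> gen3 B m (ev 2) (ev 3)"
      using H2 unfolding H2_zero_3[OF lie] by blast
    then show ?thesis unfolding gen3_axis inner_3 by (intro exI[of _ "u$2"] exI[of _ "u$3"]) simp
  qed
  define Z where "Z = {v :: real ^ 2. v \<bullet> m = 0}"
  have "vector [m$2, - m$1] = (0 :: real ^ 2)"
  proof (rule inj_on_if_subspace_subset_image[of "\<lambda>v. v v* B" Z])
    show "linear (\<lambda>v. v v* B)" by (simp add: linear_iff vector_matrix_mult_def vec_eq_iff sum_2 algebra_simps)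
    show "subspace Z" by (simp add: Z_def subspace_hyperplane2)
    show "Z \<subseteq> (\<lambda>v. v v* B) ` Z"
    proof
      fix v assume "v \<in> Z"
      then have "v$1 * m$1 + v$2 * m$2 = 0" by (simp add: Z_def inner_vec_def sum_2)
      then obtain x y where "x * m$1 + y * m$2 = 0" "v$1 = x * B$1$1 + y * B$2$1" "v$2 = x * B$1$2 + y * B$2$2"
        using sol by blast
      then show "v \<in> (\<lambda>v. v v* B) ` Z"
        by (intro image_eqI[of _ _ "vector [x, y]"])
          (simp_all add: Z_def inner_vec_def sum_2 vector_matrix_mult_def vec_eq_iff forall_2 mult.commute)
    qed
    show "vector [m$2, - m$1] \<in> Z" by (simp add: Z_def inner_vec_def sum_2)
    show "vector [m$2, - m$1] v* B = 0"
      using jac by (simp add: vector_matrix_mult_def vec_eq_iff forall_2 sum_2 mult.commute)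
  qed
  then show ?thesis by (simp add: vec_eq_iff forall_2)
qed

lemma reduction_3:
  fixes br :: "real ^ 3 \<Rightarrow> _"
  assumes "lie_algebra br" "H2_zero br" "H3_zero br"
  shows "\<exists>B. lie_isomorphic br (sd3 B)"
proof -
  obtain br' :: "real ^ 3 \<Rightarrow> _" where iso: "lie_isomorphic br' br" and 0: "\<forall>x y. br' x y $ 1 = 0"
    using closed_form_exists_3[OF assms(1,3)] rotate_closed_form[where br = br and i = 1] by metis
  note iso' = lie_isomorphic_sym[OF iso]
  have lie: "lie_algebra br'" by (rule lie_isomorphic_lie_algebra[OF iso assms(1)])
  obtain B m where br': "br' = gen3 B m" using gen3_exists[OF lie 0] by blast
  have "m = 0" using gen3_reduction lie H2_zero_iso[OF iso' assms(2)] unfolding br' by blast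
  then show ?thesis using iso' br' by blast
qed

text \<open>The equations are the entries of A S + S A^T = t S, and \<open>inj\<close> applies to
  the vectors v with S v = 0 and A^T v = 0. Only one diagonal cofactor and the determinant are
  treated; permuting the indices yields the other diagonal cofactors.\<close>

lemma symmetric_minor_zero:
  fixes a11 a12 a13 a21 a22 a23 a31 a32 a33 s11 s12 s13 s22 s23 s33 t :: real
  defines "t \<equiv> a11 + a22 + a33"
  assumes t: "t \<noteq> 0"
    and E11: "2 * (a11 * s11 + a12 * s12 + a13 * s13) = t * s11"
    and E12: "a11 * s12 + a12 * s22 + a13 * s23 + a21 * s11 + a22 * s12 + a23 * s13 = t * s12"
    and E13: "a11 * s13 + a12 * s23 + a13 * s33 + a31 * s11 + a32 * s12 + a33 * s13 = t * s13"
    and E22: "2 * (a21 * s12 + a22 * s22 + a23 * s23) = t * s22"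
    and E23: "a21 * s13 + a22 * s23 + a23 * s33 + a31 * s12 + a32 * s22 + a33 * s23 = t * s23"
    and E33: "2 * (a31 * s13 + a32 * s23 + a33 * s33) = t * s33"
    and inj: "\<And>x y z. s11 * x + s12 * y + s13 * z = 0 \<Longrightarrow> s12 * x + s22 * y + s23 * z = 0 \<Longrightarrow>
      s13 * x + s23 * y + s33 * z = 0 \<Longrightarrow> a11 * x + a21 * y + a31 * z = 0 \<Longrightarrow>
      a12 * x + a22 * y + a32 * z = 0 \<Longrightarrow> a13 * x + a23 * y + a33 * z = 0 \<Longrightarrow> x = 0"
  shows "s22 * s33 = s23 * s23"
    and "s11 * (s22 * s33 - s23 * s23) + s12 * (s13 * s23 - s12 * s33) + s13 * (s12 * s23 - s13 * s22) = 0"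
proof -
  define c11 c12 c13 c22 c23 c33 where c: "c11 = s22 * s33 - s23 * s23" "c12 = s13 * s23 - s12 * s33"
    "c13 = s12 * s23 - s13 * s22" "c22 = s11 * s33 - s13 * s13" "c23 = s12 * s13 - s11 * s23"
    "c33 = s11 * s22 - s12 * s12"
  define D where "D = s11 * c11 + s12 * c12 + s13 * c13"
  \<comment> \<open>The trace of the cofactor matrix times A S + S A^T - t S: the first two terms
    give 2 t D, the last one 3 t D.\<close>
  have "- t * D = c11 * (2 * (a11 * s11 + a12 * s12 + a13 * s13) - t * s11)
    + 2 * c12 * (a11 * s12 + a12 * s22 + a13 * s23 + a21 * s11 + a22 * s12 + a23 * s13 - t * s12)
    + 2 * c13 * (a11 * s13 + a12 * s23 + a13 * s33 + a31 * s11 + a32 * s12 + a33 * s13 - t * s13)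
    + c22 * (2 * (a21 * s12 + a22 * s22 + a23 * s23) - t * s22)
    + 2 * c23 * (a21 * s13 + a22 * s23 + a23 * s33 + a31 * s12 + a32 * s22 + a33 * s23 - t * s23)
    + c33 * (2 * (a31 * s13 + a32 * s23 + a33 * s33) - t * s33)"
    unfolding D_def c t_def by algebra
  also have "\<dots> = 0" unfolding E11 E12 E13 E22 E23 E33 by simp
  finally have D: "D = 0" using t by simp
  have d: "s11 * c11 + s12 * c12 + s13 * c13 = 0" "s12 * c11 + s22 * c12 + s23 * c13 = 0"
    "s13 * c11 + s23 * c12 + s33 * c13 = 0"
    using D unfolding D_def c by algebra+
  \<comment> \<open>The minors of size two of the cofactor matrix are \<open>D\<close> times entries
    of S, so \<open>D = 0\<close> makes it of rank at most one.\<close>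
  have cc: "c11 * c22 = c12 * c12" "c11 * c23 = c12 * c13" "c11 * c33 = c13 * c13"
    using D unfolding D_def c by algebra+
  text \<open>The cofactor matrix \<open>C\<close> satisfies \<open>A\<^sup>T C + C A = 0\<close>.\<close>
  have "2 * (a11 * c11 + a21 * c12 + a31 * c13) =
     - ((2 * (a21 * s12 + a22 * s22 + a23 * s23) - t * s22) * s33
       + s22 * (2 * (a31 * s13 + a32 * s23 + a33 * s33) - t * s33)
       - 2 * s23 * (a21 * s13 + a22 * s23 + a23 * s33 + a31 * s12 + a32 * s22 + a33 * s23 - t * s23))"
    unfolding c t_def by algebra
  also have "\<dots> = 0" unfolding E22 E23 E33 by simp
  finally have u1: "a11 * c11 + a21 * c12 + a31 * c13 = 0" by simp
  have "a11 * c12 + a21 * c22 + a31 * c23 + c11 * a12 + c12 * a22 + c13 * a32 =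
     - ((a11 * s13 + a12 * s23 + a13 * s33 + a31 * s11 + a32 * s12 + a33 * s13 - t * s13) * s23
       + s13 * (a21 * s13 + a22 * s23 + a23 * s33 + a31 * s12 + a32 * s22 + a33 * s23 - t * s23)
       - (a11 * s12 + a12 * s22 + a13 * s23 + a21 * s11 + a22 * s12 + a23 * s13 - t * s12) * s33
       - s12 * (2 * (a31 * s13 + a32 * s23 + a33 * s33) - t * s33))"
    unfolding c t_def by algebra
  also have "\<dots> = 0" unfolding E12 E13 E23 E33 by simp
  finally have u2: "a11 * c12 + a21 * c22 + a31 * c23 + c11 * a12 + c12 * a22 + c13 * a32 = 0" .
  have "a11 * c13 + a21 * c23 + a31 * c33 + c11 * a13 + c12 * a23 + c13 * a33 =
     - ((a11 * s12 + a12 * s22 + a13 * s23 + a21 * s11 + a22 * s12 + a23 * s13 - t * s12) * s23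
       + s12 * (a21 * s13 + a22 * s23 + a23 * s33 + a31 * s12 + a32 * s22 + a33 * s23 - t * s23)
       - (a11 * s13 + a12 * s23 + a13 * s33 + a31 * s11 + a32 * s12 + a33 * s13 - t * s13) * s22
       - s13 * (2 * (a21 * s12 + a22 * s22 + a23 * s23) - t * s22))"
    unfolding c t_def by algebra
  also have "\<dots> = 0" unfolding E12 E13 E23 E22 by simp
  finally have u3: "a11 * c13 + a21 * c23 + a31 * c33 + c11 * a13 + c12 * a23 + c13 * a33 = 0" .
  \<comment> \<open>After multiplication by \<open>c11\<close> the rank one relations turn the other
    rows of C into multiples of the first, and \<open>u1\<close> removes half of the terms. If
    \<open>c11 \<noteq> 0\<close>, the first row of C is thus a vector to which \<open>inj\<close>
    applies.\<close>
  have "c11 * (a12 * c11 + a22 * c12 + a32 * c13) = 0"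
    using u1 u2 cc by algebra
  moreover have "c11 * (a13 * c11 + a23 * c12 + a33 * c13) = 0"
    using u1 u3 cc by algebra
  ultimately have "c11 = 0" using inj[OF d u1] by auto
  then show "s22 * s33 = s23 * s23" unfolding c by simp
  show "s11 * (s22 * s33 - s23 * s23) + s12 * (s13 * s23 - s12 * s33) + s13 * (s12 * s23 - s13 * s22) = 0"
    using D unfolding D_def c .
qed

text \<open>Triples containing \<open>e1\<close> say that \<open>A\<close> is a derivation of the
  ideal, that is A M + M A^T = tr A . M. The remaining triple is the Jacobi identity of the ideal,
  where the vector multiplied by \<open>M\<close> is minus its trace form.\<close>

lemma gen4_jacobi:
  assumes lie: "lie_algebra (gen4 A M)"
  shows "A$i$1 * M$1$j + A$i$2 * M$2$j + A$i$3 * M$3$j + (M$i$1 * A$j$1 + M$i$2 * A$j$2 + M$i$3 * A$j$3)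
      = (A$1$1 + A$2$2 + A$3$3) * M$i$j"
    and "M *v vector [M$3$2 - M$2$3, M$1$3 - M$3$1, M$2$1 - M$1$2] = 0"
proof -
  note sw = lie_algebra_swap[OF lie, of "ev 3" "ev 1"] lie_algebra_swap[OF lie, of "ev 4" "ev 1"]
    lie_algebra_swap[OF lie, of "ev 4" "ev 2"]
  have "A$i$1 * M$1$3 + A$i$2 * M$2$3 + A$i$3 * M$3$3 + (M$i$1 * A$3$1 + M$i$2 * A$3$2 + M$i$3 * A$3$3)
      = (A$1$1 + A$2$2 + A$3$3) * M$i$3"
    using lie_algebraD(6)[OF lie, of "ev 1" "ev 2" "ev 3"] forall_3[of "\<lambda>j. i \<noteq> j"]
    unfolding gen4_axis sw
    by (auto simp add: gen4_def vec_eq_iff forall_4 ee_def axis_def algebra_simps)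
  moreover have "A$i$1 * M$1$2 + A$i$2 * M$2$2 + A$i$3 * M$3$2 + (M$i$1 * A$2$1 + M$i$2 * A$2$2 + M$i$3 * A$2$3)
      = (A$1$1 + A$2$2 + A$3$3) * M$i$2"
    using lie_algebraD(6)[OF lie, of "ev 1" "ev 2" "ev 4"] forall_3[of "\<lambda>j. i \<noteq> j"]
    unfolding gen4_axis sw
    by (auto simp add: gen4_def vec_eq_iff forall_4 ee_def axis_def algebra_simps)
  moreover have "A$i$1 * M$1$1 + A$i$2 * M$2$1 + A$i$3 * M$3$1 + (M$i$1 * A$1$1 + M$i$2 * A$1$2 + M$i$3 * A$1$3)
      = (A$1$1 + A$2$2 + A$3$3) * M$i$1"
    using lie_algebraD(6)[OF lie, of "ev 1" "ev 3" "ev 4"] forall_3[of "\<lambda>j. i \<noteq> j"]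
    unfolding gen4_axis sw
    by (auto simp add: gen4_def vec_eq_iff forall_4 ee_def axis_def algebra_simps)
  ultimately show "A$i$1 * M$1$j + A$i$2 * M$2$j + A$i$3 * M$3$j + (M$i$1 * A$j$1 + M$i$2 * A$j$2 + M$i$3 * A$j$3)
      = (A$1$1 + A$2$2 + A$3$3) * M$i$j"
    using exhaust_3[of j] by auto
  show "M *v vector [M$3$2 - M$2$3, M$1$3 - M$3$1, M$2$1 - M$1$2] = 0"
    using lie_algebraD(6)[OF lie, of "ev 2" "ev 3" "ev 4"]
    unfolding gen4_axis sw matrix_vector_3
    by (auto simp add: gen4_def vec_eq_iff forall_4 forall_3 ee_def axis_def algebra_simps)
qed

text \<open>The \<open>v\<close> with \<open>v v* M = 0\<close> are the closed 1-forms of the ideal.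
  For such a \<open>w\<close>, a primitive of \<open>e1 \<and> w\<close> restricts to a closed
  1-form that \<open>A\<close> maps to \<open>w\<close>; finite dimension turns this surjectivity
  into injectivity.\<close>

lemma gen4_kernel_trivial:
  assumes lie: "lie_algebra (gen4 A M)" and H2: "H2_zero (gen4 A M)"
    and v: "v v* M = 0" "v v* A = 0"
  shows "v = 0"
proof (rule inj_on_if_subspace_subset_image[of "\<lambda>v. v v* A" "{v. v v* M = 0}"])
  have lin: "linear (\<lambda>v. v v* N)" for N :: "real ^ 3 ^ 3"
    by (simp add: linear_iff vector_matrix_mult_def vec_eq_iff sum_3 algebra_simps)
  show "linear (\<lambda>v. v v* A)" by (rule lin)
  show "subspace {v. v v* M = 0}" by (rule linear_subspace_kernel[OF lin])
  show "{v. v v* M = 0} \<subseteq> (\<lambda>v. v v* A) ` {v. v v* M = 0}"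
  proof
    fix w assume "w \<in> {v. v v* M = 0}"
    then have w: "w$1 * M$1$j + w$2 * M$2$j + w$3 * M$3$j = 0" for j
      by (simp add: vector_matrix_mult_def vec_eq_iff sum_3 mult.commute)
    let ?f = "form2_4 (w$1) (w$2) (w$3) 0 0 0"
    have "diff2 (gen4 A M) ?f (ev 1) (ev 2) (ev 3) = 0" "diff2 (gen4 A M) ?f (ev 1) (ev 2) (ev 4) = 0"
      "diff2 (gen4 A M) ?f (ev 1) (ev 3) (ev 4) = 0" "diff2 (gen4 A M) ?f (ev 2) (ev 3) (ev 4) = 0"
      using w[of 1] w[of 2] w[of 3] unfolding diff2_def gen4_axis
      by (simp_all add: form2_4_def ee_def axis_def algebra_simps)
    then obtain u where u: "w$1 = u \<bullet> gen4 A M (ev 1) (ev 2)" "w$2 = u \<bullet> gen4 A M (ev 1) (ev 3)"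
      "w$3 = u \<bullet> gen4 A M (ev 1) (ev 4)" "0 = u \<bullet> gen4 A M (ev 2) (ev 3)"
      "0 = u \<bullet> gen4 A M (ev 2) (ev 4)" "0 = u \<bullet> gen4 A M (ev 3) (ev 4)"
      using H2 unfolding H2_zero_4[OF lie] by blast
    show "w \<in> (\<lambda>v. v v* A) ` {v. v v* M = 0}"
      using u unfolding gen4_axis inner_4
      by (intro image_eqI[of _ _ "vector [u$2, u$3, u$4]"])
        (simp_all add: vector_matrix_mult_def vec_eq_iff forall_3 sum_3 mult.commute)
  qed
qed (use v in auto)

text \<open>The antisymmetric part of \<open>M\<close> is a cross product with a multiple of
  \<open>?v\<close>. It annihilates \<open>?v\<close>, so M^T \<open>?v\<close> = M
  \<open>?v\<close> = 0, and the antisymmetric part of the derivation identity reduces to A^T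
  \<open>?v\<close> = 0.\<close>

lemma gen4_symmetric:
  assumes lie: "lie_algebra (gen4 A M)" and H2: "H2_zero (gen4 A M)"
  shows "transpose M = M"
proof -
  let ?v = "vector [M$3$2 - M$2$3, M$1$3 - M$3$1, M$2$1 - M$1$2] :: real ^ 3"
  note E = gen4_jacobi(1)[OF lie]
  have vA: "?v v* A = 0"
    using E[of 1 2] E[of 2 1] E[of 1 3] E[of 3 1] E[of 2 3] E[of 3 2]
    by (simp add: vector_matrix_mult_def vec_eq_iff forall_3 sum_3 algebra_simps)
  have vM: "?v v* M = 0"
    using gen4_jacobi(2)[OF lie] unfolding matrix_vector_3
    by (simp add: vector_matrix_mult_def vec_eq_iff forall_3 sum_3 algebra_simps)
  have "?v = 0" by (rule gen4_kernel_trivial[OF lie H2 vM vA])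
  then show ?thesis by (simp add: vec_eq_iff forall_3 transpose_def)
qed

lemma gen4_trace_nonzero:
  assumes lie: "lie_algebra (gen4 A M)" and H3: "H3_zero (gen4 A M)" and sym: "transpose M = M"
  shows "trace A \<noteq> 0"
proof
  assume tr: "trace A = 0"
  have s: "M$2$1 = M$1$2" "M$3$1 = M$1$3" "M$3$2 = M$2$3"
    using sym by (simp_all add: vec_eq_iff transpose_def)
  have "diff3 (gen4 A M) (form3_4 0 0 0 1) (ev 1) (ev 2) (ev 3) (ev 4) = 0"
    using tr unfolding diff3_def gen4_axis
    by (simp add: form3_4_def ee3_def ee_def axis_def trace_def sum_3)
  then obtain a b c d e f where "1 = diff2 (gen4 A M) (form2_4 a b c d e f) (ev 2) (ev 3) (ev 4)"
    using H3 unfolding H3_zero_4[OF lie] by blast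
  \<comment> \<open>The \<open>e234\<close> component of the differential of a 2-form is a
    combination of the differences of opposite entries of \<open>M\<close>.\<close>
  then show False
    unfolding diff2_def gen4_axis by (simp add: form2_4_def ee_def axis_def s)
qed

text \<open>The hypotheses do not depend on the order of the indices, so the computation for one
  diagonal cofactor serves for each of them.\<close>

lemma gen4_minors:
  assumes lie: "lie_algebra (gen4 A M)" and H2: "H2_zero (gen4 A M)" and H3: "H3_zero (gen4 A M)"
    and ijk: "i \<noteq> j" "i \<noteq> k" "j \<noteq> k"
  shows "M$j$j * M$k$k = M$j$k * M$j$k"
    and "M$i$i * (M$j$j * M$k$k - M$j$k * M$j$k) + M$i$j * (M$i$k * M$j$k - M$i$j * M$k$k)
      + M$i$k * (M$i$j * M$j$k - M$i$k * M$j$j) = 0" (is "?D = 0")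
proof -
  have sym: "transpose M = M" by (rule gen4_symmetric[OF lie H2])
  then have s: "M$p$q = M$q$p" for p q
    unfolding vec_eq_iff transpose_def by simp
  have U: "UNIV = {i, j, k}"
    using ijk by (intro card_subset_eq[symmetric]) simp_all
  have sum: "sum f UNIV = f i + f j + f k" for f :: "3 \<Rightarrow> real"
    unfolding U using ijk by (simp add: add.assoc)
  have t: "A$i$i + A$j$j + A$k$k \<noteq> 0"
    using gen4_trace_nonzero[OF lie H3 sym] by (simp add: trace_def sum)
  have E: "A$p$i * M$i$q + A$p$j * M$j$q + A$p$k * M$k$q + (M$p$i * A$q$i + M$p$j * A$q$j + M$p$k * A$q$k)
      = (A$i$i + A$j$j + A$k$k) * M$p$q" for p q
    using gen4_jacobi(1)[OF lie, of p q]
    by (simp only: sum[unfolded sum_3, of "\<lambda>r. A$p$r * M$r$q"]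
        sum[unfolded sum_3, of "\<lambda>r. M$p$r * A$q$r"] sum[unfolded sum_3, of "\<lambda>r. A$r$r"])
  have inj: "x = 0"
    if "M$i$i * x + M$i$j * y + M$i$k * z = 0" "M$i$j * x + M$j$j * y + M$j$k * z = 0"
      "M$i$k * x + M$j$k * y + M$k$k * z = 0" "A$i$i * x + A$j$i * y + A$k$i * z = 0"
      "A$i$j * x + A$j$j * y + A$k$j * z = 0" "A$i$k * x + A$j$k * y + A$k$k * z = 0" for x y z
  proof -
    define v :: "real ^ 3" where "v = (\<chi> p. if p = i then x else if p = j then y else z)"
    have v: "v$i = x" "v$j = y" "v$k = z" using ijk by (auto simp: v_def)
    have "\<forall>p\<in>UNIV. (v v* M)$p = 0" "\<forall>p\<in>UNIV. (v v* A)$p = 0"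
      unfolding U using that s[of j i] s[of k i] s[of k j]
      by (simp_all add: vector_matrix_mult_def sum v mult.commute)
    then have "v v* M = 0" "v v* A = 0" by (simp_all add: vec_eq_iff)
    then have "v = 0" by (rule gen4_kernel_trivial[OF lie H2])
    then show ?thesis using v by simp
  qed
  note s' = s[of j i] s[of k i] s[of k j]
  have F: "2 * (A$i$i * M$i$i + A$i$j * M$i$j + A$i$k * M$i$k) = (A$i$i + A$j$j + A$k$k) * M$i$i"
    "A$i$i * M$i$j + A$i$j * M$j$j + A$i$k * M$j$k + A$j$i * M$i$i + A$j$j * M$i$j + A$j$k * M$i$k
      = (A$i$i + A$j$j + A$k$k) * M$i$j"
    "A$i$i * M$i$k + A$i$j * M$j$k + A$i$k * M$k$k + A$k$i * M$i$i + A$k$j * M$i$j + A$k$k * M$i$k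
      = (A$i$i + A$j$j + A$k$k) * M$i$k"
    "2 * (A$j$i * M$i$j + A$j$j * M$j$j + A$j$k * M$j$k) = (A$i$i + A$j$j + A$k$k) * M$j$j"
    "A$j$i * M$i$k + A$j$j * M$j$k + A$j$k * M$k$k + A$k$i * M$i$j + A$k$j * M$j$j + A$k$k * M$j$k
      = (A$i$i + A$j$j + A$k$k) * M$j$k"
    "2 * (A$k$i * M$i$k + A$k$j * M$j$k + A$k$k * M$k$k) = (A$i$i + A$j$j + A$k$k) * M$k$k"
    using E[of i i] E[of i j] E[of i k] E[of j j] E[of j k] E[of k k] unfolding s' by (simp_all add: algebra_simps)
  show "M$j$j * M$k$k = M$j$k * M$j$k" by (rule symmetric_minor_zero(1)[OF t F]) (rule inj)
  show "?D = 0" by (rule symmetric_minor_zero(2)[OF t F]) (rule inj)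
qed

text \<open>The square of an off-diagonal cofactor is a product of two diagonal cofactors minus a
  multiple of the determinant, and all of these vanish.\<close>

lemma gen4_minors':
  assumes lie: "lie_algebra (gen4 A M)" and H2: "H2_zero (gen4 A M)" and H3: "H3_zero (gen4 A M)"
    and ijk: "i \<noteq> j" "i \<noteq> k" "j \<noteq> k"
  shows "M$i$i * M$j$k = M$i$j * M$i$k"
proof -
  note m = gen4_minors[OF lie H2 H3]
  have "(M$i$i * M$j$k - M$i$j * M$i$k) ^ 2 = 0"
    using m(1)[OF ijk(1,2,3)] m(1)[OF ijk(1)[symmetric] ijk(3,2)]
      m(1)[OF ijk(2)[symmetric] ijk(3)[symmetric] ijk(1)] m(2)[OF ijk] by algebra
  then show ?thesis by simp
qed

section \<open>Isomorphisms given on basis vectors, and the Heisenberg case\<close>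

lemma lie_isomorphic_basis_4:
  fixes b1 b2 :: "real ^ 4 \<Rightarrow> real ^ 4 \<Rightarrow> real ^ 4"
  assumes "lie_algebra b1" "lie_algebra b2" "linear f" "inj f"
    and "f (b1 (ev 1) (ev 2)) = b2 (f (ev 1)) (f (ev 2))" "f (b1 (ev 1) (ev 3)) = b2 (f (ev 1)) (f (ev 3))"
    "f (b1 (ev 1) (ev 4)) = b2 (f (ev 1)) (f (ev 4))" "f (b1 (ev 2) (ev 3)) = b2 (f (ev 2)) (f (ev 3))"
    "f (b1 (ev 2) (ev 4)) = b2 (f (ev 2)) (f (ev 4))" "f (b1 (ev 3) (ev 4)) = b2 (f (ev 3)) (f (ev 4))"
  shows "lie_isomorphic b1 b2"
proof -
  have "bij f" using assms(3,4) linear_injective_imp_surjective by (auto simp: bij_def)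
  have "(\<lambda>x y. f (b1 x y) $ i) = (\<lambda>x y. b2 (f x) (f y) $ i)" for i
  proof (rule alt2_eq4)
    show "alt2 (\<lambda>x y. f (b1 x y) $ i)"
      by (simp add: alt2_def linear_iff lie_algebraD[OF assms(1)] linear_add[OF assms(3)]
          linear_cmul[OF assms(3)] linear_0[OF assms(3)])
    show "alt2 (\<lambda>x y. b2 (f x) (f y) $ i)"
      by (rule alt2_compose[OF assms(3) alt2_bracket_nth[OF assms(2)]])
  qed (simp_all add: assms)
  then have "f (b1 x y) = b2 (f x) (f y)" for x y by (simp add: vec_eq_iff fun_eq_iff)
  then show ?thesis unfolding lie_isomorphic_def using assms(3) \<open>bij f\<close> by blast
qed

lemma lie_isomorphic_basis_3:
  fixes b1 b2 :: "real ^ 3 \<Rightarrow> real ^ 3 \<Rightarrow> real ^ 3"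
  assumes "lie_algebra b1" "lie_algebra b2" "linear f" "inj f"
    and "f (b1 (ev 1) (ev 2)) = b2 (f (ev 1)) (f (ev 2))" "f (b1 (ev 1) (ev 3)) = b2 (f (ev 1)) (f (ev 3))"
    "f (b1 (ev 2) (ev 3)) = b2 (f (ev 2)) (f (ev 3))"
  shows "lie_isomorphic b1 b2"
proof -
  have "bij f" using assms(3,4) linear_injective_imp_surjective by (auto simp: bij_def)
  have "(\<lambda>x y. f (b1 x y) $ i) = (\<lambda>x y. b2 (f x) (f y) $ i)" for i
  proof (rule alt2_eq3)
    show "alt2 (\<lambda>x y. f (b1 x y) $ i)"
      by (simp add: alt2_def linear_iff lie_algebraD[OF assms(1)] linear_add[OF assms(3)]
          linear_cmul[OF assms(3)] linear_0[OF assms(3)])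
    show "alt2 (\<lambda>x y. b2 (f x) (f y) $ i)"
      by (rule alt2_compose[OF assms(3) alt2_bracket_nth[OF assms(2)]])
  qed (simp_all add: assms)
  then have "f (b1 x y) = b2 (f x) (f y)" for x y by (simp add: vec_eq_iff fun_eq_iff)
  then show ?thesis unfolding lie_isomorphic_def using assms(3) \<open>bij f\<close> by blast
qed

lemma axis_vector_4:
  "ev 1 = (vector [1, 0, 0, 0] :: real ^ 4)" "ev 2 = (vector [0, 1, 0, 0] :: real ^ 4)"
  "ev 3 = (vector [0, 0, 1, 0] :: real ^ 4)" "ev 4 = (vector [0, 0, 0, 1] :: real ^ 4)"
proof -
  show "ev 1 = (vector [1, 0, 0, 0] :: real ^ 4)" unfolding vec_eq_iff forall_4 by (simp add: axis_def)
  show "ev 2 = (vector [0, 1, 0, 0] :: real ^ 4)" unfolding vec_eq_iff forall_4 by (simp add: axis_def)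
  show "ev 3 = (vector [0, 0, 1, 0] :: real ^ 4)" unfolding vec_eq_iff forall_4 by (simp add: axis_def)
  show "ev 4 = (vector [0, 0, 0, 1] :: real ^ 4)" unfolding vec_eq_iff forall_4 by (simp add: axis_def)
qed

text \<open>If \<open>[e\<^sub>3, e\<^sub>4] = z\<close> and \<open>p\<close>, \<open>q\<close> are the \<open>z\<close>-components of \<open>[e\<^sub>1, e\<^sub>3]\<close> and \<open>[e\<^sub>1, e\<^sub>4]\<close>, then
  \<open>e\<^sub>1 - q e\<^sub>3 + p e\<^sub>4\<close> preserves the plane spanned by \<open>e\<^sub>3\<close> and \<open>e\<^sub>4\<close>.\<close>

lemma gen4_heisenberg_1:
  assumes lie: "lie_algebra (gen4 A M)" and sym: "transpose M = M"
    and m: "M$1$1 * M$2$2 = M$1$2 * M$1$2" "M$1$1 * M$3$3 = M$1$3 * M$1$3" "M$1$1 * M$2$3 = M$1$2 * M$1$3"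
    and nz: "M$1$1 \<noteq> 0"
  shows "\<exists>B. lie_isomorphic (hs4 B) (gen4 A M)"
proof -
  have s: "M$2$1 = M$1$2" "M$3$1 = M$1$3" "M$3$2 = M$2$3"
    using sym by (simp_all add: vec_eq_iff transpose_def)
  define p q where pq: "p = A$1$2 / M$1$1" "q = A$1$3 / M$1$1"
  define B :: "real ^ 2 ^ 2" where "B = vector [vector [A$2$2 - p * M$1$2, A$2$3 - q * M$1$2],
    vector [A$3$2 - p * M$1$3, A$3$3 - q * M$1$3]]"
  \<comment> \<open>The images of the basis are e1 - q e3 + p e4, then e3, e4, and their bracket,
    the first column of \<open>M\<close>, which is independent of the others because its
    \<open>e2\<close>-entry is nonzero.\<close>
  define f :: "real ^ 4 \<Rightarrow> real ^ 4" where
    "f = (\<lambda>v. vector [v$1, v$4 * M$1$1, - q * v$1 + v$2 + v$4 * M$1$2, p * v$1 + v$3 + v$4 * M$1$3])"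
  have pM: "p * M$1$1 = A$1$2" "q * M$1$1 = A$1$3" using nz by (simp_all add: pq)
  have trB: "trace B = A$2$2 - p * M$1$2 + (A$3$3 - q * M$1$3)" by (simp add: B_def trace_def sum_2)
  have "lie_isomorphic (hs4 B) (gen4 A M)"
  proof (rule lie_isomorphic_basis_4[OF lie_algebra_hs4 lie, of f])
    show lf: "linear f" by (simp add: f_def linear_iff vec_eq_iff forall_4 algebra_simps)
    show "inj f" using nz
      by (subst linear_injective_0[OF lf]) (auto simp add: f_def vec_eq_iff forall_4)
    have E: "A$i$1 * M$1$1 + A$i$2 * M$2$1 + A$i$3 * M$3$1 + (M$i$1 * A$1$1 + M$i$2 * A$1$2 + M$i$3 * A$1$3)
      = (A$1$1 + A$2$2 + A$3$3) * M$i$1" for i by (rule gen4_jacobi(1)[OF lie])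
    show "f (hs4 B (ev 1) (ev 2)) = gen4 A M (f (ev 1)) (f (ev 2))"
      unfolding hs4_axis using pM
      by (simp add: f_def gen4_def ee_def axis_vector_4 B_def vec_eq_iff forall_4 s mult.commute)
    show "f (hs4 B (ev 1) (ev 3)) = gen4 A M (f (ev 1)) (f (ev 3))"
      unfolding hs4_axis using pM
      by (simp add: f_def gen4_def ee_def axis_vector_4 B_def vec_eq_iff forall_4 s mult.commute)
    show "f (hs4 B (ev 2) (ev 3)) = gen4 A M (f (ev 2)) (f (ev 3))"
      unfolding hs4_axis by (simp add: f_def gen4_def ee_def axis_vector_4 vec_eq_iff forall_4 s)
    show "f (hs4 B (ev 2) (ev 4)) = gen4 A M (f (ev 2)) (f (ev 4))"
      unfolding hs4_axis using m
      by (simp add: f_def gen4_def ee_def axis_vector_4 vec_eq_iff forall_4 s mult.commute)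
    show "f (hs4 B (ev 3) (ev 4)) = gen4 A M (f (ev 3)) (f (ev 4))"
      unfolding hs4_axis using m
      by (simp add: f_def gen4_def ee_def axis_vector_4 vec_eq_iff forall_4 s mult.commute)
    have pm: "p * (M$1$1 * M$2$2) = p * (M$1$2 * M$1$2)" "q * (M$1$1 * M$2$3) = q * (M$1$2 * M$1$3)"
      "p * (M$1$1 * M$2$3) = p * (M$1$2 * M$1$3)" "q * (M$1$1 * M$3$3) = q * (M$1$3 * M$1$3)"
      using m by simp_all
    have "(A$2$2 - p * M$1$2 + (A$3$3 - q * M$1$3)) * M$1$1 = A$1$1 * M$1$1 + p * M$1$1 * M$1$2 + q * M$1$1 * M$1$3"
      using E[of 1] unfolding s pM[symmetric] by (simp add: algebra_simps)
    moreover have "(A$2$2 - p * M$1$2 + (A$3$3 - q * M$1$3)) * M$1$2 = A$2$1 * M$1$1 + A$2$2 * M$1$2 + A$2$3 * M$1$3"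
      using E[of 2] pm unfolding s pM[symmetric] by (simp add: algebra_simps)
    moreover have "(A$2$2 - p * M$1$2 + (A$3$3 - q * M$1$3)) * M$1$3 = A$3$1 * M$1$1 + A$3$2 * M$1$2 + A$3$3 * M$1$3"
      using E[of 3] pm unfolding s pM[symmetric] by (simp add: algebra_simps)
    moreover note m
    ultimately show "f (hs4 B (ev 1) (ev 4)) = gen4 A M (f (ev 1)) (f (ev 4))"
      unfolding hs4_axis trB
      by (simp add: f_def gen4_def ee_def axis_vector_4 vec_eq_iff forall_4 s pM[symmetric] del: mult_cancel_left mult_cancel_right)
        (simp add: algebra_simps del: mult_cancel_left mult_cancel_right)
  qed
  then show ?thesis by blast
qed

text \<open>The matrix with respect to \<open>e3, e4, e2\<close>. A cyclic relabelling respects the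
  cyclic convention for the columns of \<open>M\<close>, so the same formula serves \<open>A\<close>
  and \<open>M\<close>, and each diagonal entry can be brought to the first place.\<close>

definition cyc :: "real ^ 3 ^ 3 \<Rightarrow> real ^ 3 ^ 3" where
  "cyc A = vector [vector [A$2$2, A$2$3, A$2$1], vector [A$3$2, A$3$3, A$3$1], vector [A$1$2, A$1$3, A$1$1]]"

lemma lie_isomorphic_cyc: "lie_isomorphic (gen4 A M) (gen4 (cyc A) (cyc M))"
proof -
  define f :: "real ^ 4 \<Rightarrow> real ^ 4" where "f = (\<lambda>v. vector [v$1, v$3, v$4, v$2])"
  have lf: "linear f" by (simp add: f_def linear_iff vec_eq_iff forall_4)
  have "inj f" by (subst linear_injective_0[OF lf]) (simp add: f_def vec_eq_iff forall_4)
  then have "bij f" using linear_injective_imp_surjective[OF lf] by (simp add: bij_def)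
  moreover have "f (gen4 A M x y) = gen4 (cyc A) (cyc M) (f x) (f y)" for x y
    by (simp add: f_def gen4_def cyc_def ee_def vec_eq_iff forall_4)
  ultimately show ?thesis unfolding lie_isomorphic_def using lf by blast
qed

lemma gen4_heisenberg:
  assumes lie: "lie_algebra (gen4 A M)" and H2: "H2_zero (gen4 A M)" and H3: "H3_zero (gen4 A M)"
    and nz: "M$1$1 \<noteq> 0"
  shows "\<exists>B. lie_isomorphic (gen4 A M) (hs4 B)"
proof -
  note m = gen4_minors(1)[OF assms(1-3)] and m' = gen4_minors'[OF assms(1-3)]
  obtain B where "lie_isomorphic (hs4 B) (gen4 A M)"
    using gen4_heisenberg_1[OF lie gen4_symmetric[OF lie H2] m[of 3 1 2] m[of 2 1 3] m'[of 1 2 3] nz]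
    by auto
  then show ?thesis using lie_isomorphic_sym by blast
qed

text \<open>When the diagonal cofactors of a symmetric matrix vanish, a zero diagonal forces the
  matrix to be zero. So a nonzero \<open>M\<close> has a nonzero diagonal entry, which is rotated
  into the first place.\<close>

lemma gen4_reduction:
  assumes lie: "lie_algebra (gen4 A M)" and H2: "H2_zero (gen4 A M)" and H3: "H3_zero (gen4 A M)"
  shows "M = 0 \<or> (\<exists>B. lie_isomorphic (gen4 A M) (hs4 B))"
proof -
  have step: "lie_algebra (gen4 (cyc A) (cyc M)) \<and> H2_zero (gen4 (cyc A) (cyc M)) \<and> H3_zero (gen4 (cyc A) (cyc M))"
    if "lie_algebra (gen4 A M) \<and> H2_zero (gen4 A M) \<and> H3_zero (gen4 A M)" for A M
    using that lie_isomorphic_lie_algebra[OF lie_isomorphic_sym[OF lie_isomorphic_cyc[of A M]]]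
      H2_zero_iso[OF lie_isomorphic_cyc[of A M]] H3_zero_iso[OF lie_isomorphic_cyc[of A M]] by blast
  have 1: "lie_algebra (gen4 (cyc A) (cyc M)) \<and> H2_zero (gen4 (cyc A) (cyc M)) \<and> H3_zero (gen4 (cyc A) (cyc M))"
    using step assms by blast
  note 2 = step[OF 1]
  consider "M$1$1 \<noteq> 0" | "M$2$2 \<noteq> 0" | "M$3$3 \<noteq> 0" | "M$1$1 = 0" "M$2$2 = 0" "M$3$3 = 0" by blast
  then show ?thesis
  proof cases
    case 1
    then show ?thesis using gen4_heisenberg[OF assms] by blast
  next
    case c: 2
    then have "cyc M$1$1 \<noteq> 0" by (simp add: cyc_def)
    then obtain B where "lie_isomorphic (gen4 (cyc A) (cyc M)) (hs4 B)"
      using gen4_heisenberg[of "cyc A" "cyc M"] 1 by blast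
    then show ?thesis using lie_isomorphic_trans[OF lie_isomorphic_cyc] by blast
  next
    case c: 3
    then have "cyc (cyc M)$1$1 \<noteq> 0" by (simp add: cyc_def)
    then obtain B where "lie_isomorphic (gen4 (cyc (cyc A)) (cyc (cyc M))) (hs4 B)"
      using gen4_heisenberg[of "cyc (cyc A)" "cyc (cyc M)"] 2 by blast
    then show ?thesis
      using lie_isomorphic_trans[OF lie_isomorphic_trans[OF lie_isomorphic_cyc lie_isomorphic_cyc]] by blast
  next
    case 4
    have s: "M$2$1 = M$1$2" "M$3$1 = M$1$3" "M$3$2 = M$2$3"
      using gen4_symmetric[OF lie H2] by (simp_all add: vec_eq_iff transpose_def)
    have "M$1$2 = 0" "M$1$3 = 0" "M$2$3 = 0"
      using gen4_minors(1)[OF assms, of 3 1 2] gen4_minors(1)[OF assms, of 2 1 3]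
        gen4_minors(1)[OF assms, of 1 2 3] 4 by simp_all
    then show ?thesis using 4 s by (simp add: vec_eq_iff forall_3)
  qed
qed

lemma reduction_4:
  fixes br :: "real ^ 4 \<Rightarrow> _"
  assumes "lie_algebra br" "H2_zero br" "H3_zero br"
  shows "(\<exists>A. lie_isomorphic br (sd4 A)) \<or> (\<exists>B. lie_isomorphic br (hs4 B))"
proof -
  obtain br' :: "real ^ 4 \<Rightarrow> _" where iso: "lie_isomorphic br' br" and 0: "\<forall>x y. br' x y $ 1 = 0"
    using closed_form_exists_4[OF assms(1,3)] rotate_closed_form[where br = br and i = 1] by blast
  note iso' = lie_isomorphic_sym[OF iso]
  have lie: "lie_algebra br'" by (rule lie_isomorphic_lie_algebra[OF iso assms(1)])
  obtain A M where br': "br' = gen4 A M" using gen4_exists[OF lie 0] by blast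
  have "M = 0 \<or> (\<exists>B. lie_isomorphic br' (hs4 B))"
    using gen4_reduction[of A M] lie H2_zero_iso[OF iso' assms(2)] H3_zero_iso[OF iso' assms(3)]
    unfolding br' by blast
  then show ?thesis using iso' br' lie_isomorphic_trans[OF iso'] by blast
qed

section \<open>Real Jordan normal forms\<close>

text \<open>Stated for tuples and not for sets, so that equal vectors count as dependent.\<close>

definition indep2 :: "'a::real_vector \<Rightarrow> 'a \<Rightarrow> bool" where
  "indep2 x y \<longleftrightarrow> (\<forall>a b. a *\<^sub>R x + b *\<^sub>R y = 0 \<longrightarrow> a = 0 \<and> b = 0)"

definition indep3 :: "'a::real_vector \<Rightarrow> 'a \<Rightarrow> 'a \<Rightarrow> bool" where
  "indep3 x y z \<longleftrightarrow> (\<forall>a b c. a *\<^sub>R x + b *\<^sub>R y + c *\<^sub>R z = 0 \<longrightarrow> a = 0 \<and> b = 0 \<and> c = 0)"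

lemma indep2_iff_det: "indep2 x y \<longleftrightarrow> x$1 * y$2 - x$2 * y$1 \<noteq> 0" for x y :: "real ^ 2"
proof -
  have "indep2 x y \<longleftrightarrow> (\<forall>a b. x$1 * a + y$1 * b = 0 \<and> x$2 * a + y$2 * b = 0 \<longrightarrow> a = 0 \<and> b = 0)"
    unfolding indep2_def by (simp add: vec_eq_iff forall_2 mult.commute)
  then show ?thesis unfolding linear_system_2 by (simp add: mult.commute)
qed

text \<open>A nonzero factor of the matrix is undone by rescaling \<open>e1\<close>, so only
  similarity up to a scalar matters. The isomorphism sends \<open>e1\<close> to
  \<open>e1 / c\<close> and \<open>e2\<close>, \<open>e3\<close> to \<open>x\<close>,
  \<open>y\<close>.\<close>

lemma sd3_basis:
  assumes "indep2 x y" "c \<noteq> 0"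
    and "B *v x = c *\<^sub>R (N$1$1 *\<^sub>R x + N$2$1 *\<^sub>R y)" "B *v y = c *\<^sub>R (N$1$2 *\<^sub>R x + N$2$2 *\<^sub>R y)"
  shows "lie_isomorphic (sd3 N) (sd3 B)"
proof -
  define k where "k = 1 / c"
  have kc: "k * c = 1" "k * (c * a) = a" for a using assms(2) by (simp_all add: k_def)
  define f :: "real ^ 3 \<Rightarrow> real ^ 3" where
    "f = (\<lambda>v. vector [k * v$1, v$2 * x$1 + v$3 * y$1, v$2 * x$2 + v$3 * y$2])"
  show ?thesis
  proof (rule lie_isomorphic_basis_3[OF lie_algebra_sd3 lie_algebra_sd3, of f])
    show lf: "linear f" by (simp add: f_def linear_iff vec_eq_iff forall_3 algebra_simps)
    show "inj f"
    proof (subst linear_injective_0[OF lf], intro allI impI)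
      fix v assume "f v = 0"
      then have "v$1 = 0" "v$2 *\<^sub>R x + v$3 *\<^sub>R y = 0"
        using assms(2) by (simp_all add: f_def k_def vec_eq_iff forall_2 forall_3)
      moreover from this have "v$2 = 0 \<and> v$3 = 0" using assms(1) unfolding indep2_def by blast
      ultimately show "v = 0" by (simp add: vec_eq_iff forall_3)
    qed
    have e: "k *\<^sub>R (B *v x) = N$1$1 *\<^sub>R x + N$2$1 *\<^sub>R y" "k *\<^sub>R (B *v y) = N$1$2 *\<^sub>R x + N$2$2 *\<^sub>R y"
      unfolding assms(3,4) by (simp_all add: kc)
    have e: "N$1$1 * x$1 + N$2$1 * y$1 = B$1$1 * (k * x$1) + B$1$2 * (k * x$2)"
      "N$1$1 * x$2 + N$2$1 * y$2 = B$2$1 * (k * x$1) + B$2$2 * (k * x$2)"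
      "N$1$2 * x$1 + N$2$2 * y$1 = B$1$1 * (k * y$1) + B$1$2 * (k * y$2)"
      "N$1$2 * x$2 + N$2$2 * y$2 = B$2$1 * (k * y$1) + B$2$2 * (k * y$2)"
      using arg_cong[OF e(1), of "\<lambda>v. v$1"] arg_cong[OF e(1), of "\<lambda>v. v$2"]
        arg_cong[OF e(2), of "\<lambda>v. v$1"] arg_cong[OF e(2), of "\<lambda>v. v$2"]
      unfolding matrix_vector_2 by (simp_all add: distrib_left mult.left_commute)
    show "f (sd3 N (ev 1) (ev 2)) = sd3 B (f (ev 1)) (f (ev 2))"
      unfolding gen3_axis
      by (simp add: f_def gen3_def ee_def axis_def vec_eq_iff forall_3 forall_2 e)
    show "f (sd3 N (ev 1) (ev 3)) = sd3 B (f (ev 1)) (f (ev 3))"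
      unfolding gen3_axis
      by (simp add: f_def gen3_def ee_def axis_def vec_eq_iff forall_3 forall_2 e)
    show "f (sd3 N (ev 2) (ev 3)) = sd3 B (f (ev 2)) (f (ev 3))"
      unfolding gen3_axis by (simp add: f_def gen3_def ee_def axis_def vec_eq_iff forall_3)
  qed
qed

lemma sd4_basis:
  assumes "indep3 x y z" "c \<noteq> 0"
    and "A *v x = c *\<^sub>R (N$1$1 *\<^sub>R x + N$2$1 *\<^sub>R y + N$3$1 *\<^sub>R z)"
    and "A *v y = c *\<^sub>R (N$1$2 *\<^sub>R x + N$2$2 *\<^sub>R y + N$3$2 *\<^sub>R z)"
    and "A *v z = c *\<^sub>R (N$1$3 *\<^sub>R x + N$2$3 *\<^sub>R y + N$3$3 *\<^sub>R z)"
  shows "lie_isomorphic (sd4 N) (sd4 A)"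
proof -
  define k where "k = 1 / c"
  have kc: "k * c = 1" "k * (c * a) = a" for a using assms(2) by (simp_all add: k_def)
  define f :: "real ^ 4 \<Rightarrow> real ^ 4" where
    "f = (\<lambda>v. vector [k * v$1, v$2 * x$1 + v$3 * y$1 + v$4 * z$1, v$2 * x$2 + v$3 * y$2 + v$4 * z$2,
       v$2 * x$3 + v$3 * y$3 + v$4 * z$3])"
  show ?thesis
  proof (rule lie_isomorphic_basis_4[OF lie_algebra_sd4 lie_algebra_sd4, of f])
    show lf: "linear f" by (simp add: f_def linear_iff vec_eq_iff forall_4 algebra_simps)
    show "inj f"
    proof (subst linear_injective_0[OF lf], intro allI impI)
      fix v assume "f v = 0"
      then have "v$1 = 0" "v$2 *\<^sub>R x + v$3 *\<^sub>R y + v$4 *\<^sub>R z = 0"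
        using assms(2) by (simp_all add: f_def k_def vec_eq_iff forall_4 forall_3)
      moreover from this have "v$2 = 0 \<and> v$3 = 0 \<and> v$4 = 0" using assms(1) unfolding indep3_def by blast
      ultimately show "v = 0" by (simp add: vec_eq_iff forall_4)
    qed
    have e: "k *\<^sub>R (A *v x) = N$1$1 *\<^sub>R x + N$2$1 *\<^sub>R y + N$3$1 *\<^sub>R z"
      "k *\<^sub>R (A *v y) = N$1$2 *\<^sub>R x + N$2$2 *\<^sub>R y + N$3$2 *\<^sub>R z"
      "k *\<^sub>R (A *v z) = N$1$3 *\<^sub>R x + N$2$3 *\<^sub>R y + N$3$3 *\<^sub>R z"
      unfolding assms(3-5) by (simp_all add: kc)
    have e: "N$1$1 * x$i + N$2$1 * y$i + N$3$1 * z$i = A$i$1 * (k * x$1) + A$i$2 * (k * x$2) + A$i$3 * (k * x$3)"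
      "N$1$2 * x$i + N$2$2 * y$i + N$3$2 * z$i = A$i$1 * (k * y$1) + A$i$2 * (k * y$2) + A$i$3 * (k * y$3)"
      "N$1$3 * x$i + N$2$3 * y$i + N$3$3 * z$i = A$i$1 * (k * z$1) + A$i$2 * (k * z$2) + A$i$3 * (k * z$3)" for i
      using arg_cong[OF e(1), of "\<lambda>v. v$i"] arg_cong[OF e(2), of "\<lambda>v. v$i"]
        arg_cong[OF e(3), of "\<lambda>v. v$i"]
      by (simp_all add: matrix_vector_mult_def sum_3 distrib_left mult.left_commute)
    show "f (sd4 N (ev 1) (ev 2)) = sd4 A (f (ev 1)) (f (ev 2))"
      unfolding gen4_axis
      by (simp add: f_def gen4_def ee_def axis_def vec_eq_iff forall_3 forall_4 e)
    show "f (sd4 N (ev 1) (ev 3)) = sd4 A (f (ev 1)) (f (ev 3))"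
      unfolding gen4_axis
      by (simp add: f_def gen4_def ee_def axis_def vec_eq_iff forall_3 forall_4 e)
    show "f (sd4 N (ev 1) (ev 4)) = sd4 A (f (ev 1)) (f (ev 4))"
      unfolding gen4_axis
      by (simp add: f_def gen4_def ee_def axis_def vec_eq_iff forall_3 forall_4 e)
  qed (unfold gen4_axis, simp_all add: f_def gen4_def ee_def axis_def vec_eq_iff forall_4)
qed

text \<open>The bracket of \<open>x\<close> and \<open>y\<close> is their determinant times
  \<open>e4\<close>, so the centre is scaled by \<open>d\<close>. Its eigenvalue fits because the
  traces also differ by the factor \<open>c\<close>.\<close>

lemma hs4_basis:
  assumes "indep2 x y" "c \<noteq> 0"
    and "B *v x = c *\<^sub>R (N$1$1 *\<^sub>R x + N$2$1 *\<^sub>R y)" "B *v y = c *\<^sub>R (N$1$2 *\<^sub>R x + N$2$2 *\<^sub>R y)"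
  shows "lie_isomorphic (hs4 N) (hs4 B)"
proof -
  define d where "d = x$1 * y$2 - x$2 * y$1"
  have d: "d \<noteq> 0" using assms(1) unfolding indep2_iff_det d_def .
  note e = assms(3,4)[unfolded matrix_vector_2]
  have tr: "trace B = c * trace N"
  proof -
    \<comment> \<open>The derivative of the determinant: tr B det(x, y) = det(B x, y) + det(x, B
      y).\<close>
    have "d * trace B = (B$1$1 * x$1 + B$1$2 * x$2) * y$2 - (B$2$1 * x$1 + B$2$2 * x$2) * y$1
      + x$1 * (B$2$1 * y$1 + B$2$2 * y$2) - x$2 * (B$1$1 * y$1 + B$1$2 * y$2)"
      unfolding d_def trace_def sum_2 by algebra
    also have "\<dots> = d * (c * trace N)"
      using e unfolding d_def trace_def sum_2 vec_eq_iff forall_2 by simp (simp add: algebra_simps)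
    finally show ?thesis using d by simp
  qed
  define k where "k = 1 / c"
  have kc: "k * c = 1" "k * (c * a) = a" for a using assms(2) by (simp_all add: k_def)
  define f :: "real ^ 4 \<Rightarrow> real ^ 4" where
    "f = (\<lambda>v. vector [k * v$1, v$2 * x$1 + v$3 * y$1, v$2 * x$2 + v$3 * y$2, v$4 * d])"
  show ?thesis
  proof (rule lie_isomorphic_basis_4[OF lie_algebra_hs4 lie_algebra_hs4, of f])
    show lf: "linear f" by (simp add: f_def linear_iff vec_eq_iff forall_4 algebra_simps)
    show "inj f"
    proof (subst linear_injective_0[OF lf], intro allI impI)
      fix v assume "f v = 0"
      then have "v$1 = 0" "v$4 = 0" "v$2 *\<^sub>R x + v$3 *\<^sub>R y = 0"
        using assms(2) d by (simp_all add: f_def k_def vec_eq_iff forall_2 forall_4)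
      moreover from this have "v$2 = 0 \<and> v$3 = 0" using assms(1) unfolding indep2_def by blast
      ultimately show "v = 0" by (simp add: vec_eq_iff forall_4)
    qed
    have e: "k *\<^sub>R (B *v x) = N$1$1 *\<^sub>R x + N$2$1 *\<^sub>R y" "k *\<^sub>R (B *v y) = N$1$2 *\<^sub>R x + N$2$2 *\<^sub>R y"
      unfolding assms(3,4) by (simp_all add: kc)
    have e: "N$1$1 * x$1 + N$2$1 * y$1 = B$1$1 * (k * x$1) + B$1$2 * (k * x$2)"
      "N$1$1 * x$2 + N$2$1 * y$2 = B$2$1 * (k * x$1) + B$2$2 * (k * x$2)"
      "N$1$2 * x$1 + N$2$2 * y$1 = B$1$1 * (k * y$1) + B$1$2 * (k * y$2)"
      "N$1$2 * x$2 + N$2$2 * y$2 = B$2$1 * (k * y$1) + B$2$2 * (k * y$2)"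
      using arg_cong[OF e(1), of "\<lambda>v. v$1"] arg_cong[OF e(1), of "\<lambda>v. v$2"]
        arg_cong[OF e(2), of "\<lambda>v. v$1"] arg_cong[OF e(2), of "\<lambda>v. v$2"]
      unfolding matrix_vector_2 by (simp_all add: distrib_left mult.left_commute)
    show "f (hs4 N (ev 1) (ev 2)) = hs4 B (f (ev 1)) (f (ev 2))"
      unfolding hs4_axis
      by (simp add: f_def hs4_def gen4_def ee_def axis_def vec_eq_iff forall_4 forall_2 e)
    show "f (hs4 N (ev 1) (ev 3)) = hs4 B (f (ev 1)) (f (ev 3))"
      unfolding hs4_axis
      by (simp add: f_def hs4_def gen4_def ee_def axis_def vec_eq_iff forall_4 forall_2 e)
    show "f (hs4 N (ev 1) (ev 4)) = hs4 B (f (ev 1)) (f (ev 4))"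
      unfolding hs4_axis using tr assms(2)
      by (simp add: k_def f_def hs4_def gen4_def ee_def axis_def vec_eq_iff forall_4)
    show "f (hs4 N (ev 2) (ev 3)) = hs4 B (f (ev 2)) (f (ev 3))"
      unfolding hs4_axis
      by (simp add: f_def hs4_def gen4_def ee_def axis_def vec_eq_iff forall_4 d_def mult.commute)
  qed (unfold hs4_axis, simp_all add: f_def hs4_def gen4_def ee_def axis_def vec_eq_iff forall_4)
qed

section \<open>Linear maps on an invariant plane\<close>

lemma real_quadratic_root:
  assumes "(p - s)^2 + 4 * q * r \<ge> (0::real)"
  shows "\<exists>m. (p - m) * (s - m) = q * r"
proof -
  define w where "w = sqrt ((p - s)^2 + 4 * q * r)"
  have "w^2 = (p - s)^2 + 4 * q * r" using assms by (simp add: w_def)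
  then show ?thesis
    by (intro exI[of _ "(p + s + w) / 2"]) (simp add: field_simps power2_eq_square)
qed

lemma singular_system_2:
  assumes "a * d = b * (c::real)"
  shows "\<exists>x y. (x \<noteq> 0 \<or> y \<noteq> 0) \<and> a * x + b * y = 0 \<and> c * x + d * y = 0"
proof -
  have "\<not> (\<forall>x y. a * x + b * y = 0 \<and> c * x + d * y = 0 \<longrightarrow> x = 0 \<and> y = 0)"
    unfolding linear_system_2 using assms by simp
  then show ?thesis by blast
qed

text \<open>The sign of the discriminant of the characteristic polynomial decides between a real
  eigenvector and a complex pair. The plane lies in an arbitrary space because the result is also
  applied to an invariant plane of a three-dimensional one.\<close>

lemma plane_normal_form:
  fixes T :: "'a::real_vector \<Rightarrow> 'a"
  assumes T: "linear T"
    and Tw: "T w1 = p *\<^sub>R w1 + q *\<^sub>R w2" "T w2 = r *\<^sub>R w1 + s *\<^sub>R w2"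
  obtains k1 k2 l1 l2 v1 v2 a b where "k1 * l2 - k2 * l1 \<noteq> 0"
    "v1 = k1 *\<^sub>R w1 + k2 *\<^sub>R w2" "v2 = l1 *\<^sub>R w1 + l2 *\<^sub>R w2"
    "T v1 = a *\<^sub>R v1 \<and> T v2 = b *\<^sub>R v2 \<or> T v1 = a *\<^sub>R v1 \<and> T v2 = v1 + a *\<^sub>R v2 \<or>
     b \<noteq> 0 \<and> T v1 = a *\<^sub>R v1 - b *\<^sub>R v2 \<and> T v2 = b *\<^sub>R v1 + a *\<^sub>R v2"
proof -
  have Tc: "T (x *\<^sub>R w1 + y *\<^sub>R w2) = (p * x + r * y) *\<^sub>R w1 + (q * x + s * y) *\<^sub>R w2" for x y
    by (simp add: linear_add[OF T] linear_cmul[OF T] Tw algebra_simps)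
  show thesis
  proof (cases "(p - s)^2 + 4 * q * r \<ge> 0")
    case True
    then obtain m where m: "(p - m) * (s - m) = q * r" using real_quadratic_root by blast
    then obtain x y where xy: "x \<noteq> 0 \<or> y \<noteq> 0" "(p - m) * x + r * y = 0" "q * x + (s - m) * y = 0"
      using singular_system_2[of "p - m" "s - m" r q] by (auto simp: mult.commute)
    define v where "v = x *\<^sub>R w1 + y *\<^sub>R w2"
    have "p * x + r * y = m * x" "q * x + s * y = m * y" using xy(2,3) by (simp_all add: algebra_simps)
    then have Tv: "T v = m *\<^sub>R v" unfolding v_def Tc by (simp add: algebra_simps)
    obtain x' y' where nz: "x * y' - y * x' \<noteq> 0"
    proof (cases "x = 0")
      case True
      then show ?thesis using that[of 0 1] xy(1) that[of 1 0] by simp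
    next
      case False
      then show ?thesis using that[of 1 0] by simp
    qed
    define v' where "v' = x' *\<^sub>R w1 + y' *\<^sub>R w2"
    define D where "D = x * y' - y * x'"
    define X Y where "X = p * x' + r * y'" and "Y = q * x' + s * y'"
    \<comment> \<open>Cramer's rule for the coordinates of \<open>T v'\<close> in the basis
      \<open>v\<close>, \<open>v'\<close>.\<close>
    define c d where "c = (X * y' - Y * x') / D" and "d = (x * Y - y * X) / D"
    have D0: "D \<noteq> 0" using nz by (simp add: D_def)
    then have cd: "D * c = X * y' - Y * x'" "D * d = x * Y - y * X" by (simp_all add: c_def d_def)
    have "D * X = D * (c * x + d * x')" "D * Y = D * (c * y + d * y')"
      using cd unfolding D_def by algebra+
    then have "X = c * x + d * x'" "Y = c * y + d * y'" using D0 by simp_all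
    then have Tv': "T v' = c *\<^sub>R v + d *\<^sub>R v'"
      unfolding v'_def Tc v_def by (simp add: X_def[symmetric] Y_def[symmetric] algebra_simps)
    show thesis
    proof (cases "d = m")
      case False
      \<comment> \<open>Chosen to make \<open>v' + t v\<close> an eigenvector for the second
        eigenvalue \<open>d\<close>.\<close>
      define t where "t = c / (d - m)"
      have t: "c + t * m = d * t" using False by (simp add: t_def field_simps)
      have "T (v' + t *\<^sub>R v) = d *\<^sub>R v' + (c + t * m) *\<^sub>R v"
        by (simp add: linear_add[OF T] linear_cmul[OF T] Tv Tv' algebra_simps)
      then have "T (v' + t *\<^sub>R v) = d *\<^sub>R (v' + t *\<^sub>R v)" unfolding t by (simp add: algebra_simps)
      moreover have "v' + t *\<^sub>R v = (x' + t * x) *\<^sub>R w1 + (y' + t * y) *\<^sub>R w2"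
        by (simp add: v_def v'_def algebra_simps)
      moreover have "x * (y' + t * y) - y * (x' + t * x) \<noteq> 0" using nz by (simp add: algebra_simps)
      ultimately show thesis using that[of x "y' + t * y" y "x' + t * x" v _ m d] Tv v_def by blast
    next
      case dm: True
      show thesis
      proof (cases "c = 0")
        case True
        then show thesis using that[of x y' y x' v v' m m] nz Tv Tv' v_def v'_def dm by simp
      next
        case False
        \<comment> \<open>With \<open>c v\<close> in place of \<open>v\<close> the entry above the
          diagonal becomes 1.\<close>
        have "T (c *\<^sub>R v) = m *\<^sub>R (c *\<^sub>R v)" by (simp add: linear_cmul[OF T] Tv)
        moreover have "c *\<^sub>R v = (c * x) *\<^sub>R w1 + (c * y) *\<^sub>R w2" by (simp add: v_def algebra_simps)
        moreover have "(c * x) * y' - (c * y) * x' \<noteq> 0" using nz False by (simp add: algebra_simps)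
        ultimately show thesis using that[of "c * x" y' "c * y" x' "c *\<^sub>R v" v' m m] Tv' v'_def dm by blast
      qed
    qed
  next
    case False
    \<comment> \<open>Real and imaginary part of the eigenvalues.\<close>
    define a b where "a = (p + s) / 2" and "b = sqrt (- ((p - s)^2 + 4 * q * r)) / 2"
    have b0: "b \<noteq> 0" using False by (simp add: b_def)
    have b2: "(2 * b)^2 = - ((p - s)^2 + 4 * q * r)" using False by (simp add: b_def)
    have q0: "q \<noteq> 0" using False by auto
    \<comment> \<open>The second vector is found by solving T w1 = a w1 - b v for v.\<close>
    define X Y where "X = (a - p) / b" and "Y = - q / b"
    have XY: "b * X = a - p" "b * Y = - q" using b0 by (simp_all add: X_def Y_def)
    define v where "v = X *\<^sub>R w1 + Y *\<^sub>R w2"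
    have bv: "b *\<^sub>R v = (a - p) *\<^sub>R w1 - q *\<^sub>R w2"
      unfolding v_def scaleR_add_right scaleR_scaleR XY by simp
    have 1: "T w1 = a *\<^sub>R w1 - b *\<^sub>R v" unfolding bv Tw by (simp add: algebra_simps)
    have "T v = b *\<^sub>R w1 + a *\<^sub>R v"
    proof -
      have "b * (p * X + r * Y) = b * (b + a * X)" "b * (q * X + s * Y) = b * (a * Y)"
        using b2 XY unfolding a_def by algebra+
      then have e: "p * X + r * Y = b + a * X" "q * X + s * Y = a * Y" using b0 by simp_all
      show ?thesis unfolding v_def Tc e by (simp add: algebra_simps)
    qed
    moreover have "1 * Y - 0 * X \<noteq> 0" using q0 b0 by (simp add: Y_def)
    ultimately show thesis using that[of 1 Y 0 X w1 v a b] 1 b0 v_def by simp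
  qed
qed

lemma indep2_comb:
  assumes "indep2 w1 w2" "k1 * l2 - k2 * l1 \<noteq> 0"
    "v1 = k1 *\<^sub>R w1 + k2 *\<^sub>R w2" "v2 = l1 *\<^sub>R w1 + l2 *\<^sub>R w2"
  shows "indep2 v1 v2"
  unfolding indep2_def
proof (intro allI impI)
  fix a b assume "a *\<^sub>R v1 + b *\<^sub>R v2 = 0"
  then have "(k1 * a + l1 * b) *\<^sub>R w1 + (k2 * a + l2 * b) *\<^sub>R w2 = 0"
    unfolding assms(3,4) by (simp add: algebra_simps)
  then have "k1 * a + l1 * b = 0 \<and> k2 * a + l2 * b = 0" using assms(1) unfolding indep2_def by blast
  moreover have "k1 * l2 - l1 * k2 \<noteq> 0" using assms(2) by (simp add: mult.commute)
  ultimately show "a = 0 \<and> b = 0" using linear_system_2(2)[of k1 l1 k2 l2] by blast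
qed

lemma indep3_comb:
  assumes "indep3 u w1 w2" "k1 * l2 - k2 * l1 \<noteq> 0"
    "v1 = k1 *\<^sub>R w1 + k2 *\<^sub>R w2" "v2 = l1 *\<^sub>R w1 + l2 *\<^sub>R w2"
  shows "indep3 u v1 v2"
  unfolding indep3_def
proof (intro allI impI)
  fix c a b assume "c *\<^sub>R u + a *\<^sub>R v1 + b *\<^sub>R v2 = 0"
  then have "c *\<^sub>R u + (k1 * a + l1 * b) *\<^sub>R w1 + (k2 * a + l2 * b) *\<^sub>R w2 = 0"
    unfolding assms(3,4) by (simp add: algebra_simps)
  then have "c = 0 \<and> k1 * a + l1 * b = 0 \<and> k2 * a + l2 * b = 0" using assms(1) unfolding indep3_def by blast
  moreover have "k1 * l2 - l1 * k2 \<noteq> 0" using assms(2) by (simp add: mult.commute)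
  ultimately show "c = 0 \<and> a = 0 \<and> b = 0" using linear_system_2(2)[of k1 l1 k2 l2] by blast
qed

lemma indep2_scale: "indep2 x y \<Longrightarrow> s \<noteq> 0 \<Longrightarrow> t \<noteq> 0 \<Longrightarrow> indep2 (s *\<^sub>R x) (t *\<^sub>R y)"
  by (rule indep2_comb[of x y s t 0 0]) auto

lemma indep2_swap: "indep2 x y \<Longrightarrow> indep2 y x"
  by (rule indep2_comb[of x y 0 0 1 1]) auto

lemma indep3_scale:
  assumes "indep3 x y z" "r \<noteq> 0" "s \<noteq> 0" "t \<noteq> 0"
  shows "indep3 (r *\<^sub>R x) (s *\<^sub>R y) (t *\<^sub>R z)"
  unfolding indep3_def
proof (intro allI impI)
  fix a b c assume "a *\<^sub>R r *\<^sub>R x + b *\<^sub>R s *\<^sub>R y + c *\<^sub>R t *\<^sub>R z = 0"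
  then have "a * r = 0 \<and> b * s = 0 \<and> c * t = 0"
    using assms(1) unfolding indep3_def scaleR_scaleR by blast
  then show "a = 0 \<and> b = 0 \<and> c = 0" using assms(2-) by simp
qed

lemma indep3_perm:
  assumes "indep3 x y z" shows "indep3 y x z" "indep3 x z y"
proof -
  show "indep3 y x z" unfolding indep3_def
  proof (intro allI impI)
    fix a b c assume "a *\<^sub>R y + b *\<^sub>R x + c *\<^sub>R z = 0"
    then have "b *\<^sub>R x + a *\<^sub>R y + c *\<^sub>R z = 0" by (simp only: add.commute)
    then show "a = 0 \<and> b = 0 \<and> c = 0" using assms unfolding indep3_def by blast
  qed
  show "indep3 x z y" unfolding indep3_def
  proof (intro allI impI)
    fix a b c assume "a *\<^sub>R x + b *\<^sub>R z + c *\<^sub>R y = 0"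
    then have "a *\<^sub>R x + c *\<^sub>R y + b *\<^sub>R z = 0" by (simp add: add_ac)
    then show "a = 0 \<and> b = 0 \<and> c = 0" using assms unfolding indep3_def by blast
  qed
qed

lemma indep3_shift:
  assumes "indep3 u x y" shows "indep3 (u + a *\<^sub>R x + b *\<^sub>R y) x y"
  unfolding indep3_def
proof (intro allI impI)
  fix c d e assume "c *\<^sub>R (u + a *\<^sub>R x + b *\<^sub>R y) + d *\<^sub>R x + e *\<^sub>R y = 0"
  then have "c *\<^sub>R u + (c * a + d) *\<^sub>R x + (c * b + e) *\<^sub>R y = 0" by (simp add: algebra_simps)
  then have "c = 0 \<and> c * a + d = 0 \<and> c * b + e = 0" using assms unfolding indep3_def by blast
  then show "c = 0 \<and> d = 0 \<and> e = 0" by auto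
qed

lemma indep2_axis: "indep2 (ev 1) (ev 2 :: real ^ 2)"
  unfolding indep2_def vec_eq_iff forall_2 by (simp add: axis_def)

lemma plane_normal_form_matrix:
  fixes B :: "real ^ 2 ^ 2"
  obtains v1 v2 a b where "indep2 v1 v2"
    "B *v v1 = a *\<^sub>R v1 \<and> B *v v2 = b *\<^sub>R v2 \<or> B *v v1 = a *\<^sub>R v1 \<and> B *v v2 = v1 + a *\<^sub>R v2 \<or>
     b \<noteq> 0 \<and> B *v v1 = a *\<^sub>R v1 - b *\<^sub>R v2 \<and> B *v v2 = b *\<^sub>R v1 + a *\<^sub>R v2"
proof -
  have e: "B *v ev 1 = B$1$1 *\<^sub>R ev 1 + B$2$1 *\<^sub>R ev 2" "B *v ev 2 = B$1$2 *\<^sub>R ev 1 + B$2$2 *\<^sub>R ev 2"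
    by (simp_all add: matrix_vector_2 vec_eq_iff forall_2 axis_def)
  show thesis
  proof (rule plane_normal_form[OF matrix_vector_mul_linear e])
    fix k1 l2 k2 l1 v1 v2 a b
    assume k: "k1 * l2 - k2 * l1 \<noteq> 0" "v1 = k1 *\<^sub>R ev 1 + k2 *\<^sub>R ev 2" "v2 = l1 *\<^sub>R ev 1 + l2 *\<^sub>R ev 2"
      and nf: "B *v v1 = a *\<^sub>R v1 \<and> B *v v2 = b *\<^sub>R v2 \<or> B *v v1 = a *\<^sub>R v1 \<and> B *v v2 = v1 + a *\<^sub>R v2 \<or>
       b \<noteq> 0 \<and> B *v v1 = a *\<^sub>R v1 - b *\<^sub>R v2 \<and> B *v v2 = b *\<^sub>R v1 + a *\<^sub>R v2"
    show thesis by (rule that[OF indep2_comb[OF indep2_axis k] nf])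
  qed
qed

section \<open>Linear maps on a three-dimensional space\<close>

lemma cubic_root: "\<exists>x::real. x^3 + p * x^2 + q * x + r = 0"
proof -
  \<comment> \<open>With this bound K^3 is the sum of K^2, |p| K^2, |q| K^2 and |r| K^2, and as K is
    at least 1 it dominates the lower terms at both endpoints.\<close>
  define K where "K = 1 + \<bar>p\<bar> + \<bar>q\<bar> + \<bar>r\<bar>"
  define f where "f = (\<lambda>x::real. x^3 + p * x^2 + q * x + r)"
  have K: "K \<ge> 1" "K > 0" by (auto simp: K_def)
  have K2: "K \<le> K^2" "1 \<le> K^2" using K by (simp_all add: self_le_power)
  have "p * K^2 \<le> \<bar>p\<bar> * K^2" "- (p * K^2) \<le> \<bar>p\<bar> * K^2"
    using mult_right_mono[of p "\<bar>p\<bar>" "K^2"] mult_right_mono[of "- p" "\<bar>p\<bar>" "K^2"] by auto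
  moreover have "q * K \<le> \<bar>q\<bar> * K^2" "- (q * K) \<le> \<bar>q\<bar> * K^2"
    using mult_mono[of q "\<bar>q\<bar>" K "K^2"] mult_mono[of "- q" "\<bar>q\<bar>" K "K^2"] K K2 by auto
  moreover have "\<bar>r\<bar> \<le> \<bar>r\<bar> * K^2" using mult_left_mono[OF K2(2), of "\<bar>r\<bar>"] by simp
  moreover have "K^3 = K^2 + \<bar>p\<bar> * K^2 + \<bar>q\<bar> * K^2 + \<bar>r\<bar> * K^2"
    unfolding power3_eq_cube power2_eq_square
    using arg_cong[OF K_def, of "\<lambda>x. x * (K * K)"] by (simp add: algebra_simps)
  moreover have "f K = K^3 + p * K^2 + q * K + r" "f (- K) = - (K^3) + p * K^2 - q * K + r"
    by (simp_all add: f_def)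
  moreover have "r \<le> \<bar>r\<bar>" "- r \<le> \<bar>r\<bar>" by simp_all
  ultimately have "f K \<ge> 0" "f (- K) \<le> 0" using K2 by linarith+
  moreover have "continuous_on {- K..K} f" unfolding f_def by (intro continuous_intros)
  ultimately obtain x where "f x = 0" using IVT'[of f "- K" 0 K] K by auto
  then show ?thesis by (auto simp: f_def)
qed

text \<open>The transpose has a real eigenvector because its characteristic polynomial has odd
  degree. The kernel of this functional will be an invariant plane; \<open>?e\<close> is the sum of
  the principal minors of size two.\<close>

lemma left_eigenvector_3:
  fixes A :: "real ^ 3 ^ 3"
  shows "\<exists>l m. l \<noteq> 0 \<and> (\<forall>x. l \<bullet> (A *v x) = m * (l \<bullet> x))"
proof -
  let ?t = "A$1$1 + A$2$2 + A$3$3"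
  let ?e = "A$1$1 * A$2$2 - A$1$2 * A$2$1 + A$1$1 * A$3$3 - A$1$3 * A$3$1 + A$2$2 * A$3$3 - A$2$3 * A$3$2"
  obtain m where m: "m^3 + (- ?t) * m^2 + ?e * m + (- det A) = 0" using cubic_root by metis
  let ?N = "transpose A - mat m"
  have "det ?N = - (m^3 + (- ?t) * m^2 + ?e * m + (- det A))"
    by (simp add: det_3 transpose_def mat_def power3_eq_cube power2_eq_square algebra_simps)
  then have "det ?N = 0" using m by simp
  then obtain l where l: "?N *v l = 0" "l \<noteq> 0" using det_nz_iff_inj[of ?N] by blast
  have l1: "A$1$1 * l$1 + A$2$1 * l$2 + A$3$1 * l$3 = m * l$1" "A$1$2 * l$1 + A$2$2 * l$2 + A$3$2 * l$3 = m * l$2"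
    "A$1$3 * l$1 + A$2$3 * l$2 + A$3$3 * l$3 = m * l$3"
    using l(1) unfolding matrix_vector_3 by (simp_all add: vec_eq_iff forall_3 transpose_def mat_def algebra_simps)
  have "l \<bullet> (A *v x) = m * (l \<bullet> x)" for x
  proof -
    have "l \<bullet> (A *v x) = (A$1$1 * l$1 + A$2$1 * l$2 + A$3$1 * l$3) * x$1
      + (A$1$2 * l$1 + A$2$2 * l$2 + A$3$2 * l$3) * x$2 + (A$1$3 * l$1 + A$2$3 * l$2 + A$3$3 * l$3) * x$3"
      unfolding matrix_vector_3 inner_3 by (simp add: algebra_simps)
    then show ?thesis unfolding l1 inner_3 by (simp add: algebra_simps)
  qed
  then show ?thesis using l(2) by blast
qed

text \<open>An orthogonal map sending a multiple of the first basis vector to \<open>l\<close> sends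
  the other two into the kernel of \<open>l\<close>, which \<open>A\<close> preserves; on the
  quotient \<open>A\<close> acts by \<open>m\<close>.\<close>

lemma invariant_plane_3:
  fixes A :: "real ^ 3 ^ 3"
  obtains u w1 w2 m p q r s c d where "indep3 u w1 w2"
    "A *v u = m *\<^sub>R u + c *\<^sub>R w1 + d *\<^sub>R w2"
    "A *v w1 = p *\<^sub>R w1 + q *\<^sub>R w2" "A *v w2 = r *\<^sub>R w1 + s *\<^sub>R w2"
proof -
  obtain l m where l: "l \<noteq> 0" "\<And>x. l \<bullet> (A *v x) = m * (l \<bullet> x)" using left_eigenvector_3[of A] by blast
  have "norm (norm l *\<^sub>R ev 1 :: real ^ 3) = norm l" by (simp add: norm_axis_1)
  from orthogonal_transformation_exists[OF this]
  obtain f :: "real ^ 3 \<Rightarrow> real ^ 3" where f: "orthogonal_transformation f" "f (norm l *\<^sub>R ev 1) = l"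
    by blast
  have lin: "linear f" and bij: "bij f"
    using f(1) by (auto simp: orthogonal_transformation_linear orthogonal_transformation_bij)
  have lf: "l \<bullet> f x = norm l * x$1" for x
  proof -
    have "l \<bullet> f x = f (norm l *\<^sub>R ev 1) \<bullet> f x" using f(2) by simp
    also have "\<dots> = (norm l *\<^sub>R ev 1) \<bullet> x" using f(1) by (simp add: orthogonal_transformation_def)
    finally show ?thesis by (simp add: inner_axis')
  qed
  have ex: "\<exists>a b. A *v f x = (m * x$1) *\<^sub>R f (ev 1) + a *\<^sub>R f (ev 2) + b *\<^sub>R f (ev 3)" for x
  proof -
    obtain y where y: "A *v f x = f y" using surjD[OF bij_is_surj[OF bij]] by blast
    have "norm l * y$1 = norm l * (m * x$1)" using lf[of y] l(2)[of "f x"] lf[of x] y by simp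
    then have "y$1 = m * x$1" using l(1) by simp
    moreover have yeq: "y = y$1 *\<^sub>R ev 1 + y$2 *\<^sub>R ev 2 + y$3 *\<^sub>R ev 3"
      unfolding vec_eq_iff forall_3 by (simp add: axis_def)
    have "f y = y$1 *\<^sub>R f (ev 1) + y$2 *\<^sub>R f (ev 2) + y$3 *\<^sub>R f (ev 3)"
      using arg_cong[OF yeq, of f] by (simp only: linear_add[OF lin] linear_cmul[OF lin])
    ultimately have "A *v f x = (m * x$1) *\<^sub>R f (ev 1) + y$2 *\<^sub>R f (ev 2) + y$3 *\<^sub>R f (ev 3)"
      unfolding y by simp
    then show ?thesis by blast
  qed
  have ind: "indep3 (f (ev 1)) (f (ev 2)) (f (ev 3))" unfolding indep3_def
  proof (intro allI impI)
    fix a b c assume "a *\<^sub>R f (ev 1) + b *\<^sub>R f (ev 2) + c *\<^sub>R f (ev 3) = 0"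
    then have "f (a *\<^sub>R ev 1 + b *\<^sub>R ev 2 + c *\<^sub>R ev 3) = f 0"
      by (simp add: linear_add[OF lin] linear_cmul[OF lin] linear_0[OF lin])
    then have "a *\<^sub>R ev 1 + b *\<^sub>R ev 2 + c *\<^sub>R ev 3 = (0 :: real ^ 3)"
      using bij by (simp add: bij_is_inj inj_eq)
    then show "a = 0 \<and> b = 0 \<and> c = 0" unfolding vec_eq_iff forall_3 by (simp add: axis_def)
  qed
  have e0: "ev 1 $ (1::3) = (1::real)" "ev 2 $ (1::3) = (0::real)" "ev 3 $ (1::3) = (0::real)"
    by (simp_all add: axis_def)
  then have ex': "\<exists>a b. A *v f (ev 1) = m *\<^sub>R f (ev 1) + a *\<^sub>R f (ev 2) + b *\<^sub>R f (ev 3)"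
    "\<exists>a b. A *v f (ev 2) = a *\<^sub>R f (ev 2) + b *\<^sub>R f (ev 3)"
    "\<exists>a b. A *v f (ev 3) = a *\<^sub>R f (ev 2) + b *\<^sub>R f (ev 3)"
    using ex[of "ev 1"] ex[of "ev 2"] ex[of "ev 3"]
    by (simp_all only: e0 mult_1_right mult_zero_right scaleR_zero_left add_0_left)
  obtain c d p q r s where
    "A *v f (ev 1) = m *\<^sub>R f (ev 1) + c *\<^sub>R f (ev 2) + d *\<^sub>R f (ev 3)"
    "A *v f (ev 2) = p *\<^sub>R f (ev 2) + q *\<^sub>R f (ev 3)"
    "A *v f (ev 3) = r *\<^sub>R f (ev 2) + s *\<^sub>R f (ev 3)" using ex' by (elim exE)
  then show thesis by (rule that[OF ind])
qed

text \<open>The invariant plane is normalized, and \<open>u\<close> is then shifted within its coset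
  so that \<open>A u - m u\<close> loses every component it can. A component that cannot be removed
  lengthens a Jordan chain.\<close>

lemma normal_form_3:
  fixes A :: "real ^ 3 ^ 3"
  obtains x y z a b c where "indep3 x y z"
    "A *v x = a *\<^sub>R x \<and> A *v y = b *\<^sub>R y \<and> A *v z = c *\<^sub>R z \<or>
     A *v x = a *\<^sub>R x \<and> A *v y = b *\<^sub>R y \<and> A *v z = y + b *\<^sub>R z \<or>
     A *v x = a *\<^sub>R x \<and> A *v y = x + a *\<^sub>R y \<and> A *v z = y + a *\<^sub>R z \<or>
     c \<noteq> 0 \<and> A *v x = a *\<^sub>R x \<and> A *v y = b *\<^sub>R y - c *\<^sub>R z \<and> A *v z = c *\<^sub>R y + b *\<^sub>R z"
proof -
  obtain u w1 w2 m p q r s c d where ind: "indep3 u w1 w2"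
    and Au: "A *v u = m *\<^sub>R u + c *\<^sub>R w1 + d *\<^sub>R w2"
    and Aw: "A *v w1 = p *\<^sub>R w1 + q *\<^sub>R w2" "A *v w2 = r *\<^sub>R w1 + s *\<^sub>R w2"
    by (rule invariant_plane_3)
  have T: "linear ((*v) A)" by (rule matrix_vector_mul_linear)
  note lin = linear_add[OF T] linear_cmul[OF T]
  obtain k1 k2 l1 l2 v1 v2 a b where k: "k1 * l2 - k2 * l1 \<noteq> 0"
    and v: "v1 = k1 *\<^sub>R w1 + k2 *\<^sub>R w2" "v2 = l1 *\<^sub>R w1 + l2 *\<^sub>R w2" and
    nf: "A *v v1 = a *\<^sub>R v1 \<and> A *v v2 = b *\<^sub>R v2 \<or> A *v v1 = a *\<^sub>R v1 \<and> A *v v2 = v1 + a *\<^sub>R v2 \<or>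
     b \<noteq> 0 \<and> A *v v1 = a *\<^sub>R v1 - b *\<^sub>R v2 \<and> A *v v2 = b *\<^sub>R v1 + a *\<^sub>R v2"
    by (rule plane_normal_form[OF T Aw])
  have ind: "indep3 u v1 v2" by (rule indep3_comb[OF ind k v])
  obtain e f where ef: "c = k1 * e + l1 * f" "d = k2 * e + l2 * f"
  proof -
    have "k1 * l2 - l1 * k2 \<noteq> 0" using k by (simp add: mult.commute)
    then show ?thesis using linear_system_2(1)[of k1 l1 k2 l2] that by blast
  qed
  have Au: "A *v u = m *\<^sub>R u + e *\<^sub>R v1 + f *\<^sub>R v2" unfolding Au ef v by (simp add: algebra_simps)
  have As: "A *v (u + x *\<^sub>R v1 + y *\<^sub>R v2) = m *\<^sub>R u + e *\<^sub>R v1 + f *\<^sub>R v2 + x *\<^sub>R (A *v v1) + y *\<^sub>R (A *v v2)" for x y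
    by (simp add: lin Au)
  from nf show thesis
  proof (elim disjE conjE)
    assume v1: "A *v v1 = a *\<^sub>R v1" and v2: "A *v v2 = b *\<^sub>R v2"
    \<comment> \<open>Adding \<open>x v1\<close> to \<open>u\<close> changes the
      \<open>v1\<close>-component of \<open>(A - m) u\<close> by \<open>(a - m) x\<close>, which can
      cancel it unless \<open>a = m\<close>; then \<open>e'\<close> is the remainder. Likewise for
      \<open>y\<close> and \<open>f'\<close>.\<close>
    define x y where "x = (if a = m then 0 else e / (m - a))" and "y = (if b = m then 0 else f / (m - b))"
    define e' f' where "e' = (if a = m then e else 0)" and "f' = (if b = m then f else 0)"
    define z where "z = u + x *\<^sub>R v1 + y *\<^sub>R v2"
    have iz: "indep3 z v1 v2" unfolding z_def by (rule indep3_shift[OF ind])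
    have xy: "e + x * a = m * x + e'" "f + y * b = m * y + f'"
      by (auto simp: x_def y_def e'_def f'_def field_simps)
    have "A *v z = m *\<^sub>R u + (e + x * a) *\<^sub>R v1 + (f + y * b) *\<^sub>R v2"
      unfolding z_def As v1 v2 by (simp add: algebra_simps)
    then have Az: "A *v z = m *\<^sub>R z + e' *\<^sub>R v1 + f' *\<^sub>R v2" unfolding xy z_def by (simp add: algebra_simps)
    consider "e' = 0" "f' = 0" | "e' \<noteq> 0" "f' = 0" | "e' = 0" "f' \<noteq> 0" | "e' \<noteq> 0" "f' \<noteq> 0" by blast
    then show thesis
    proof cases
      case 1
      then show thesis using that[OF iz, of m a b] Az v1 v2 by simp
    next
      case 2
      then have am: "a = m" by (auto simp: e'_def split: if_splits)
      have "indep3 v2 (e' *\<^sub>R v1) z"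
        using indep3_scale[OF indep3_perm(1)[OF indep3_perm(2)[OF indep3_perm(1)[OF iz]]], of 1 e' 1]
          indep3_scale[OF indep3_perm(2)[OF indep3_perm(1)[OF indep3_perm(2)[OF iz]]], of 1 e' 1] 2 by simp
      then show thesis using that[of v2 "e' *\<^sub>R v1" z b m] Az v1 v2 2 am by (simp add: lin add.commute)
    next
      case 3
      then have bm: "b = m" by (auto simp: f'_def split: if_splits)
      have "indep3 v1 (f' *\<^sub>R v2) z"
        using indep3_scale[OF indep3_perm(2)[OF indep3_perm(1)[OF iz]], of 1 f' 1] 3 by simp
      then show thesis using that[of v1 "f' *\<^sub>R v2" z a m] Az v1 v2 3 bm by (simp add: lin add.commute)
    next
      case 4
      then have am: "a = m" "b = m" by (auto simp: e'_def f'_def split: if_splits)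
      \<comment> \<open>All vectors of the plane are eigenvectors for \<open>m\<close>, so the
        remainder \<open>e' v1 + f' v2\<close> can be the start of the chain ending in
        \<open>z\<close>.\<close>
      have "indep3 z v1 (e' *\<^sub>R v1 + f' *\<^sub>R v2)"
        using indep3_comb[OF iz, of 1 f' 0 e' v1 "e' *\<^sub>R v1 + f' *\<^sub>R v2"] 4 by simp
      then have "indep3 v1 (e' *\<^sub>R v1 + f' *\<^sub>R v2) z" by (rule indep3_perm(2)[OF indep3_perm(1)])
      then show thesis using that[of v1 "e' *\<^sub>R v1 + f' *\<^sub>R v2" z m m] Az v1 v2 am by (simp add: lin algebra_simps)
    qed
  next
    assume v1: "A *v v1 = a *\<^sub>R v1" and v2: "A *v v2 = v1 + a *\<^sub>R v2"
    show thesis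
    proof (cases "a = m")
      case False
      define y where "y = f / (m - a)"
      define x where "x = (e + y) / (m - a)"
      define z where "z = u + x *\<^sub>R v1 + y *\<^sub>R v2"
      have iz: "indep3 z v1 v2" unfolding z_def by (rule indep3_shift[OF ind])
      have "x * (m - a) = e + y" "y * (m - a) = f" using False by (simp_all add: x_def y_def)
      then have xy: "e + x * a + y = m * x" "f + y * a = m * y" by (simp_all add: algebra_simps)
      have "A *v z = m *\<^sub>R u + (e + x * a + y) *\<^sub>R v1 + (f + y * a) *\<^sub>R v2"
        unfolding z_def As v1 v2 by (simp add: algebra_simps)
      then have "A *v z = m *\<^sub>R z" unfolding xy z_def by (simp add: algebra_simps)
      then show thesis using that[OF iz, of m a] v1 v2 by simp
    next
      case am: True
      \<comment> \<open>\<open>A - m\<close> sends \<open>v2\<close> to \<open>v1\<close>, so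
        subtracting \<open>e v2\<close> removes the \<open>v1\<close>-component.\<close>
      define z where "z = u + 0 *\<^sub>R v1 + (- e) *\<^sub>R v2"
      have iz: "indep3 z v1 v2" unfolding z_def by (rule indep3_shift[OF ind])
      have Az: "A *v z = m *\<^sub>R z + f *\<^sub>R v2"
        unfolding z_def As v1 v2 by (simp add: am algebra_simps)
      show thesis
      proof (cases "f = 0")
        case True
        then show thesis using that[OF iz, of m a] v1 v2 Az by simp
      next
        case False
        have "indep3 (f *\<^sub>R v1) (f *\<^sub>R v2) z"
          using indep3_scale[OF indep3_perm(2)[OF indep3_perm(1)[OF iz]], of f f 1] False by simp
        then show thesis using that[of "f *\<^sub>R v1" "f *\<^sub>R v2" z m] v1 v2 Az am
          by (simp add: lin algebra_simps)
      qed
    qed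
  next
    assume b: "b \<noteq> 0" and v1: "A *v v1 = a *\<^sub>R v1 - b *\<^sub>R v2" and v2: "A *v v2 = b *\<^sub>R v1 + a *\<^sub>R v2"
    \<comment> \<open>The determinant of \<open>A - m\<close> on the plane, (a - m)^2 + b^2: the
      real number \<open>m\<close> is not an eigenvalue of the complex block, so the shift can
      always be solved for.\<close>
    have "(a - m) * (a - m) - b * (- b) \<noteq> 0"
    proof -
      have "(a - m) * (a - m) \<ge> 0" "b * b > 0" using b by (auto simp: zero_less_mult_iff)
      then show ?thesis by linarith
    qed
    then obtain x y where xy: "- e = (a - m) * x + b * y" "- f = (- b) * x + (a - m) * y"
      using linear_system_2(1)[of "a - m" b "- b" "a - m"] by blast
    define z where "z = u + x *\<^sub>R v1 + y *\<^sub>R v2"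
    have iz: "indep3 z v1 v2" unfolding z_def by (rule indep3_shift[OF ind])
    have xy: "e + x * a + y * b = m * x" "f - x * b + y * a = m * y"
      using xy by (simp_all add: algebra_simps)
    have "A *v z = m *\<^sub>R u + (e + x * a + y * b) *\<^sub>R v1 + (f - x * b + y * a) *\<^sub>R v2"
      unfolding z_def As v1 v2 by (simp add: algebra_simps)
    then have "A *v z = m *\<^sub>R z" unfolding xy z_def by (simp add: algebra_simps)
    then show thesis using that[OF iz, of m a b] v1 v2 b by simp
  qed
qed

section \<open>The algebras of the list\<close>

abbreviation mat2 :: "real \<Rightarrow> real \<Rightarrow> real \<Rightarrow> real \<Rightarrow> real ^ 2 ^ 2" where
  "mat2 a b c d \<equiv> vector [vector [a, b], vector [c, d]]"

abbreviation mat3 :: "real \<Rightarrow> real \<Rightarrow> real \<Rightarrow> real \<Rightarrow> real \<Rightarrow> real \<Rightarrow> real \<Rightarrow> real \<Rightarrow> real \<Rightarrow> real ^ 3 ^ 3" where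
  "mat3 a b c d e f g h i \<equiv> vector [vector [a, b, c], vector [d, e, f], vector [g, h, i]]"

abbreviation "diag2 a b \<equiv> mat2 a 0 0 b"
abbreviation "jordan2 \<equiv> mat2 1 1 0 1"
abbreviation "rot2 l \<equiv> mat2 l 1 (- 1) l"
abbreviation "diag3 a m l \<equiv> mat3 a 0 0 0 m 0 0 0 l"
abbreviation "block2 l \<equiv> mat3 1 0 0 0 l 1 0 0 l"
abbreviation "block3 \<equiv> mat3 1 1 0 0 1 1 0 0 1"
abbreviation "rot3 m l \<equiv> mat3 m 0 0 0 l 1 0 (- 1) l"

fun matrix3 :: "lie3 \<Rightarrow> real ^ 2 ^ 2" where
  "matrix3 R3 = jordan2"
| "matrix3 (R3_lambda l) = diag2 1 l"
| "matrix3 (R3'_lambda l) = rot2 l"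

lemma bracket3_eq: "bracket3 t = sd3 (matrix3 t)"
  by (cases t) (simp_all add: fun_eq_iff gen3_def vec_eq_iff forall_3 ee_def algebra_simps)

lemma bracket4_abelian:
  "bracket4 R4 = sd4 (block3)"
  "bracket4 (R4_lambda l) = sd4 (block2 l)"
  "bracket4 (R4_mu_lambda m l) = sd4 (diag3 1 m l)"
  "bracket4 (R4'_mu_lambda m l) = sd4 (rot3 m l)"
  by (simp_all add: fun_eq_iff gen4_def vec_eq_iff forall_4 ee_def algebra_simps)

lemma bracket4_heisenberg:
  "bracket4 (D4_lambda l) = hs4 (diag2 l (1 - l))"
  "bracket4 (D4'_lambda l) = hs4 (rot2 l)"
  "bracket4 H4 = hs4 (jordan2)"
  by (simp_all add: fun_eq_iff hs4_def gen4_def vec_eq_iff forall_4 ee_def trace_def sum_2 algebra_simps)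

text \<open>No eigenvalue of the matrix, no sum of two and not the sum of all three may vanish. For
  \<open>block2 l\<close> the eigenvalues are 1, l, l; for \<open>rot3 m l\<close> they are m and a
  complex pair with real part l, so that only m, 2 l and m + 2 l are at stake.\<close>

lemma trivial_matrix_abelian:
  "trivial_2_3 (sd4 (block3))"
  "trivial_2_3 (sd4 (block2 l)) \<longleftrightarrow> l \<noteq> - 1 \<and> l \<noteq> - 1/2 \<and> l \<noteq> 0"
  "trivial_2_3 (sd4 (diag3 a m l)) \<longleftrightarrow>
     a \<noteq> 0 \<and> m \<noteq> 0 \<and> l \<noteq> 0 \<and> a + m \<noteq> 0 \<and> a + l \<noteq> 0 \<and> m + l \<noteq> 0 \<and> a + m + l \<noteq> 0"
  "trivial_2_3 (sd4 (rot3 m l)) \<longleftrightarrow> m \<noteq> 0 \<and> l \<noteq> - m/2 \<and> l \<noteq> 0"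
proof -
  have sq: "x * x + y * y = 0 \<longleftrightarrow> x = 0 \<and> y = 0" for x y :: real
    by (simp add: sum_squares_eq_zero_iff)
  show "trivial_2_3 (sd4 (block3))"
    unfolding trivial_sd4 by (simp add: det_3 trace_def sum_3 mat_def)
  have "det (block2 l) = l * l" "trace (block2 l) = 2 * l + 1"
    "det (mat (2 * l + 1) - block2 l) = 2 * l * (l + 1) * (l + 1)"
    by (simp_all add: det_3 trace_def sum_3 mat_def algebra_simps)
  then show "trivial_2_3 (sd4 (block2 l)) \<longleftrightarrow> l \<noteq> - 1 \<and> l \<noteq> - 1/2 \<and> l \<noteq> 0"
    unfolding trivial_sd4 by auto
  have "det (diag3 a m l) = a * m * l" "trace (diag3 a m l) = a + m + l"
    "det (mat (a + m + l) - diag3 a m l) = (m + l) * (a + l) * (a + m)"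
    by (simp_all add: det_3 trace_def sum_3 mat_def)
  then show "trivial_2_3 (sd4 (diag3 a m l)) \<longleftrightarrow>
     a \<noteq> 0 \<and> m \<noteq> 0 \<and> l \<noteq> 0 \<and> a + m \<noteq> 0 \<and> a + l \<noteq> 0 \<and> m + l \<noteq> 0 \<and> a + m + l \<noteq> 0"
    unfolding trivial_sd4 by auto
  have "det (rot3 m l) = m * (l * l + 1 * 1)"
    "trace (rot3 m l) = m + 2 * l"
    "det (mat (m + 2 * l) - rot3 m l) = 2 * l * ((m + l) * (m + l) + 1 * 1)"
    by (simp_all add: det_3 trace_def sum_3 mat_def algebra_simps)
  then show "trivial_2_3 (sd4 (rot3 m l)) \<longleftrightarrow> m \<noteq> 0 \<and> l \<noteq> - m/2 \<and> l \<noteq> 0"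
    unfolding trivial_sd4 using sq[of l 1] sq[of "m + l" 1] by auto
qed

lemma trivial_matrix_heisenberg:
  "trivial_2_3 (hs4 (diag2 a b)) \<longleftrightarrow> a \<noteq> 0 \<and> b \<noteq> 0 \<and> a + b \<noteq> 0 \<and> 2 * a + b \<noteq> 0 \<and> a + 2 * b \<noteq> 0"
  "trivial_2_3 (hs4 (rot2 l)) \<longleftrightarrow> l \<noteq> 0"
  "trivial_2_3 (hs4 (jordan2))"
proof -
  have sq: "x * x + 1 \<noteq> 0" for x :: real
    using zero_le_square[of x] by linarith
  have "det (diag2 a b) = a * b" "trace (diag2 a b) = a + b"
    "det (mat (a + b) + diag2 a b) = (2 * a + b) * (a + 2 * b)"
    by (simp_all add: det_2 trace_def sum_2 mat_def algebra_simps)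
  then show "trivial_2_3 (hs4 (diag2 a b)) \<longleftrightarrow> a \<noteq> 0 \<and> b \<noteq> 0 \<and> a + b \<noteq> 0 \<and> 2 * a + b \<noteq> 0 \<and> a + 2 * b \<noteq> 0"
    unfolding trivial_hs4 by auto
  have "det (rot2 l) = l * l + 1" "trace (rot2 l) = 2 * l"
    "det (mat (2 * l) + rot2 l) = (3 * l) * (3 * l) + 1"
    by (simp_all add: det_2 trace_def sum_2 mat_def algebra_simps)
  then show "trivial_2_3 (hs4 (rot2 l)) \<longleftrightarrow> l \<noteq> 0"
    unfolding trivial_hs4 using sq[of l] sq[of "3 * l"] by auto
  show "trivial_2_3 (hs4 (jordan2))"
    unfolding trivial_hs4 by (simp add: det_2 trace_def sum_2 mat_def)
qed

lemma trivial_matrix_3: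
  "trivial_2_3 (sd3 (diag2 a b)) \<longleftrightarrow> a \<noteq> 0 \<and> b \<noteq> 0 \<and> a + b \<noteq> 0"
  "trivial_2_3 (sd3 (rot2 l)) \<longleftrightarrow> l \<noteq> 0"
  "trivial_2_3 (sd3 (jordan2))"
proof -
  have sq: "l * l + 1 \<noteq> 0" using zero_le_square[of l] by linarith
  show "trivial_2_3 (sd3 (diag2 a b)) \<longleftrightarrow> a \<noteq> 0 \<and> b \<noteq> 0 \<and> a + b \<noteq> 0"
    "trivial_2_3 (sd3 (rot2 l)) \<longleftrightarrow> l \<noteq> 0" "trivial_2_3 (sd3 (jordan2))"
    unfolding trivial_sd3 using sq by (auto simp: det_2 trace_def sum_2)
qed

lemma listed3_trivial:
  assumes "listed3 t" shows "lie_algebra (bracket3 t)" "trivial_2_3 (bracket3 t)"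
proof -
  show "lie_algebra (bracket3 t)" unfolding bracket3_eq by (rule lie_algebra_sd3)
  show "trivial_2_3 (bracket3 t)"
    using assms unfolding bracket3_eq by (cases t) (auto simp: trivial_matrix_3)
qed

lemma listed4_trivial:
  assumes "listed4 t" shows "lie_algebra (bracket4 t)" "trivial_2_3 (bracket4 t)"
proof -
  show "lie_algebra (bracket4 t)"
    by (cases t) (simp_all add: bracket4_abelian bracket4_heisenberg lie_algebra_sd4 lie_algebra_hs4 del: bracket4.simps)
  show "trivial_2_3 (bracket4 t)"
    using assms
    by (cases t) (auto simp: bracket4_abelian bracket4_heisenberg trivial_matrix_abelian
        trivial_matrix_heisenberg param_R_def simp del: bracket4.simps)
qed

section \<open>Each algebra of the three families is in the list\<close>

lemma trivial_2_3_iso: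
  fixes b1 :: "'a::euclidean_space \<Rightarrow> _" and b2 :: "'b::euclidean_space \<Rightarrow> _"
  assumes "lie_isomorphic b1 b2"
  shows "trivial_2_3 b1 \<longleftrightarrow> trivial_2_3 b2"
  unfolding trivial_2_3_iff_euclidean
  using H2_zero_iso[OF assms] H3_zero_iso[OF assms] H2_zero_iso[OF lie_isomorphic_sym[OF assms]]
    H3_zero_iso[OF lie_isomorphic_sym[OF assms]] by blast

text \<open>The imaginary part of a complex pair changes sign when the second vector is negated.
  This freedom lets the parameter be made positive.\<close>

lemma complex_scale:
  assumes "b \<noteq> 0" "a \<noteq> (0::real)"
  obtains e where "e = 1 \<or> e = - 1" "a / (e * b) > 0"
proof (cases "a / b > 0")
  case True
  then show ?thesis using that[of 1] by simp
next
  case False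
  then have "a / b < 0" using assms by (metis divide_eq_0_iff linorder_neqE_linordered_idom)
  then show ?thesis using that[of "- 1"] by simp
qed

lemma classification_3:
  assumes "trivial_2_3 (sd3 B)"
  shows "\<exists>t. listed3 t \<and> lie_isomorphic (bracket3 t) (sd3 B)"
proof -
  obtain v1 v2 a b where ind: "indep2 v1 v2" and nf:
    "B *v v1 = a *\<^sub>R v1 \<and> B *v v2 = b *\<^sub>R v2 \<or> B *v v1 = a *\<^sub>R v1 \<and> B *v v2 = v1 + a *\<^sub>R v2 \<or>
     b \<noteq> 0 \<and> B *v v1 = a *\<^sub>R v1 - b *\<^sub>R v2 \<and> B *v v2 = b *\<^sub>R v1 + a *\<^sub>R v2"
    by (rule plane_normal_form_matrix)
  have triv: "trivial_2_3 (sd3 N)" if "lie_isomorphic (sd3 N) (sd3 B)" for N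
    using trivial_2_3_iso[OF that] assms by simp
  have diag: ?thesis if ind: "indep2 v1 v2" and v: "B *v v1 = a *\<^sub>R v1" "B *v v2 = b *\<^sub>R v2" "\<bar>b\<bar> \<le> \<bar>a\<bar>"
    for v1 v2 a b
  proof -
    have "lie_isomorphic (sd3 (diag2 a b)) (sd3 B)"
      by (rule sd3_basis[OF ind, of 1]) (simp_all add: v)
    from triv[OF this] have ab: "a \<noteq> 0" "b \<noteq> 0" "a + b \<noteq> 0" unfolding trivial_matrix_3 by auto
    \<comment> \<open>Division by the eigenvalue of larger absolute value leaves a ratio between -1
      and 1; the trace excludes -1 and the determinant 0.\<close>
    have "lie_isomorphic (sd3 (diag2 1 (b / a))) (sd3 B)"
      by (rule sd3_basis[OF ind ab(1)]) (simp_all add: v ab)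
    moreover have "listed3 (R3_lambda (b / a))"
      using ab that(4) by (auto simp: field_simps abs_if split: if_splits)
    ultimately show ?thesis by (intro exI[of _ "R3_lambda (b / a)"]) (simp add: bracket3_eq del: bracket3.simps)
  qed
  from nf show ?thesis
  proof (elim disjE conjE)
    assume v: "B *v v1 = a *\<^sub>R v1" "B *v v2 = b *\<^sub>R v2"
    show ?thesis
      using diag[OF ind v] diag[OF indep2_swap[OF ind] v(2,1)] linear[of "\<bar>a\<bar>" "\<bar>b\<bar>"] by blast
  next
    assume v: "B *v v1 = a *\<^sub>R v1" "B *v v2 = v1 + a *\<^sub>R v2"
    have "lie_isomorphic (sd3 (mat2 a 1 0 a)) (sd3 B)"
      by (rule sd3_basis[OF ind, of 1]) (simp_all add: v)
    from triv[OF this] have a: "a \<noteq> 0" unfolding trivial_sd3 by (auto simp: det_2)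
    have "lie_isomorphic (sd3 (jordan2)) (sd3 B)"
      by (rule sd3_basis[OF indep2_scale[OF ind, of "1 / a" 1] a])
        (use a in \<open>simp_all add: v linear_cmul[OF matrix_vector_mul_linear] algebra_simps\<close>)
    then show ?thesis by (intro exI[of _ R3]) (simp add: bracket3_eq del: bracket3.simps)
  next
    assume b: "b \<noteq> 0" and v: "B *v v1 = a *\<^sub>R v1 - b *\<^sub>R v2" "B *v v2 = b *\<^sub>R v1 + a *\<^sub>R v2"
    have "lie_isomorphic (sd3 (mat2 a b (- b) a)) (sd3 B)"
      by (rule sd3_basis[OF ind, of 1]) (simp_all add: v)
    from triv[OF this] have a: "a \<noteq> 0" unfolding trivial_sd3 by (auto simp: trace_def sum_2)
    obtain e where e: "e = 1 \<or> e = - 1" "a / (e * b) > 0" using complex_scale[OF b a] .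
    have "lie_isomorphic (sd3 (rot2 (a / (e * b)))) (sd3 B)"
      by (rule sd3_basis[OF indep2_scale[OF ind, of 1 e], of "e * b"])
        (use b e in \<open>auto simp: v linear_cmul[OF matrix_vector_mul_linear] linear_neg[OF matrix_vector_mul_linear] algebra_simps\<close>)
    then show ?thesis using e(2)
      by (intro exI[of _ "R3'_lambda (a / (e * b))"]) (simp add: bracket3_eq del: bracket3.simps)
  qed
qed

lemma classification_hs4:
  assumes "trivial_2_3 (hs4 B)"
  shows "\<exists>t. listed4 t \<and> lie_isomorphic (bracket4 t) (hs4 B)"
proof -
  obtain v1 v2 a b where ind: "indep2 v1 v2" and nf:
    "B *v v1 = a *\<^sub>R v1 \<and> B *v v2 = b *\<^sub>R v2 \<or> B *v v1 = a *\<^sub>R v1 \<and> B *v v2 = v1 + a *\<^sub>R v2 \<or>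
     b \<noteq> 0 \<and> B *v v1 = a *\<^sub>R v1 - b *\<^sub>R v2 \<and> B *v v2 = b *\<^sub>R v1 + a *\<^sub>R v2"
    by (rule plane_normal_form_matrix)
  have triv: "trivial_2_3 (hs4 N)" if "lie_isomorphic (hs4 N) (hs4 B)" for N
    using trivial_2_3_iso[OF that] assms by simp
  note bsimps = bracket4_heisenberg
  have diag: ?thesis if ind: "indep2 v1 v2" and v: "B *v v1 = a *\<^sub>R v1" "B *v v2 = b *\<^sub>R v2"
    and le: "b / (a + b) \<le> a / (a + b)" for v1 v2 a b
  proof -
    have "lie_isomorphic (hs4 (diag2 a b)) (hs4 B)"
      by (rule hs4_basis[OF ind, of 1]) (simp_all add: v)
    from triv[OF this] have ab: "a \<noteq> 0" "b \<noteq> 0" "a + b \<noteq> 0" unfolding trivial_matrix_heisenberg by auto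
    \<comment> \<open>Rescaling \<open>e1\<close> makes the trace 1, and the order of the
      eigenvalues gives l at least 1/2. At l = 1 the determinant vanishes, at l = 2 the factor
      \<open>a + 2 * b\<close>.\<close>
    define l where "l = a / (a + b)"
    have l: "(a + b) * l = a" "(a + b) * (1 - l) = b" using ab by (simp_all add: l_def field_simps)
    have iso: "lie_isomorphic (hs4 (diag2 l (1 - l))) (hs4 B)"
      by (rule hs4_basis[OF ind ab(3)]) (simp_all add: v l)
    have "b / (a + b) = 1 - l" using ab by (simp add: l_def field_simps)
    then have "l \<ge> 1/2" using le unfolding l_def[symmetric] by simp
    moreover have "l \<noteq> 1" "l \<noteq> 2" using triv[OF iso] unfolding trivial_matrix_heisenberg by auto
    ultimately have "listed4 (D4_lambda l)" by simp
    then show ?thesis using iso by (intro exI[of _ "D4_lambda l"]) (simp add: bsimps del: bracket4.simps)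
  qed
  from nf show ?thesis
  proof (elim disjE conjE)
    assume v: "B *v v1 = a *\<^sub>R v1" "B *v v2 = b *\<^sub>R v2"
    show ?thesis
      using diag[OF ind v] diag[OF indep2_swap[OF ind] v(2,1)] by (metis add.commute linear)
  next
    assume v: "B *v v1 = a *\<^sub>R v1" "B *v v2 = v1 + a *\<^sub>R v2"
    have "lie_isomorphic (hs4 (mat2 a 1 0 a)) (hs4 B)"
      by (rule hs4_basis[OF ind, of 1]) (simp_all add: v)
    from triv[OF this] have a: "a \<noteq> 0" unfolding trivial_hs4 by (auto simp: det_2)
    have "lie_isomorphic (hs4 (jordan2)) (hs4 B)"
      by (rule hs4_basis[OF indep2_scale[OF ind, of "1 / a" 1] a])
        (use a in \<open>simp_all add: v linear_cmul[OF matrix_vector_mul_linear] algebra_simps\<close>)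
    then show ?thesis by (intro exI[of _ H4]) (simp add: bsimps del: bracket4.simps)
  next
    assume b: "b \<noteq> 0" and v: "B *v v1 = a *\<^sub>R v1 - b *\<^sub>R v2" "B *v v2 = b *\<^sub>R v1 + a *\<^sub>R v2"
    have "lie_isomorphic (hs4 (mat2 a b (- b) a)) (hs4 B)"
      by (rule hs4_basis[OF ind, of 1]) (simp_all add: v)
    from triv[OF this] have a: "a \<noteq> 0" unfolding trivial_hs4 by (auto simp: trace_def sum_2)
    obtain e where e: "e = 1 \<or> e = - 1" "a / (e * b) > 0" using complex_scale[OF b a] .
    have "lie_isomorphic (hs4 (rot2 (a / (e * b)))) (hs4 B)"
      by (rule hs4_basis[OF indep2_scale[OF ind, of 1 e], of "e * b"])
        (use b e in \<open>auto simp: v linear_cmul[OF matrix_vector_mul_linear] linear_neg[OF matrix_vector_mul_linear] algebra_simps\<close>)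
    then show ?thesis using e(2)
      by (intro exI[of _ "D4'_lambda (a / (e * b))"]) (simp add: bsimps del: bracket4.simps)
  qed
qed

lemma max_abs_first:
  assumes "P a b c" "\<And>a b c. P a b c \<Longrightarrow> P b a c" "\<And>a b c. P a b c \<Longrightarrow> P a c b"
  shows "\<exists>a b c :: real. P a b c \<and> \<bar>b\<bar> \<le> \<bar>a\<bar> \<and> \<bar>c\<bar> \<le> \<bar>a\<bar>"
proof -
  consider "\<bar>b\<bar> \<le> \<bar>a\<bar> \<and> \<bar>c\<bar> \<le> \<bar>a\<bar>" | "\<bar>a\<bar> \<le> \<bar>b\<bar> \<and> \<bar>c\<bar> \<le> \<bar>b\<bar>" | "\<bar>a\<bar> \<le> \<bar>c\<bar> \<and> \<bar>b\<bar> \<le> \<bar>c\<bar>"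
    by linarith
  then show ?thesis using assms by cases blast+
qed

lemma classification_sd4:
  assumes "trivial_2_3 (sd4 A)"
  shows "\<exists>t. listed4 t \<and> lie_isomorphic (bracket4 t) (sd4 A)"
proof -
  have triv: "trivial_2_3 (sd4 N)" if "lie_isomorphic (sd4 N) (sd4 A)" for N
    using trivial_2_3_iso[OF that] assms by simp
  note bsimps = bracket4_abelian
  note lin = linear_cmul[OF matrix_vector_mul_linear] linear_neg[OF matrix_vector_mul_linear]
  obtain x y z a b c where ind: "indep3 x y z" and nf:
    "A *v x = a *\<^sub>R x \<and> A *v y = b *\<^sub>R y \<and> A *v z = c *\<^sub>R z \<or>
     A *v x = a *\<^sub>R x \<and> A *v y = b *\<^sub>R y \<and> A *v z = y + b *\<^sub>R z \<or>
     A *v x = a *\<^sub>R x \<and> A *v y = x + a *\<^sub>R y \<and> A *v z = y + a *\<^sub>R z \<or>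
     c \<noteq> 0 \<and> A *v x = a *\<^sub>R x \<and> A *v y = b *\<^sub>R y - c *\<^sub>R z \<and> A *v z = c *\<^sub>R y + b *\<^sub>R z"
    by (rule normal_form_3)
  from nf show ?thesis
  proof (elim disjE conjE)
    assume v: "A *v x = a *\<^sub>R x" "A *v y = b *\<^sub>R y" "A *v z = c *\<^sub>R z"
    define P where "P = (\<lambda>a b c. \<exists>x y z. indep3 x y z \<and> A *v x = a *\<^sub>R x \<and> A *v y = b *\<^sub>R y \<and> A *v z = c *\<^sub>R z)"
    have P0: "P a b c" using ind v unfolding P_def by blast
    have P1: "P b a c" if "P a b c" for a b c using that indep3_perm(1) unfolding P_def by blast
    have P2: "P a c b" if "P a b c" for a b c using that indep3_perm(2) unfolding P_def by blast
    \<comment> \<open>\<open>P\<close> is symmetric in the eigenvalues, so the one of largest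
      absolute value may be put first and divided out.\<close>
    obtain a b c where "P a b c" and m: "\<bar>b\<bar> \<le> \<bar>a\<bar>" "\<bar>c\<bar> \<le> \<bar>a\<bar>"
      using max_abs_first[of P, OF P0 P1 P2] by blast
    then obtain x y z where ind: "indep3 x y z" and v: "A *v x = a *\<^sub>R x" "A *v y = b *\<^sub>R y" "A *v z = c *\<^sub>R z"
      unfolding P_def by blast
    have "lie_isomorphic (sd4 (diag3 a b c)) (sd4 A)"
      by (rule sd4_basis[OF ind, of 1]) (simp_all add: v)
    from triv[OF this] have a: "a \<noteq> 0" unfolding trivial_matrix_abelian by auto
    have diag: ?thesis if ind: "indep3 x y z" and v: "A *v y = (a * m) *\<^sub>R y" "A *v z = (a * l) *\<^sub>R z"
      and ml: "m \<le> l" "\<bar>m\<bar> \<le> 1" "\<bar>l\<bar> \<le> 1" for y z m l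
    proof -
      have iso: "lie_isomorphic (sd4 (diag3 1 m l)) (sd4 A)"
        by (rule sd4_basis[OF ind a]) (simp_all add: v \<open>A *v x = a *\<^sub>R x\<close>)
      \<comment> \<open>The sums of 1 with \<open>m\<close> and with \<open>l\<close> exclude the
        endpoint -1; the other conditions are those of \<open>param_R\<close>.\<close>
      have "m \<noteq> 0" "l \<noteq> 0" "1 + m \<noteq> 0" "1 + l \<noteq> 0" "m + l \<noteq> 0" "1 + m + l \<noteq> 0"
        using triv[OF iso] unfolding trivial_matrix_abelian by auto
      then have "listed4 (R4_mu_lambda m l)" using ml by (auto simp: param_R_def abs_le_iff)
      then show ?thesis using iso by (intro exI[of _ "R4_mu_lambda m l"]) (simp add: bsimps del: bracket4.simps)
    qed
    have bc: "a * (b / a) = b" "a * (c / a) = c" "\<bar>b / a\<bar> \<le> 1" "\<bar>c / a\<bar> \<le> 1"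
      using a m by (simp_all add: abs_divide)
    show ?thesis
    proof (cases "b / a \<le> c / a")
      case True
      then show ?thesis by (intro diag[OF ind _ _ True bc(3,4)]) (simp_all only: bc v)
    next
      case False
      then show ?thesis by (intro diag[OF indep3_perm(2)[OF ind] _ _ _ bc(4,3)]) (simp_all add: v a)
    qed
  next
    assume v: "A *v x = a *\<^sub>R x" "A *v y = b *\<^sub>R y" "A *v z = y + b *\<^sub>R z"
    have "lie_isomorphic (sd4 (mat3 a 0 0 0 b 1 0 0 b)) (sd4 A)"
      by (rule sd4_basis[OF ind, of 1]) (simp_all add: v)
    from triv[OF this] have a: "a \<noteq> 0" unfolding trivial_sd4 by (auto simp: det_3)
    have iso: "lie_isomorphic (sd4 (block2 (b / a))) (sd4 A)"
      by (rule sd4_basis[OF indep3_scale[OF ind, of 1 "1 / a" 1] a])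
        (use a in \<open>simp_all add: v lin algebra_simps\<close>)
    from triv[OF iso] have "listed4 (R4_lambda (b / a))" unfolding trivial_matrix_abelian by simp
    then show ?thesis using iso by (intro exI[of _ "R4_lambda (b / a)"]) (simp add: bsimps del: bracket4.simps)
  next
    assume v: "A *v x = a *\<^sub>R x" "A *v y = x + a *\<^sub>R y" "A *v z = y + a *\<^sub>R z"
    have "lie_isomorphic (sd4 (mat3 a 1 0 0 a 1 0 0 a)) (sd4 A)"
      by (rule sd4_basis[OF ind, of 1]) (simp_all add: v)
    from triv[OF this] have a: "a \<noteq> 0" unfolding trivial_sd4 by (auto simp: det_3)
    \<comment> \<open>After division by \<open>a\<close> the powers of \<open>1 / a\<close> restore
      the entries 1 along the Jordan chain.\<close>
    have "lie_isomorphic (sd4 (block3)) (sd4 A)"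
      by (rule sd4_basis[OF indep3_scale[OF ind, of "1 / (a * a)" "1 / a" 1] a])
        (use a in \<open>simp_all add: v lin algebra_simps\<close>)
    then show ?thesis by (intro exI[of _ R4]) (simp add: bsimps del: bracket4.simps)
  next
    assume c: "c \<noteq> 0" and v: "A *v x = a *\<^sub>R x" "A *v y = b *\<^sub>R y - c *\<^sub>R z" "A *v z = c *\<^sub>R y + b *\<^sub>R z"
    have "lie_isomorphic (sd4 (mat3 a 0 0 0 b c 0 (- c) b)) (sd4 A)"
      by (rule sd4_basis[OF ind, of 1]) (simp_all add: v)
    from triv[OF this] have a: "a \<noteq> 0" unfolding trivial_sd4 by (auto simp: det_3)
    obtain e where e: "e = 1 \<or> e = - 1" "a / (e * c) > 0" using complex_scale[OF c a] .
    let ?m = "a / (e * c)" and ?l = "b / (e * c)"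
    have iso: "lie_isomorphic (sd4 (rot3 ?m ?l)) (sd4 A)"
      by (rule sd4_basis[OF indep3_scale[OF ind, of 1 1 e], of "e * c"])
        (use c e in \<open>auto simp: v lin algebra_simps\<close>)
    from triv[OF iso] have "listed4 (R4'_mu_lambda ?m ?l)" using e(2) unfolding trivial_matrix_abelian by simp
    then show ?thesis using iso by (intro exI[of _ "R4'_mu_lambda ?m ?l"]) (simp add: bsimps del: bracket4.simps)
  qed
qed

section \<open>Isomorphisms between semidirect products\<close>

lemma intertwine_diff_mat:
  fixes P A C :: "real ^ 'n ^ 'n"
  assumes "P ** A = C ** P"
  shows "P ** (A - mat x) = (C - mat x) ** P"
proof -
  have "(P ** (A - mat x)) $ i $ j = (P ** A) $ i $ j - (P ** mat x) $ i $ j"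
    "((C - mat x) ** P) $ i $ j = (C ** P) $ i $ j - (mat x ** P) $ i $ j" for i j
    by (simp_all add: matrix_matrix_mult_def algebra_simps sum_subtractf)
  moreover have "P ** mat x = mat x ** P"
    by (simp add: vec_eq_iff matrix_matrix_mult_def mat_def if_distrib if_distribR cong: if_cong)
  ultimately show ?thesis using assms by (simp add: vec_eq_iff)
qed

lemma det_intertwine:
  fixes P A C :: "real ^ 'n ^ 'n"
  assumes "det P \<noteq> 0" "P ** A = C ** P"
  shows "det (A - mat x) = det (C - mat x)"
proof -
  have "det P * det (A - mat x) = det (C - mat x) * det P"
    unfolding det_mul[symmetric] intertwine_diff_mat[OF assms(2)] ..
  then show ?thesis using assms(1) by simp
qed

text \<open>A quadratic polynomial annihilating one matrix is carried over to the other. This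
  separates Jordan types with the same characteristic polynomial.\<close>

lemma product_intertwine:
  fixes P A C :: "real ^ 'n ^ 'n"
  assumes "det P \<noteq> 0" "P ** A = C ** P" "(C - mat x) ** (C - mat y) = 0"
  shows "(A - mat x) ** (A - mat y) = 0"
proof -
  note PA = intertwine_diff_mat[OF assms(2)]
  have "P ** ((A - mat x) ** (A - mat y)) = (C - mat x) ** (C - mat y) ** P"
    by (simp add: matrix_mul_assoc PA) (simp add: PA flip: matrix_mul_assoc)
  then have P0: "P ** ((A - mat x) ** (A - mat y)) = 0" using assms(3) by simp
  obtain Q where "Q ** P = mat 1" using assms(1) unfolding invertible_det_nz[symmetric] invertible_left_inverse by blast
  then have "(A - mat x) ** (A - mat y) = Q ** (P ** ((A - mat x) ** (A - mat y)))"
    by (simp add: matrix_mul_assoc)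
  then show ?thesis unfolding P0 by simp
qed

lemma scalar_intertwine:
  fixes P A C :: "real ^ 'n ^ 'n"
  assumes "det P \<noteq> 0" "P ** A = C ** P" "C = mat x"
  shows "A = mat x"
proof -
  obtain Q where Q: "Q ** P = mat 1"
    using assms(1) unfolding invertible_det_nz[symmetric] invertible_left_inverse by blast
  have "Q ** P ** (A - mat x) = 0"
    unfolding matrix_mul_assoc[symmetric] intertwine_diff_mat[OF assms(2)] by (simp add: assms(3))
  then show ?thesis unfolding Q by simp
qed

text \<open>By \<open>d1\<close> the hyperplane of vanishing \<open>i\<close>-th coordinate consists
  of sums of brackets, so an isomorphism keeps it and acts on the quotient line by a nonzero factor.
  Two brackets are allowed because the Heisenberg case needs one for the plane and one for the
  centre.\<close>

lemma iso_derived: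
  fixes b1 b2 :: "real ^ 'n \<Rightarrow> real ^ 'n \<Rightarrow> real ^ 'n"
  assumes f: "linear f" "bij f" "\<And>x y. f (b1 x y) = b2 (f x) (f y)"
    and d1: "\<forall>x. x $ i = 0 \<longrightarrow> (\<exists>y y' z z'. x = b1 y y' + b1 z z')"
    and d2: "\<And>x y. b2 x y $ i = 0"
  shows "x $ i = 0 \<Longrightarrow> f x $ i = 0" "f x $ i = x $ i * f (ev i) $ i" "f (ev i) $ i \<noteq> 0"
proof -
  show 1: "f x $ i = 0" if "x $ i = 0" for x
    using d1[rule_format, OF that] d2 by (auto simp: linear_add[OF f(1)] f(3))
  show 2: "f x $ i = x $ i * f (ev i) $ i" for x
  proof -
    have "(x - x $ i *\<^sub>R ev i) $ i = 0" by (simp add: axis_def)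
    from 1[OF this] show ?thesis by (simp add: linear_diff[OF f(1)] linear_cmul[OF f(1)])
  qed
  obtain x where "f x = ev i" using surjD[OF bij_is_surj[OF f(2)], of "ev i"] by metis
  then show "f (ev i) $ i \<noteq> 0" using 2[of x] by (auto simp: axis_def)
qed

lemma sd3_derived:
  assumes "det B \<noteq> 0"
  shows "\<forall>x. x $ 1 = 0 \<longrightarrow> (\<exists>y y' z z'. x = sd3 B y y' + sd3 B z z')"
proof (intro allI impI)
  fix x :: "real ^ 3" assume x: "x $ 1 = 0"
  obtain u where u: "B *v u = vector [x$2, x$3]" using assms(1) unfolding det_nz_iff_surj by blast
  have "x = sd3 B (ev 1) (vector [0, u$1, u$2]) + sd3 B 0 0"
    using u x unfolding matrix_vector_2
    by (simp add: gen3_def vec_eq_iff forall_3 forall_2 ee_def axis_def)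
  then show "\<exists>y y' z z'. x = sd3 B y y' + sd3 B z z'" by blast
qed

lemma sd4_derived:
  assumes "det A \<noteq> 0"
  shows "\<forall>x. x $ 1 = 0 \<longrightarrow> (\<exists>y y' z z'. x = sd4 A y y' + sd4 A z z')"
proof (intro allI impI)
  fix x :: "real ^ 4" assume x: "x $ 1 = 0"
  obtain u where u: "A *v u = vector [x$2, x$3, x$4]" using assms(1) unfolding det_nz_iff_surj by blast
  have "x = sd4 A (ev 1) (vector [0, u$1, u$2, u$3]) + sd4 A 0 0"
    using u x unfolding matrix_vector_3
    by (simp add: gen4_def vec_eq_iff forall_3 forall_4 ee_def axis_def)
  then show "\<exists>y y' z z'. x = sd4 A y y' + sd4 A z z'" by blast
qed

lemma hs4_derived:
  assumes "det B \<noteq> 0"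
  shows "\<forall>x. x $ 1 = 0 \<longrightarrow> (\<exists>y y' z z'. x = hs4 B y y' + hs4 B z z')"
proof (intro allI impI)
  fix x :: "real ^ 4" assume x: "x $ 1 = 0"
  obtain u where u: "B *v u = vector [x$2, x$3]" using assms(1) unfolding det_nz_iff_surj by blast
  have "x = hs4 B (ev 1) (vector [0, u$1, u$2, 0]) + hs4 B (x$4 *\<^sub>R ev 2) (ev 3)"
    using u x unfolding matrix_vector_2
    by (simp add: hs4_def gen4_def vec_eq_iff forall_2 forall_4 ee_def axis_def)
  then show "\<exists>y y' z z'. x = hs4 B y y' + hs4 B z z'" by blast
qed

lemma gen_nth_1: "gen3 B m x y $ 1 = 0" "gen4 A M u v $ 1 = 0" "hs4 N u v $ 1 = 0"
  by (simp_all add: gen3_def gen4_def hs4_def)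

text \<open>\<open>P\<close> is the isomorphism on the derived algebra and \<open>c\<close> its
  factor on the quotient line. As the ideal is abelian, the image of \<open>e1\<close> acts on it by
  \<open>c\<close> times \<open>B'\<close>, whatever its other components.\<close>

lemma sd3_isoD:
  assumes "lie_isomorphic (sd3 B) (sd3 B')" "det B \<noteq> 0"
  shows "\<exists>P c. c \<noteq> 0 \<and> det P \<noteq> 0 \<and> P ** B = (c *\<^sub>R B') ** P"
proof -
  obtain f where f: "linear f" "bij f" "\<And>x y. f (sd3 B x y) = sd3 B' (f x) (f y)"
    using assms(1) unfolding lie_isomorphic_def by blast
  note der = iso_derived[OF f sd3_derived[OF assms(2)] gen_nth_1(1)]
  define c where "c = f (ev 1) $ 1"
  define P where "P = mat2 (f (ev 2) $ 2) (f (ev 3) $ 2) (f (ev 2) $ 3) (f (ev 3) $ 3)"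
  have k: "f (ev 2) $ 1 = 0" "f (ev 3) $ 1 = 0" by (rule der(1), simp add: axis_def)+
  have expand: "f (vector [0, a, b]) = a *\<^sub>R f (ev 2) + b *\<^sub>R f (ev 3)" for a b
  proof -
    have "(vector [0, a, b] :: real ^ 3) = a *\<^sub>R ev 2 + b *\<^sub>R ev 3"
      unfolding vec_eq_iff forall_3 by (simp add: axis_def)
    then show ?thesis by (simp add: linear_add[OF f(1)] linear_cmul[OF f(1)])
  qed
  have "det P \<noteq> 0" unfolding det_nz_iff_inj
  proof (intro allI impI)
    fix v assume "P *v v = 0"
    then have "f (vector [0, v$1, v$2]) = f 0"
      unfolding expand matrix_vector_2
      by (simp add: P_def vec_eq_iff forall_2 forall_3 k linear_0[OF f(1)] mult.commute)
    then have "vector [0, v$1, v$2] = (0 :: real ^ 3)" using f(2) by (simp add: bij_is_inj inj_eq)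
    then show "v = 0" by (simp add: vec_eq_iff forall_2 forall_3)
  qed
  moreover have "P ** B = (c *\<^sub>R B') ** P"
    using f(3)[of "ev 1" "ev 2"] f(3)[of "ev 1" "ev 3"] unfolding gen3_axis expand
    by (simp add: gen3_def ee_def k c_def[symmetric] vec_eq_iff forall_3 forall_2
        matrix_matrix_mult_def sum_2 P_def algebra_simps)
  ultimately show ?thesis using der(3) unfolding c_def by blast
qed

lemma sd4_isoD:
  assumes "lie_isomorphic (sd4 A) (sd4 A')" "det A \<noteq> 0"
  shows "\<exists>P c. c \<noteq> 0 \<and> det P \<noteq> 0 \<and> P ** A = (c *\<^sub>R A') ** P"
proof -
  obtain f where f: "linear f" "bij f" "\<And>x y. f (sd4 A x y) = sd4 A' (f x) (f y)"
    using assms(1) unfolding lie_isomorphic_def by blast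
  note der = iso_derived[OF f sd4_derived[OF assms(2)] gen_nth_1(2)]
  define c where "c = f (ev 1) $ 1"
  define P where "P = mat3 (f (ev 2) $ 2) (f (ev 3) $ 2) (f (ev 4) $ 2)
     (f (ev 2) $ 3) (f (ev 3) $ 3) (f (ev 4) $ 3) (f (ev 2) $ 4) (f (ev 3) $ 4) (f (ev 4) $ 4)"
  have k: "f (ev 2) $ 1 = 0" "f (ev 3) $ 1 = 0" "f (ev 4) $ 1 = 0" by (rule der(1), simp add: axis_def)+
  have expand: "f (vector [0, a, b, d]) = a *\<^sub>R f (ev 2) + b *\<^sub>R f (ev 3) + d *\<^sub>R f (ev 4)" for a b d
  proof -
    have "(vector [0, a, b, d] :: real ^ 4) = a *\<^sub>R ev 2 + b *\<^sub>R ev 3 + d *\<^sub>R ev 4"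
      unfolding vec_eq_iff forall_4 by (simp add: axis_def)
    then show ?thesis by (simp add: linear_add[OF f(1)] linear_cmul[OF f(1)])
  qed
  have "det P \<noteq> 0" unfolding det_nz_iff_inj
  proof (intro allI impI)
    fix v assume "P *v v = 0"
    then have "f (vector [0, v$1, v$2, v$3]) = f 0"
      unfolding expand matrix_vector_3
      by (simp add: P_def vec_eq_iff forall_3 forall_4 k linear_0[OF f(1)] mult.commute)
    then have "vector [0, v$1, v$2, v$3] = (0 :: real ^ 4)" using f(2) by (simp add: bij_is_inj inj_eq)
    then show "v = 0" by (simp add: vec_eq_iff forall_3 forall_4)
  qed
  moreover have "P ** A = (c *\<^sub>R A') ** P"
    using f(3)[of "ev 1" "ev 2"] f(3)[of "ev 1" "ev 3"] f(3)[of "ev 1" "ev 4"] unfolding gen4_axis expand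
    by (simp add: gen4_def ee_def k c_def[symmetric] vec_eq_iff forall_3 forall_4
        matrix_matrix_mult_def sum_3 P_def algebra_simps)
  ultimately show ?thesis using der(3) unfolding c_def by blast
qed

text \<open>Here \<open>P\<close> is induced on the derived algebra modulo its centre, where the
  ideal components of the image of \<open>e1\<close> act trivially.\<close>

lemma hs4_isoD:
  assumes "lie_isomorphic (hs4 B) (hs4 B')" "det B \<noteq> 0"
  shows "\<exists>P c. c \<noteq> 0 \<and> det P \<noteq> 0 \<and> P ** B = (c *\<^sub>R B') ** P"
proof -
  obtain f where f: "linear f" "bij f" "\<And>x y. f (hs4 B x y) = hs4 B' (f x) (f y)"
    using assms(1) unfolding lie_isomorphic_def by blast
  note der = iso_derived[OF f hs4_derived[OF assms(2)] gen_nth_1(3)]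
  define c where "c = f (ev 1) $ 1"
  define P where "P = mat2 (f (ev 2) $ 2) (f (ev 3) $ 2) (f (ev 2) $ 3) (f (ev 3) $ 3)"
  have k: "f (ev 2) $ 1 = 0" "f (ev 3) $ 1 = 0" "f (ev 4) $ 1 = 0" by (rule der(1), simp add: axis_def)+
  have v4: "vector [0, 0, 0, a] = a *\<^sub>R (ev 4 :: real ^ 4)" for a
    unfolding vec_eq_iff forall_4 by (simp add: axis_def)
  have expand: "f (vector [0, a, b, 0]) = a *\<^sub>R f (ev 2) + b *\<^sub>R f (ev 3)" for a b
  proof -
    have "(vector [0, a, b, 0] :: real ^ 4) = a *\<^sub>R ev 2 + b *\<^sub>R ev 3"
      unfolding vec_eq_iff forall_4 by (simp add: axis_def)
    then show ?thesis by (simp add: linear_add[OF f(1)] linear_cmul[OF f(1)])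
  qed
  \<comment> \<open>\<open>ev 4\<close> is a bracket of two elements of the derived algebra, and
    such brackets are central.\<close>
  have z: "f (ev 4) $ 2 = 0" "f (ev 4) $ 3 = 0"
    using f(3)[of "ev 2" "ev 3"] unfolding hs4_axis v4
    by (simp_all add: hs4_def gen4_def ee_def k vec_eq_iff forall_4)
  have z4: "f (ev 4) $ 4 \<noteq> 0"
  proof
    assume "f (ev 4) $ 4 = 0"
    then have "f (ev 4) = f 0" using z k by (simp add: vec_eq_iff forall_4 linear_0[OF f(1)])
    then have "ev 4 = (0 :: real ^ 4)" using f(2) by (simp add: bij_is_inj inj_eq)
    then show False by (simp add: axis_eq_0_iff)
  qed
  have "det P \<noteq> 0" unfolding det_nz_iff_inj
  proof (intro allI impI)
    fix v assume v: "P *v v = 0"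
    \<comment> \<open>If \<open>P\<close> kills \<open>v\<close>, the image of \<open>v\<close> is
      central; it is matched with the image of \<open>w\<close> times \<open>ev 4\<close>, and
      injectivity of \<open>f\<close> leaves \<open>v = 0\<close>.\<close>
    define w where "w = (v$1 * f (ev 2) $ 4 + v$2 * f (ev 3) $ 4) / f (ev 4) $ 4"
    have w: "w * f (ev 4) $ 4 = v$1 * f (ev 2) $ 4 + v$2 * f (ev 3) $ 4" using z4 by (simp add: w_def)
    have "f (vector [0, v$1, v$2, 0]) = w *\<^sub>R f (ev 4)"
      using v w unfolding expand matrix_vector_2
      by (simp add: P_def vec_eq_iff forall_2 forall_4 k z mult.commute)
    then have "f (vector [0, v$1, v$2, 0]) = f (vector [0, 0, 0, w])"
      by (simp add: v4 linear_cmul[OF f(1)])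
    then have "vector [0, v$1, v$2, 0] = (vector [0, 0, 0, w] :: real ^ 4)"
      using f(2) by (simp add: bij_is_inj inj_eq)
    then show "v = 0" by (simp add: vec_eq_iff forall_2 forall_4)
  qed
  moreover have "P ** B = (c *\<^sub>R B') ** P"
    using f(3)[of "ev 1" "ev 2"] f(3)[of "ev 1" "ev 3"] unfolding hs4_axis expand
    by (simp add: hs4_def gen4_def ee_def k c_def[symmetric] vec_eq_iff forall_4 forall_2
        matrix_matrix_mult_def sum_2 P_def algebra_simps)
  ultimately show ?thesis using der(3) unfolding c_def by blast
qed

text \<open>The derived algebra is abelian on one side only: \<open>ev 2\<close> and
  \<open>ev 3\<close> have a nonzero bracket in the Heisenberg ideal, but their preimages lie in an
  abelian one.\<close>

lemma sd4_not_hs4: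
  assumes "det A \<noteq> 0" shows "\<not> lie_isomorphic (sd4 A) (hs4 B)"
proof
  assume "lie_isomorphic (sd4 A) (hs4 B)"
  then obtain f where f: "linear f" "bij f" "\<And>x y. f (sd4 A x y) = hs4 B (f x) (f y)"
    unfolding lie_isomorphic_def by blast
  note der = iso_derived[OF f sd4_derived[OF assms] gen_nth_1(3)]
  obtain x y where xy: "ev 2 = f x" "ev 3 = f y" using surjD[OF bij_is_surj[OF f(2)]] by metis
  have "x $ 1 = 0" "y $ 1 = 0"
    using der(2)[of x] der(2)[of y] der(3) unfolding xy[symmetric] by (simp_all add: axis_def)
  then have "sd4 A x y = 0" by (simp add: gen4_def ee_def vec_eq_iff forall_4)
  then have "hs4 B (ev 2) (ev 3) = 0" using f(3)[of x y] linear_0[OF f(1)] by (simp add: xy)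
  then show False unfolding hs4_axis by (simp add: vec_eq_iff forall_4)
qed

section \<open>Similarity up to a scalar and its invariants\<close>

definition scaled_similar :: "real ^ 'n ^ 'n \<Rightarrow> real \<Rightarrow> real ^ 'n ^ 'n \<Rightarrow> bool" where
  "scaled_similar A c C \<longleftrightarrow> c \<noteq> 0 \<and> (\<exists>P. det P \<noteq> 0 \<and> P ** A = (c *\<^sub>R C) ** P)"

lemma scaled_similar_det: "scaled_similar A c C \<Longrightarrow> det (A - mat x) = det (c *\<^sub>R C - mat x)"
  unfolding scaled_similar_def using det_intertwine by blast

lemma scaled_similar_scalar: "scaled_similar A c C \<Longrightarrow> c *\<^sub>R C = mat x \<Longrightarrow> A = mat x"
  unfolding scaled_similar_def using scalar_intertwine by blast

lemma scaled_similar_product: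
  "scaled_similar A c C \<Longrightarrow> (c *\<^sub>R C - mat x) ** (c *\<^sub>R C - mat y) = 0 \<Longrightarrow>
    (A - mat x) ** (A - mat y) = 0"
  unfolding scaled_similar_def using product_intertwine by blast

lemma scaled_similar_2:
  fixes B C :: "real ^ 2 ^ 2"
  assumes "scaled_similar B c C"
  shows "trace B = c * trace C" "det B = c * c * det C"
proof -
  \<comment> \<open>Two values of the characteristic polynomial determine determinant and
    trace.\<close>
  have "det (B - mat 0) = det (c *\<^sub>R C - mat 0)" "det (B - mat 1) = det (c *\<^sub>R C - mat 1)"
    by (rule scaled_similar_det[OF assms])+
  then show "trace B = c * trace C" "det B = c * c * det C"
    by (simp_all add: det_2 trace_def sum_2 mat_def algebra_simps)
qed

text \<open>Sum 2 and product 1 force both scaled eigenvalues to be 1, so the diagonal matrix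
  becomes scalar, and a scalar matrix is similar only to itself.\<close>

lemma jordan_not_similar_diagonal: "\<not> scaled_similar (jordan2) c (diag2 a b)"
proof
  assume s: "scaled_similar (jordan2) c (diag2 a b)"
  have "c * a + c * b = 2" "(c * a) * (c * b) = 1"
    using scaled_similar_2[OF s] by (simp_all add: det_2 trace_def sum_2 algebra_simps)
  moreover have "X = 1" if "X + Y = 2" "X * Y = 1" for X Y :: real
  proof -
    have "(X - 1)^2 = X * (X + Y) - X * Y - 2 * X + 1" by (simp add: power2_eq_square algebra_simps)
    then show ?thesis using that by simp
  qed
  ultimately have "c * a = 1" "c * b = 1" by (metis, metis add.commute mult.commute)
  then have "c *\<^sub>R diag2 a b = mat 1" by (simp add: vec_eq_iff forall_2 mat_def)
  from scaled_similar_scalar[OF s this] show False by (simp add: vec_eq_iff forall_2 mat_def)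
qed

text \<open>The quantity tr^2 - 4 det is multiplied by a positive number; it is zero for a Jordan
  block, nonnegative for a diagonal matrix and -4 for \<open>rot2 l\<close>.\<close>

lemma jordan_not_similar_rotation: "\<not> scaled_similar (jordan2) c (rot2 l)"
proof
  assume s: "scaled_similar (jordan2) c (rot2 l)"
  have "1 = c * l" "1 = c * c * (l * l + 1)"
    using scaled_similar_2[OF s] by (simp_all add: det_2 trace_def sum_2 algebra_simps)
  then have "c ^ 2 = 0" by algebra
  then show False using s by (simp add: scaled_similar_def)
qed

lemma diagonal_not_similar_rotation: "\<not> scaled_similar (diag2 a b) c (rot2 l)"
proof
  assume s: "scaled_similar (diag2 a b) c (rot2 l)"
  have "a + b = 2 * c * l" "a * b = c * c * (l * l + 1)"
    using scaled_similar_2[OF s] by (simp_all add: det_2 trace_def sum_2 algebra_simps)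
  then have "(a - b) ^ 2 + (2 * c) ^ 2 = 0" by algebra
  then have "2 * c = 0" unfolding sum_power2_eq_zero_iff by blast
  then show False using s by (simp add: scaled_similar_def)
qed

lemma rotation_similar_eq:
  assumes s: "scaled_similar (rot2 l) c (rot2 k)" and pos: "l > 0" "k > 0"
  shows "l = k"
proof -
  have e: "l = c * k" "l * l + 1 = c * c * (k * k + 1)"
    using scaled_similar_2[OF s] by (simp_all add: det_2 trace_def sum_2 algebra_simps)
  then have "c ^ 2 = 1" by algebra
  moreover have "c > 0" using e(1) pos by (simp add: zero_less_mult_iff)
  ultimately show ?thesis using e(1) by (simp add: power2_eq_1_iff)
qed

text \<open>Eliminating \<open>c\<close> via the scale invariant tr^2 / det leaves
  \<open>l = k\<close> or \<open>l k = 1\<close>, and parameters in the half-open interval satisfy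
  the latter only when both are 1.\<close>

lemma diagonal_similar_eq_3:
  assumes s: "scaled_similar (diag2 1 l) c (diag2 1 k)"
    and "l \<in> {-1<..1} - {0}" "k \<in> {-1<..1} - {0}"
  shows "l = k"
proof -
  have e: "1 + l = c * (1 + k)" "l = c * c * k"
    using scaled_similar_2[OF s] by (simp_all add: det_2 trace_def sum_2 algebra_simps)
  then have "(l - k) * (1 - l * k) = 0" by algebra
  moreover have "l = k" if "l * k = 1"
  proof -
    have "\<bar>l\<bar> * \<bar>k\<bar> = 1" using that by (metis abs_mult abs_one)
    moreover have "\<bar>l\<bar> \<le> 1" "\<bar>k\<bar> \<le> 1" using assms by auto
    ultimately have "\<bar>l\<bar> = 1" "\<bar>k\<bar> = 1"
      using mult_left_le[of "\<bar>k\<bar>" "\<bar>l\<bar>"] mult_left_le[of "\<bar>l\<bar>" "\<bar>k\<bar>"] by (simp_all add: mult.commute)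
    then show ?thesis using assms by (auto simp: abs_if split: if_splits)
  qed
  ultimately show ?thesis by auto
qed

lemma diagonal_similar_eq_4:
  assumes s: "scaled_similar (diag2 l (1 - l)) c (diag2 k (1 - k))" and "l \<ge> 1/2" "k \<ge> 1/2"
  shows "l = k"
proof -
  have e: "1 = c" "l * (1 - l) = c * c * (k * (1 - k))"
    using scaled_similar_2[OF s] by (simp_all add: det_2 trace_def sum_2 algebra_simps)
  then have "l * (1 - l) = k * (1 - k)" by simp
  then have "(l - k) * (1 - l - k) = 0" by algebra
  then show ?thesis using assms(2,3) by auto
qed

lemma charpoly_3:
  "det (c *\<^sub>R block3 - mat x) = (c - x) * (c - x) * (c - x)"
  "det (c *\<^sub>R block2 l - mat x) = (c - x) * (c * l - x) * (c * l - x)"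
  "det (c *\<^sub>R diag3 1 m l - mat x) = (c - x) * (c * m - x) * (c * l - x)"
  "det (c *\<^sub>R rot3 m l - mat x) = (c * m - x) * ((c * l - x)^2 + c^2)"
  by (simp_all add: det_3 mat_def power2_eq_square algebra_simps)

lemmas charpoly_3_1 = charpoly_3[where c = 1, simplified]

lemma block3_not_similar_diagonal: "\<not> scaled_similar (block3) c (diag3 1 m l)"
proof
  assume s: "scaled_similar (block3) c (diag3 1 m l)"
  have p: "(1 - x) * (1 - x) * (1 - x) = (c - x) * (c * m - x) * (c * l - x)" for x
    using scaled_similar_det[OF s, of x] unfolding charpoly_3 charpoly_3_1 by simp
  have "c = 1" "c * m = 1" "c * l = 1" using p[of c] p[of "c * m"] p[of "c * l"] by auto
  then have "c *\<^sub>R diag3 1 m l = mat 1" by (simp add: vec_eq_iff forall_3 mat_def)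
  from scaled_similar_scalar[OF s this] show False by (simp add: vec_eq_iff forall_3 mat_def)
qed

text \<open>The diagonal matrix has its eigenvalues in {1, k}, so it is annihilated by (X - 1)(X -
  k). The block is annihilated only if k = 1, and then the diagonal matrix is scalar.\<close>

lemma block2_not_similar_diagonal: "\<not> scaled_similar (block2 k) c (diag3 1 m l)"
proof
  assume s: "scaled_similar (block2 k) c (diag3 1 m l)"
  have p: "(1 - x) * (k - x) * (k - x) = (c - x) * (c * m - x) * (c * l - x)" for x
    using scaled_similar_det[OF s, of x] unfolding charpoly_3 charpoly_3_1 by simp
  have r: "c = 1 \<or> c = k" "c * m = 1 \<or> c * m = k" "c * l = 1 \<or> c * l = k"
    using p[of c] p[of "c * m"] p[of "c * l"] by auto
  then have "(c *\<^sub>R diag3 1 m l - mat 1) ** (c *\<^sub>R diag3 1 m l - mat k) = 0"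
    by (auto simp: vec_eq_iff forall_3 mat_def matrix_matrix_mult_def sum_3)
  from scaled_similar_product[OF s this] have k: "k = 1"
    by (simp add: vec_eq_iff forall_3 mat_def matrix_matrix_mult_def sum_3)
  then have "c *\<^sub>R diag3 1 m l = mat 1" using r by (simp add: vec_eq_iff forall_3 mat_def)
  from scaled_similar_scalar[OF s this] show False by (simp add: vec_eq_iff forall_3 mat_def)
qed

lemma block3_not_similar_block2: "\<not> scaled_similar (block3) c (block2 l)"
proof
  assume s: "scaled_similar (block3) c (block2 l)"
  have p: "(1 - x) * (1 - x) * (1 - x) = (c - x) * (c * l - x) * (c * l - x)" for x
    using scaled_similar_det[OF s, of x] unfolding charpoly_3 charpoly_3_1 by simp
  have "c = 1" "c * l = 1" using p[of c] p[of "c * l"] by auto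
  then have "(c *\<^sub>R block2 l - mat 1) ** (c *\<^sub>R block2 l - mat 1) = 0"
    by (simp add: vec_eq_iff forall_3 mat_def matrix_matrix_mult_def sum_3)
  from scaled_similar_product[OF s this] show False
    by (simp add: vec_eq_iff forall_3 mat_def matrix_matrix_mult_def sum_3)
qed

text \<open>The root 1 is either the scaled simple root \<open>c\<close> or the scaled double root
  \<open>c l\<close>. In the second case the values at 0 and 2 force
  \<open>k = c = 1\<close>.\<close>

lemma block2_similar_eq:
  assumes s: "scaled_similar (block2 k) c (block2 l)"
  shows "k = l"
proof -
  have p: "(1 - x) * (k - x) * (k - x) = (c - x) * (c * l - x) * (c * l - x)" for x
    using scaled_similar_det[OF s, of x] unfolding charpoly_3 charpoly_3_1 by simp
  have "c = 1 \<or> c * l = 1" using p[of 1] by auto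
  then show ?thesis
  proof
    assume "c = 1"
    then show ?thesis using p[of 0] p[of 2] by simp (simp add: algebra_simps)
  next
    assume cl: "c * l = 1"
    then have "c = k * k" "- ((k - 2) * (k - 2)) = c - 2"
      using p[of 0] p[of 2] by (simp_all add: algebra_simps)
    then have "(k - 1)^2 = 0" by algebra
    then have "k = 1" by simp
    then show ?thesis using cl \<open>c = k * k\<close> by simp
  qed
qed

text \<open>The quadratic factor has no real root, so all roots on the right equal \<open>m\<close>.
  The values at \<open>m - 1\<close> and \<open>m + 1\<close> then give \<open>l\<close> two
  different values.\<close>

lemma complex_not_split:
  assumes "\<And>x::real. (m - x) * ((l - x)^2 + 1) = (a - x) * (b - x) * (d - x)"
  shows False
proof -
  have q: "(l - x)^2 + 1 \<noteq> 0" for x using zero_le_power2[of "l - x"] by linarith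
  have "a = m" "b = m" "d = m" using assms[of a] assms[of b] assms[of d] q by auto
  then have "(l - (m - 1))^2 = 0" "(l - (m + 1))^2 = 0" using assms[of "m - 1"] assms[of "m + 1"] by simp_all
  then show False by simp
qed

lemma complex_not_similar:
  "\<not> scaled_similar (rot3 m l) c (block3)"
  "\<not> scaled_similar (rot3 m l) c (block2 a)"
  "\<not> scaled_similar (rot3 m l) c (diag3 1 a b)"
proof -
  have no: "\<not> scaled_similar (rot3 m l) c C"
    if "\<And>x. det (c *\<^sub>R C - mat x) = (p - x) * (q - x) * (r - x)" for C p q r
  proof
    assume s: "scaled_similar (rot3 m l) c C"
    have "(m - x) * ((l - x)^2 + 1) = (p - x) * (q - x) * (r - x)" for x
      using scaled_similar_det[OF s, of x] unfolding that charpoly_3_1 .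
    then show False by (rule complex_not_split)
  qed
  show "\<not> scaled_similar (rot3 m l) c (block3)"
    "\<not> scaled_similar (rot3 m l) c (block2 a)"
    "\<not> scaled_similar (rot3 m l) c (diag3 1 a b)"
    by (rule no, rule charpoly_3)+
qed

text \<open>The only real root gives \<open>m = c m'\<close>, so \<open>c > 0\<close>. Comparing the
  quadratic factors at two points gives \<open>l = c l'\<close> and \<open>c^2 = 1\<close>.\<close>

lemma complex_similar_eq:
  assumes s: "scaled_similar (rot3 m l) c (rot3 m' l')"
    and pos: "m > 0" "m' > 0"
  shows "m = m' \<and> l = l'"
proof -
  have p: "(m - x) * ((l - x)^2 + 1) = (c * m' - x) * ((c * l' - x)^2 + c^2)" for x
    using scaled_similar_det[OF s, of x] unfolding charpoly_3 charpoly_3_1 by simp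
  have q: "(l - x)^2 + 1 \<noteq> 0" for x using zero_le_power2[of "l - x"] by linarith
  have m: "m = c * m'" using p[of "c * m'"] q by auto
  have "(l - (m - 1))^2 + 1 = (c * l' - (m - 1))^2 + c^2" "(l - (m + 1))^2 + 1 = (c * l' - (m + 1))^2 + c^2"
    using p[of "m - 1"] p[of "m + 1"] unfolding m[symmetric] by simp_all
  then have l: "l = c * l'" and "c^2 = 1" by algebra+
  moreover have "c > 0" using m pos by (simp add: zero_less_mult_iff)
  ultimately have "c = 1" by (simp add: power2_eq_1_iff)
  then show ?thesis using m l by simp
qed

text \<open>Both matrices have 1 as an eigenvalue of largest absolute value. As \<open>c\<close> is
  among 1, m, l and 1 is among c, c m', c l', the absolute value of \<open>c\<close> is 1; the
  excluded endpoint -1 leaves \<open>c = 1\<close>, and the ordering settles the rest.\<close>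

lemma diagonal3_similar_eq:
  assumes s: "scaled_similar (diag3 1 m l) c (diag3 1 m' l')"
    and r: "m \<in> {-1<..1}" "l \<in> {-1<..1}" "m' \<in> {-1<..1}" "l' \<in> {-1<..1}" "m \<le> l" "m' \<le> l'"
  shows "m = m' \<and> l = l'"
proof -
  have p: "(1 - x) * (m - x) * (l - x) = (c - x) * (c * m' - x) * (c * l' - x)" for x
    using scaled_similar_det[OF s, of x] unfolding charpoly_3 charpoly_3_1 by simp
  have c1: "c = 1 \<or> c = m \<or> c = l" using p[of c] by auto
  have c2: "c = 1 \<or> c * m' = 1 \<or> c * l' = 1" using p[of 1] by auto
  have "\<bar>c\<bar> \<le> 1" using c1 r by auto
  moreover have "\<bar>c\<bar> \<ge> 1"
  proof -
    have "\<bar>c\<bar> \<ge> 1" if "c * t = 1" "\<bar>t\<bar> \<le> 1" for t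
      using that mult_left_le[of "\<bar>t\<bar>" "\<bar>c\<bar>"] by (metis abs_ge_zero abs_mult abs_one)
    moreover have "\<bar>m'\<bar> \<le> 1" "\<bar>l'\<bar> \<le> 1" using r by auto
    ultimately show ?thesis using c2 by auto
  qed
  ultimately have "c = 1 \<or> c = - 1" by linarith
  then have c: "c = 1" using c1 r by auto
  have "m * l = m' * l'" "m + l = m' + l'" using p[of 0] p[of 2] unfolding c by (simp_all add: algebra_simps)
  then have "(m - m') * (m - l') = 0" by algebra
  then have "m = m' \<or> m = l'" by simp
  then show ?thesis using \<open>m + l = m' + l'\<close> r by linarith
qed

section \<open>Distinct labels give non-isomorphic algebras\<close>

lemma sd3_iso_similar:
  "trivial_2_3 (sd3 B) \<Longrightarrow> lie_isomorphic (sd3 B) (sd3 B') \<Longrightarrow> \<exists>c. scaled_similar B c B'"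
  unfolding trivial_sd3 scaled_similar_def using sd3_isoD by blast

lemma sd4_iso_similar:
  "trivial_2_3 (sd4 A) \<Longrightarrow> lie_isomorphic (sd4 A) (sd4 A') \<Longrightarrow> \<exists>c. scaled_similar A c A'"
  unfolding trivial_sd4 scaled_similar_def using sd4_isoD by blast

lemma hs4_iso_similar:
  "trivial_2_3 (hs4 B) \<Longrightarrow> lie_isomorphic (hs4 B) (hs4 B') \<Longrightarrow> \<exists>c. scaled_similar B c B'"
  unfolding trivial_hs4 scaled_similar_def using hs4_isoD by blast

lemma listed3_unique:
  assumes st: "listed3 s" "listed3 t" and iso: "lie_isomorphic (bracket3 s) (bracket3 t)"
  shows "s = t"
proof -
  \<comment> \<open>Both directions are recorded because each non-similarity result is stated for
    one order of the two types only.\<close>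
  obtain c c' where c: "scaled_similar (matrix3 s) c (matrix3 t)" "scaled_similar (matrix3 t) c' (matrix3 s)"
    using sd3_iso_similar[of "matrix3 s" "matrix3 t"] sd3_iso_similar[of "matrix3 t" "matrix3 s"]
      listed3_trivial(2)[OF st(1)] listed3_trivial(2)[OF st(2)] iso lie_isomorphic_sym[OF iso]
    unfolding bracket3_eq by blast
  note no = jordan_not_similar_diagonal jordan_not_similar_rotation diagonal_not_similar_rotation
  show ?thesis
  proof (cases s)
    case R3
    then show ?thesis using c by (cases t) (auto simp: no)
  next
    case s: (R3_lambda l)
    show ?thesis using c st by (cases t) (auto simp: s no dest: diagonal_similar_eq_3)
  next
    case s: (R3'_lambda l)
    show ?thesis using c st by (cases t) (auto simp: s no dest: rotation_similar_eq)
  qed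
qed

lemma listed4_cases:
  assumes "listed4 t"
  obtains A where "bracket4 t = sd4 A" "trivial_2_3 (sd4 A)" "t = R4 \<and> A = block3 \<or>
      (\<exists>l. t = R4_lambda l \<and> A = block2 l) \<or>
      (\<exists>m l. t = R4_mu_lambda m l \<and> A = diag3 1 m l) \<or>
      (\<exists>m l. t = R4'_mu_lambda m l \<and> A = rot3 m l)"
  | B where "bracket4 t = hs4 B" "trivial_2_3 (hs4 B)" "t = H4 \<and> B = jordan2 \<or>
      (\<exists>l. t = D4_lambda l \<and> B = diag2 l (1 - l)) \<or> (\<exists>l. t = D4'_lambda l \<and> B = rot2 l)"
  using listed4_trivial(2)[OF assms] that
  by (cases t) (simp_all only: bracket4_abelian bracket4_heisenberg, simp_all)

lemma listed4_unique:
  assumes st: "listed4 s" "listed4 t" and iso: "lie_isomorphic (bracket4 s) (bracket4 t)"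
  shows "s = t"
proof -
  note iso' = lie_isomorphic_sym[OF iso]
  have eq_sd4: "scaled_similar (block2 k) c (block2 l) \<Longrightarrow> R4_lambda k = R4_lambda l"
    "listed4 (R4_mu_lambda m l) \<Longrightarrow> listed4 (R4_mu_lambda m' l') \<Longrightarrow>
      scaled_similar (diag3 1 m l) c (diag3 1 m' l') \<Longrightarrow>
      R4_mu_lambda m l = R4_mu_lambda m' l'"
    "listed4 (R4'_mu_lambda m l) \<Longrightarrow> listed4 (R4'_mu_lambda m' l') \<Longrightarrow>
      scaled_similar (rot3 m l) c (rot3 m' l') \<Longrightarrow>
      R4'_mu_lambda m l = R4'_mu_lambda m' l'" for k l m l' m' c
    using block2_similar_eq[of k c l] diagonal3_similar_eq[of m l c m' l'] complex_similar_eq[of m l c m' l']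
    by (simp_all add: param_R_def)
  have eq_hs4: "listed4 (D4_lambda k) \<Longrightarrow> listed4 (D4_lambda l) \<Longrightarrow>
      scaled_similar (diag2 k (1 - k)) c (diag2 l (1 - l)) \<Longrightarrow> D4_lambda k = D4_lambda l"
    "listed4 (D4'_lambda k) \<Longrightarrow> listed4 (D4'_lambda l) \<Longrightarrow>
      scaled_similar (rot2 k) c (rot2 l) \<Longrightarrow> D4'_lambda k = D4'_lambda l" for k l c
    using diagonal_similar_eq_4[of k c l] rotation_similar_eq[of k c l] by simp_all
  show ?thesis
  proof (cases rule: listed4_cases[OF st(1)]; cases rule: listed4_cases[OF st(2)])
    fix A A' assume A: "bracket4 s = sd4 A" "trivial_2_3 (sd4 A)" and A': "bracket4 t = sd4 A'" "trivial_2_3 (sd4 A')"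
      and sA: "s = R4 \<and> A = block3 \<or> (\<exists>l. s = R4_lambda l \<and> A = block2 l) \<or>
      (\<exists>m l. s = R4_mu_lambda m l \<and> A = diag3 1 m l) \<or>
      (\<exists>m l. s = R4'_mu_lambda m l \<and> A = rot3 m l)"
      and tA: "t = R4 \<and> A' = block3 \<or> (\<exists>l. t = R4_lambda l \<and> A' = block2 l) \<or>
      (\<exists>m l. t = R4_mu_lambda m l \<and> A' = diag3 1 m l) \<or>
      (\<exists>m l. t = R4'_mu_lambda m l \<and> A' = rot3 m l)"
    obtain c c' where c: "scaled_similar A c A'" "scaled_similar A' c' A"
      using sd4_iso_similar[OF A(2), of A'] sd4_iso_similar[OF A'(2), of A] iso iso'
      unfolding A(1) A'(1) by blast
    note no = block3_not_similar_diagonal block2_not_similar_diagonal block3_not_similar_block2 complex_not_similar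
    from sA tA c st show "s = t"
      by (elim disjE exE conjE; hypsubst)
        (rule refl | (rule eq_sd4; assumption) | (rule no[THEN notE], assumption))+
  next
    fix B B' assume B: "bracket4 s = hs4 B" "trivial_2_3 (hs4 B)" and B': "bracket4 t = hs4 B'" "trivial_2_3 (hs4 B')"
      and sB: "s = H4 \<and> B = jordan2 \<or> (\<exists>l. s = D4_lambda l \<and> B = diag2 l (1 - l)) \<or>
      (\<exists>l. s = D4'_lambda l \<and> B = rot2 l)"
      and tB: "t = H4 \<and> B' = jordan2 \<or> (\<exists>l. t = D4_lambda l \<and> B' = diag2 l (1 - l)) \<or>
      (\<exists>l. t = D4'_lambda l \<and> B' = rot2 l)"
    obtain c c' where c: "scaled_similar B c B'" "scaled_similar B' c' B"
      using hs4_iso_similar[OF B(2), of B'] hs4_iso_similar[OF B'(2), of B] iso iso'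
      unfolding B(1) B'(1) by blast
    note no = jordan_not_similar_diagonal jordan_not_similar_rotation diagonal_not_similar_rotation
    from sB tB c st show "s = t"
      by (elim disjE exE conjE; hypsubst)
        (rule refl | (rule eq_hs4; assumption) | (rule no[THEN notE], assumption))+
  next
    fix A B assume "bracket4 s = sd4 A" "trivial_2_3 (sd4 A)" "bracket4 t = hs4 B"
    then show "s = t" using iso sd4_not_hs4[of A B] by (simp add: trivial_sd4)
  next
    fix A B assume "bracket4 s = hs4 B" "trivial_2_3 (sd4 A)" "bracket4 t = sd4 A"
    then show "s = t" using iso' sd4_not_hs4[of A B] by (simp add: trivial_sd4)
  qed
qed

section \<open>Arbitrary real vector spaces of dimension three and four\<close>

lemma transport_to_coordinates:
  fixes br :: "'a::real_vector \<Rightarrow> 'a \<Rightarrow> 'a"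
  assumes "lie_algebra br" "dim (UNIV :: 'a set) = CARD('n::finite)" "trivial_2_3 br"
  obtains br' :: "real ^ 'n \<Rightarrow> real ^ 'n \<Rightarrow> real ^ 'n"
  where "lie_isomorphic br br'" "lie_algebra br'" "H2_zero br'" "H3_zero br'"
proof -
  obtain f :: "real ^ 'n \<Rightarrow> 'a" where f: "linear f" "bij f"
    using dim_UNIV_linear_bij[OF assms(2)] by blast
  let ?br = "\<lambda>x y. inv f (br (f x) (f y))"
  have iso: "lie_isomorphic ?br br" by (rule lie_isomorphic_pullback[OF f])
  \<comment> \<open>The images of the standard basis form the finite spanning set over which
    vanishing Betti numbers become exactness.\<close>
  have span: "span (f ` Basis) = UNIV"
    using f by (simp add: linear_span_image bij_is_surj)
  have "H2_zero br" "H3_zero br"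
    using trivial_2_3_iff[OF _ span, of br] assms(3) by simp_all
  then show thesis
    using that[OF lie_isomorphic_sym[OF iso] lie_isomorphic_lie_algebra[OF iso assms(1)]]
      H2_zero_iso[OF lie_isomorphic_sym[OF iso]] H3_zero_iso[OF lie_isomorphic_sym[OF iso]] by blast
qed

lemma classification_dim_3:
  fixes br :: "'a::real_vector \<Rightarrow> 'a \<Rightarrow> 'a"
  assumes "lie_algebra br" "dim (UNIV :: 'a set) = 3" "trivial_2_3 br"
  shows "\<exists>!t. listed3 t \<and> lie_isomorphic br (bracket3 t)"
proof (rule ex_ex1I)
  have "dim (UNIV :: 'a set) = CARD(3)" using assms(2) by simp
  from transport_to_coordinates[OF assms(1) this assms(3)]
  obtain br' :: "real ^ 3 \<Rightarrow> real ^ 3 \<Rightarrow> real ^ 3" where br': "lie_isomorphic br br'" "lie_algebra br'"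
    "H2_zero br'" "H3_zero br'" .
  obtain B where B: "lie_isomorphic br' (sd3 B)" using reduction_3[OF br'(2-4)] by blast
  have "trivial_2_3 (sd3 B)"
    using H2_zero_iso[OF B br'(3)] H3_zero_iso[OF B br'(4)] by (simp add: trivial_2_3_iff_euclidean)
  then obtain t where t: "listed3 t" "lie_isomorphic (bracket3 t) (sd3 B)" using classification_3 by blast
  have "lie_isomorphic br (bracket3 t)"
    by (rule lie_isomorphic_trans[OF br'(1) lie_isomorphic_trans[OF B lie_isomorphic_sym[OF t(2)]]])
  then show "\<exists>t. listed3 t \<and> lie_isomorphic br (bracket3 t)" using t(1) by blast
next
  fix s t assume s: "listed3 s \<and> lie_isomorphic br (bracket3 s)" and t: "listed3 t \<and> lie_isomorphic br (bracket3 t)"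
  have "lie_isomorphic (bracket3 s) (bracket3 t)"
    by (rule lie_isomorphic_trans[OF lie_isomorphic_sym[OF conjunct2[OF s]] conjunct2[OF t]])
  with s t show "s = t" using listed3_unique by simp
qed

lemma classification_dim_4:
  fixes br :: "'a::real_vector \<Rightarrow> 'a \<Rightarrow> 'a"
  assumes "lie_algebra br" "dim (UNIV :: 'a set) = 4" "trivial_2_3 br"
  shows "\<exists>!t. listed4 t \<and> lie_isomorphic br (bracket4 t)"
proof (rule ex_ex1I)
  have "dim (UNIV :: 'a set) = CARD(4)" using assms(2) by simp
  from transport_to_coordinates[OF assms(1) this assms(3)]
  obtain br' :: "real ^ 4 \<Rightarrow> real ^ 4 \<Rightarrow> real ^ 4" where br': "lie_isomorphic br br'" "lie_algebra br'"
    "H2_zero br'" "H3_zero br'" .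
  have tr: "trivial_2_3 g" if "lie_isomorphic br' g" for g :: "real ^ 4 \<Rightarrow> real ^ 4 \<Rightarrow> real ^ 4"
    using H2_zero_iso[OF that br'(3)] H3_zero_iso[OF that br'(4)] by (simp add: trivial_2_3_iff_euclidean)
  have "\<exists>g :: real ^ 4 \<Rightarrow> real ^ 4 \<Rightarrow> real ^ 4. lie_isomorphic br' g \<and> (\<exists>t. listed4 t \<and> lie_isomorphic (bracket4 t) g)"
    using reduction_4[OF br'(2-4)]
  proof (elim disjE exE)
    fix A assume A: "lie_isomorphic br' (sd4 A)"
    show ?thesis by (rule exI[of _ "sd4 A"], rule conjI[OF A classification_sd4[OF tr[OF A]]])
  next
    fix B assume B: "lie_isomorphic br' (hs4 B)"
    show ?thesis by (rule exI[of _ "hs4 B"], rule conjI[OF B classification_hs4[OF tr[OF B]]])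
  qed
  then obtain g :: "real ^ 4 \<Rightarrow> real ^ 4 \<Rightarrow> real ^ 4" and t where g: "lie_isomorphic br' g" "listed4 t" "lie_isomorphic (bracket4 t) g" by blast
  have "lie_isomorphic br (bracket4 t)"
    by (rule lie_isomorphic_trans[OF br'(1) lie_isomorphic_trans[OF g(1) lie_isomorphic_sym[OF g(3)]]])
  then show "\<exists>t. listed4 t \<and> lie_isomorphic br (bracket4 t)" using g(2) by blast
next
  fix s t assume s: "listed4 s \<and> lie_isomorphic br (bracket4 s)" and t: "listed4 t \<and> lie_isomorphic br (bracket4 t)"
  have "lie_isomorphic (bracket4 s) (bracket4 t)"
    by (rule lie_isomorphic_trans[OF lie_isomorphic_sym[OF conjunct2[OF s]] conjunct2[OF t]])
  with s t show "s = t" using listed4_unique by simp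
qed

theorem proposition4p2:
  shows "(\<forall>t. listed3 t \<longrightarrow> lie_algebra (bracket3 t) \<and> trivial_2_3 (bracket3 t)) \<and>
    (\<forall>s t. listed3 s \<and> listed3 t \<and> lie_isomorphic (bracket3 s) (bracket3 t) \<longrightarrow> s = t) \<and>
    (\<forall>br :: 'a::real_vector \<Rightarrow> 'a \<Rightarrow> 'a.
       lie_algebra br \<and> dim (UNIV :: 'a set) = 3 \<and> trivial_2_3 br \<longrightarrow>
         (\<exists>!t. listed3 t \<and> lie_isomorphic br (bracket3 t))) \<and>
    (\<forall>t. listed4 t \<longrightarrow> lie_algebra (bracket4 t) \<and> trivial_2_3 (bracket4 t)) \<and>
    (\<forall>s t. listed4 s \<and> listed4 t \<and> lie_isomorphic (bracket4 s) (bracket4 t) \<longrightarrow> s = t) \<and>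
    (\<forall>br :: 'a \<Rightarrow> 'a \<Rightarrow> 'a.
       lie_algebra br \<and> dim (UNIV :: 'a set) = 4 \<and> trivial_2_3 br \<longrightarrow>
         (\<exists>!t. listed4 t \<and> lie_isomorphic br (bracket4 t)))"
proof (intro conjI allI impI)
  show "lie_algebra (bracket3 t)" "trivial_2_3 (bracket3 t)" if "listed3 t" for t
    using listed3_trivial[OF that] .
  show "lie_algebra (bracket4 t)" "trivial_2_3 (bracket4 t)" if "listed4 t" for t
    using listed4_trivial[OF that] .
  show "s = t" if "listed3 s \<and> listed3 t \<and> lie_isomorphic (bracket3 s) (bracket3 t)" for s t
    using listed3_unique that by blast
  show "s = t" if "listed4 s \<and> listed4 t \<and> lie_isomorphic (bracket4 s) (bracket4 t)" for s t
    using listed4_unique that by blast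
  show "\<exists>!t. listed3 t \<and> lie_isomorphic br (bracket3 t)"
    if "lie_algebra br \<and> dim (UNIV :: 'a set) = 3 \<and> trivial_2_3 br" for br :: "'a \<Rightarrow> 'a \<Rightarrow> 'a"
    using classification_dim_3[of br] that by simp
  show "\<exists>!t. listed4 t \<and> lie_isomorphic br (bracket4 t)"
    if "lie_algebra br \<and> dim (UNIV :: 'a set) = 4 \<and> trivial_2_3 br" for br :: "'a \<Rightarrow> 'a \<Rightarrow> 'a"
    using classification_dim_4[of br] that by simp
qed

end
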